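(* Let $(M_t)_{0\le t<T}$ be a maximal solution of the Gauss curvature flow $\frac{d}{dt}X=-K\nu$ of closed strictly convex hypersurfaces in $\mathbb{R}^{4}$, where $M_0$ is $2$-pinched. Let $$\psi_K=\left(\frac{(a-b)^2}{(ab)^2}+\frac{(a-c)^2}{(ac)^2}+\frac{(b-c)^2}{(bc)^2}\right)K^2,$$ where $a,b,c$ are the principal curvatures. Then $\max_{M_t}\psi_K$ is non-increasing in time $t\in[0,T)$.
   Context: Hypersurfaces are smooth, closed (compact, without boundary), embedded, of dimension $n=3$ in Euclidean $\mathbb{R}^4$, with outer unit normal $\nu$, induced metric $g_{ij}=\langle X_{,i},X_{,j}\rangle$, second fundamental form $h_{ij}=-\langle X_{,ij},\nu\rangle$, and principal curvatures $a=\lambda_1,\ b=\lambda_2,\ c=\lambda_3$ (the eigenvalues of $(h_{ij})$ with respect to $(g_{ij})$). Strictly convex means that all $\lambda_i>0$. $K=abc$ is the Gauss curvature. A solution of the flow is a smooth time-dependent family of embeddings $X(\cdot,t)$ with image $M_t$, $0\le t<T$, satisfying $\frac{d}{dt}X=-K\nu$ and starting at $M_0$; it is maximal if it cannot be extended as a smooth solution beyond time $T$. $M_0$ is $2$-pinched if $\lambda_i/\lambda_j\le 2$ everywhere on $M_0$ for all $1\le i,j\le 3$. *)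

theory Defs
  imports "HOL-Analysis.Analysis"
begin

text \<open>The derivative is taken within \<open>S\<close>, so that functions on a space-time cylinder
  \<open>U \<times> [0,T)\<close> are differentiated one-sidedly in time at \<open>t = 0\<close>. Only sets \<open>S\<close> on which
  derivatives within \<open>S\<close> are unique (open sets and such cylinders) are used below.\<close>

fun Ck_on :: "nat \<Rightarrow> 'a::euclidean_space set \<Rightarrow> ('a \<Rightarrow> 'b::real_normed_vector) \<Rightarrow> bool" where
  "Ck_on 0 S f \<longleftrightarrow> continuous_on S f"
| "Ck_on (Suc k) S f \<longleftrightarrow>
     (\<exists>D. (\<forall>x\<in>S. (f has_derivative D x) (at x within S)) \<and> (\<forall>v. Ck_on k S (\<lambda>x. D x v)))"

definition smooth_on :: "'a::euclidean_space set \<Rightarrow> ('a \<Rightarrow> 'b::real_normed_vector) \<Rightarrow> bool" where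
  "smooth_on S f \<longleftrightarrow> (\<forall>k. Ck_on k S f)"

definition partial :: "3 \<Rightarrow> (real^3 \<Rightarrow> 'b::real_normed_vector) \<Rightarrow> real^3 \<Rightarrow> 'b" where
  "partial i f x = frechet_derivative f (at x) (axis i 1)"

text \<open>A chart \<open>(U, \<phi>)\<close> is a local parametrization \<open>\<phi> : U \<rightarrow> M\<close>, i.e. the inverse of a
  coordinate map.\<close>

type_synonym 'm chart = "(real^3) set \<times> (real^3 \<Rightarrow> 'm)"

definition smooth_atlas :: "'m::t2_space set \<Rightarrow> 'm chart set \<Rightarrow> bool" where
  "smooth_atlas M A \<longleftrightarrow>
     (\<forall>(U, \<phi>)\<in>A. open U \<and> openin (top_of_set M) (\<phi> ` U) \<and> (\<exists>\<theta>. homeomorphism U (\<phi> ` U) \<phi> \<theta>)) \<and>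
     (\<Union>(U, \<phi>)\<in>A. \<phi> ` U) = M \<and>
     (\<forall>(U, \<phi>)\<in>A. \<forall>(V, \<psi>)\<in>A.
        smooth_on (U \<inter> \<phi> -` (\<psi> ` V)) (\<lambda>x. inv_into V \<psi> (\<phi> x)))"

definition closed_manifold :: "'m::t2_space set \<Rightarrow> 'm chart set \<Rightarrow> bool" where
  "closed_manifold M A \<longleftrightarrow> compact M \<and> smooth_atlas M A"

definition smooth_embedding ::
    "'m::t2_space set \<Rightarrow> 'm chart set \<Rightarrow> ('m \<Rightarrow> real^4) \<Rightarrow> bool" where
  "smooth_embedding M A F \<longleftrightarrow>
     (\<forall>(U, \<phi>)\<in>A. smooth_on U (F \<circ> \<phi>) \<and>
        (\<forall>x\<in>U. inj (frechet_derivative (F \<circ> \<phi>) (at x)))) \<and>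
     (\<exists>G. homeomorphism M (F ` M) F G)"

text \<open>Here \<open>Y\<close> is a local parametrization of the hypersurface, \<open>x\<close> a point of its domain and
  \<open>n\<close> a unit normal at \<open>Y x\<close>.\<close>

definition induced_metric :: "(real^3 \<Rightarrow> real^4) \<Rightarrow> real^3 \<Rightarrow> real^3^3" where
  "induced_metric Y x = (\<chi> i j. partial i Y x \<bullet> partial j Y x)"

definition second_fundamental_form ::
    "(real^3 \<Rightarrow> real^4) \<Rightarrow> real^4 \<Rightarrow> real^3 \<Rightarrow> real^3^3" where
  "second_fundamental_form Y n x = (\<chi> i j. - (partial j (partial i Y) x \<bullet> n))"

text \<open>The components of \<open>l\<close> are the eigenvalues of \<open>h\<close> with respect to \<open>g\<close>, repeated according
  to multiplicity and in no particular order: there is a basis of eigenvectors belonging to them.\<close>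

definition relative_eigenvalues :: "real^3^3 \<Rightarrow> real^3^3 \<Rightarrow> real^3 \<Rightarrow> bool" where
  "relative_eigenvalues g h l \<longleftrightarrow>
     (\<exists>e :: 3 \<Rightarrow> real^3. inj e \<and> independent (range e) \<and>
        (\<forall>i. h *v e i = (l $ i) *\<^sub>R (g *v e i)))"

text \<open>The set \<open>S\<close> is the whole hypersurface; outer means pointing into the unbounded part of
  its complement.\<close>

definition outer_unit_normal ::
    "(real^4) set \<Rightarrow> (real^3 \<Rightarrow> real^4) \<Rightarrow> real^3 \<Rightarrow> real^4 \<Rightarrow> bool" where
  "outer_unit_normal S Y x n \<longleftrightarrow>
     norm n = 1 \<and> (\<forall>i. partial i Y x \<bullet> n = 0) \<and>
     (\<forall>\<^sub>F s in at_right 0. Y x + s *\<^sub>R n \<in> outside S)"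

definition outer_normal_field ::
    "'m::t2_space set \<Rightarrow> 'm chart set \<Rightarrow> ('m \<Rightarrow> real^4) \<Rightarrow> ('m \<Rightarrow> real^4) \<Rightarrow> bool" where
  "outer_normal_field M A F \<nu> \<longleftrightarrow>
     (\<forall>(U, \<phi>)\<in>A. \<forall>x\<in>U. outer_unit_normal (F ` M) (F \<circ> \<phi>) x (\<nu> (\<phi> x)))"

definition principal_curvatures ::
    "'m chart set \<Rightarrow> ('m \<Rightarrow> real^4) \<Rightarrow> ('m \<Rightarrow> real^4) \<Rightarrow> ('m \<Rightarrow> real^3) \<Rightarrow> bool" where
  "principal_curvatures A F \<nu> \<kappa> \<longleftrightarrow>
     (\<forall>(U, \<phi>)\<in>A. \<forall>x\<in>U. relative_eigenvalues
        (induced_metric (F \<circ> \<phi>) x) (second_fundamental_form (F \<circ> \<phi>) (\<nu> (\<phi> x)) x) (\<kappa> (\<phi> x)))"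

definition gauss_curvature :: "real^3 \<Rightarrow> real" where
  "gauss_curvature l = l $ 1 * l $ 2 * l $ 3"

definition strictly_convex :: "'m set \<Rightarrow> ('m \<Rightarrow> real^3) \<Rightarrow> bool" where
  "strictly_convex M \<kappa> \<longleftrightarrow> (\<forall>p\<in>M. \<forall>i. \<kappa> p $ i > 0)"

definition two_pinched :: "'m set \<Rightarrow> ('m \<Rightarrow> real^3) \<Rightarrow> bool" where
  "two_pinched M \<kappa> \<longleftrightarrow> (\<forall>p\<in>M. \<forall>i j. \<kappa> p $ i / \<kappa> p $ j \<le> 2)"

definition psi_K :: "real^3 \<Rightarrow> real" where
  "psi_K l = (let a = l $ 1; b = l $ 2; c = l $ 3 in
     ((a - b)^2 / (a * b)^2 + (a - c)^2 / (a * c)^2 + (b - c)^2 / (b * c)^2)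
       * (gauss_curvature l)^2)"

text \<open>The existence time may a priori be infinite.\<close>

definition time_interval :: "ereal \<Rightarrow> real set" where
  "time_interval T = {t. 0 \<le> t \<and> ereal t < T}"

definition smooth_family ::
    "'m chart set \<Rightarrow> ereal \<Rightarrow> (real \<Rightarrow> 'm \<Rightarrow> real^4) \<Rightarrow> bool" where
  "smooth_family A T X \<longleftrightarrow>
     (\<forall>(U, \<phi>)\<in>A. smooth_on (U \<times> time_interval T) (\<lambda>(x, t). X t (\<phi> x)))"

text \<open>The outer unit normals \<open>\<nu>\<close> and the principal curvatures \<open>\<kappa>\<close> are determined by \<open>X\<close>
  (\<open>\<kappa>\<close> up to the order of its components). They are carried along as arguments so as to have names
  for them.\<close>

definition gauss_curvature_flow ::
    "'m::t2_space set \<Rightarrow> 'm chart set \<Rightarrow> ereal \<Rightarrow> (real \<Rightarrow> 'm \<Rightarrow> real^4) \<Rightarrow>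
     (real \<Rightarrow> 'm \<Rightarrow> real^4) \<Rightarrow> (real \<Rightarrow> 'm \<Rightarrow> real^3) \<Rightarrow> bool" where
  "gauss_curvature_flow M A T X \<nu> \<kappa> \<longleftrightarrow>
     0 < T \<and> smooth_family A T X \<and>
     (\<forall>t\<in>time_interval T.
        smooth_embedding M A (X t) \<and>
        outer_normal_field M A (X t) (\<nu> t) \<and>
        principal_curvatures A (X t) (\<nu> t) (\<kappa> t) \<and>
        (\<forall>p\<in>M. ((\<lambda>s. X s p) has_vector_derivative - gauss_curvature (\<kappa> t p) *\<^sub>R \<nu> t p)
                   (at t within time_interval T)))"

definition maximal_gauss_curvature_flow ::
    "'m::t2_space set \<Rightarrow> 'm chart set \<Rightarrow> ereal \<Rightarrow> (real \<Rightarrow> 'm \<Rightarrow> real^4) \<Rightarrow>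
     (real \<Rightarrow> 'm \<Rightarrow> real^4) \<Rightarrow> (real \<Rightarrow> 'm \<Rightarrow> real^3) \<Rightarrow> bool" where
  "maximal_gauss_curvature_flow M A T X \<nu> \<kappa> \<longleftrightarrow>
     gauss_curvature_flow M A T X \<nu> \<kappa> \<and>
     \<not> (\<exists>T' X' \<nu>' \<kappa>'. T < T' \<and> gauss_curvature_flow M A T' X' \<nu>' \<kappa>' \<and>
          (\<forall>t\<in>time_interval T. \<forall>p\<in>M. X' t p = X t p))"

end

theory Submission
  imports Defs
begin

text \<open>The maximum principle in local form. With \<open>r\<^sub>i = 1 / \<lambda>\<^sub>i\<close> one has
  \<open>\<psi> = K\<^sup>2 \<Sum> (r\<^sub>i - r\<^sub>j)\<^sup>2 = 2 E\<^sub>2\<^sup>2 - 6 E\<^sub>1 E\<^sub>3\<close> in the elementary symmetric functions of the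
  principal curvatures, a polynomial in the Weingarten map. At a spatial maximum of \<open>\<psi>\<close> the
  zeroth order terms of \<open>(\<partial>\<^sub>t - K h\<^sup>i\<^sup>j \<nabla>\<^sub>i \<nabla>\<^sub>j) \<psi>\<close> cancel exactly. The remaining quadratic form in
  the derivatives of the second fundamental form is negative semidefinite as long as the hypersurface is
  2-pinched.

  Pinching is preserved because \<open>h(v,v) g(w,w) - 2 h(w,w) g(v,v)\<close>, as a function of the point and of
  the tangent vectors \<open>v\<close>, \<open>w\<close>, has a strictly negative time derivative at every point where its
  maximum is zero: moving \<open>v\<close> and \<open>w\<close> along with the point absorbs the gradient terms, and the
  reaction term is \<open>- 4 K \<lambda>\<^sub>3\<^sup>2\<close>.

  All computations take place at one point in a parametrization in which the metric is Euclidean and the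
  Christoffel symbols vanish there. Since \<open>K > 0\<close>, the velocity \<open>- K \<nu>\<close> determines \<open>K\<close> and \<open>\<nu>\<close>, so
  both are smooth in space and time.\<close>

subsection \<open>Calculus of smooth functions\<close>

text \<open>Principal curvatures are not smooth where they coincide, and the Weingarten map involves
  the inverse metric. Both preserved inequalities are therefore expressed by polynomials in the
  entries of \<open>g\<close> and \<open>h\<close>: a gap
  \<open>psi_numerator g h - c * (det3 g)^2\<close>, which is psi minus \<open>c\<close> up to a
  positive factor, and a comparison of quadratic forms in two free tangent vectors.

  No first time of contact is sought. If an inequality holds on a whole time slice, every point of
  equality is a spatial maximum on that slice; a negative one-sided time derivative there lets the
  inequality continue for a short while. Compactness makes this uniform, continuity closes the set
  of good times, and continuous induction reaches every time, the start at 0 included. For pinching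
  the derivative is strictly negative. For psi it is only nonpositive, so the bound is relaxed to
  \<open>c + eps * (t - s)\<close>. Pinching comes first, because the sign of the psi gradient terms
  is derived from it.\<close>

definition approachable :: "'a::euclidean_space set \<Rightarrow> bool" where
  "approachable S \<longleftrightarrow>
     (\<forall>x\<in>S. \<forall>i\<in>Basis. \<forall>e>0. \<exists>d. 0 < \<bar>d\<bar> \<and> \<bar>d\<bar> < e \<and> x + d *\<^sub>R i \<in> S)"

definition dd :: "'a::euclidean_space set \<Rightarrow> 'a \<Rightarrow> ('a \<Rightarrow> 'b::real_normed_vector) \<Rightarrow> 'a \<Rightarrow> 'b" where
  "dd S v f x = frechet_derivative f (at x within S) v"

lemma open_approachable:
  assumes "open S" shows "approachable S"
  unfolding approachable_def
proof (intro ballI allI impI)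
  fix x i :: 'a and e :: real assume x: "x \<in> S" and i: "i \<in> Basis" and e: "e > 0"
  obtain r where r: "r > 0" "ball x r \<subseteq> S" using assms x by (meson open_contains_ball)
  define d where "d = min r e / 2"
  have d: "0 < d" "d < r" "d < e" using r(1) e by (auto simp: d_def)
  have "x + d *\<^sub>R i \<in> ball x r" using d i by (simp add: dist_norm)
  then show "\<exists>d. 0 < \<bar>d\<bar> \<and> \<bar>d\<bar> < e \<and> x + d *\<^sub>R i \<in> S"
    using d r(2) by (intro exI[of _ d]) auto
qed

lemma approachable_Times:
  assumes "approachable S" "approachable T"
  shows "approachable (S \<times> T)"
  unfolding approachable_def
proof (intro ballI allI impI)
  fix z i :: "'a \<times> 'b" and e :: real
  assume z: "z \<in> S \<times> T" and i: "i \<in> Basis" and e: "e > 0"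
  from i consider u where "u \<in> Basis" "i = (u, 0)" | w where "w \<in> Basis" "i = (0, w)"
    by (auto simp: Basis_prod_def)
  then show "\<exists>d. 0 < \<bar>d\<bar> \<and> \<bar>d\<bar> < e \<and> z + d *\<^sub>R i \<in> S \<times> T"
  proof cases
    case 1
    then obtain d where "0 < \<bar>d\<bar>" "\<bar>d\<bar> < e" "fst z + d *\<^sub>R u \<in> S"
      using assms(1) z e unfolding approachable_def by (metis mem_Times_iff)
    then show ?thesis using z 1 by (intro exI[of _ d]) (auto simp: mem_Times_iff)
  next
    case 2
    then obtain d where "0 < \<bar>d\<bar>" "\<bar>d\<bar> < e" "snd z + d *\<^sub>R w \<in> T"
      using assms(2) z e unfolding approachable_def by (metis mem_Times_iff)
    then show ?thesis using z 2 by (intro exI[of _ d]) (auto simp: mem_Times_iff)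
  qed
qed

lemma approachable_time_interval: "approachable (time_interval T)"
  unfolding approachable_def
proof (intro ballI allI impI)
  fix t i e :: real
  assume t: "t \<in> time_interval T" and i: "i \<in> Basis" and e: "e > 0"
  have t': "0 \<le> t" "ereal t < T" using t by (auto simp: time_interval_def)
  obtain r where r: "t < r" "ereal r < T"
    using ereal_dense2[OF t'(2)] by auto
  define d where "d = min (r - t) (e / 2)"
  have "0 < d" "d < e" "t + d \<le> r" using r e by (auto simp: d_def)
  moreover have "ereal (t + d) < T" using r(2) \<open>t + d \<le> r\<close> by (meson ereal_less_eq(3) order.strict_trans1)
  ultimately show "\<exists>d. 0 < \<bar>d\<bar> \<and> \<bar>d\<bar> < e \<and> t + d *\<^sub>R i \<in> time_interval T"
    using t' i by (intro exI[of _ d]) (auto simp: time_interval_def)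
qed

text \<open>Approachability along every coordinate axis is what uniqueness of derivatives within a
  set asks for. It makes \<open>dd\<close> unambiguous also on the initial slice of a cylinder,
  where time derivatives are one-sided.\<close>

lemma dd_eq:
  assumes "approachable S" "x \<in> S" "(f has_derivative D) (at x within S)"
  shows "dd S v f x = D v"
proof -
  have "(f has_derivative frechet_derivative f (at x within S)) (at x within S)"
    using assms(3) frechet_derivative_works unfolding differentiable_def by blast
  from frechet_derivative_unique_within[OF this assms(3)]
  have "frechet_derivative f (at x within S) = D"
    using assms(1,2) unfolding approachable_def by blast
  then show ?thesis by (simp add: dd_def)
qed

lemma Ck_on_has_derivative:
  assumes "Ck_on (Suc k) S f" "x \<in> S"
  shows "(f has_derivative (\<lambda>v. dd S v f x)) (at x within S)"
  using assms frechet_derivative_works unfolding dd_def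
  by (auto simp: differentiable_def eta_contract_eq)

lemma Ck_on_cong:
  "(\<And>x. x \<in> S \<Longrightarrow> f x = g x) \<Longrightarrow> Ck_on k S f \<longleftrightarrow> Ck_on k S g"
proof (cases k)
  case 0
  assume "\<And>x. x \<in> S \<Longrightarrow> f x = g x"
  then show ?thesis using 0 by (simp cong: continuous_on_cong)
next
  case (Suc m)
  assume eq: "\<And>x. x \<in> S \<Longrightarrow> f x = g x"
  have "(f has_derivative D) (at x within S) \<longleftrightarrow> (g has_derivative D) (at x within S)"
    if "x \<in> S" for D x
    using eq that has_derivative_transform[of x S f g] has_derivative_transform[of x S g f] by auto
  then show ?thesis using Suc by (simp cong: conj_cong ball_cong)
qed

lemma Ck_on_dd:
  assumes "approachable S" "Ck_on (Suc k) S f"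
  shows "Ck_on k S (dd S v f)"
proof -
  obtain D where D: "\<forall>x\<in>S. (f has_derivative D x) (at x within S)" "\<forall>v. Ck_on k S (\<lambda>x. D x v)"
    using assms(2) by auto
  have "dd S v f x = D x v" if "x \<in> S" for x
    using dd_eq[OF assms(1) that] D(1) that by blast
  then show ?thesis using D(2) Ck_on_cong[of S "dd S v f" "\<lambda>x. D x v" k] by blast
qed

lemma Ck_on_SucI:
  assumes "\<And>x. x \<in> S \<Longrightarrow> (f has_derivative D x) (at x within S)" "\<And>v. Ck_on k S (\<lambda>x. D x v)"
  shows "Ck_on (Suc k) S f"
  using assms by auto

lemma Ck_on_continuous: "Ck_on k S f \<Longrightarrow> continuous_on S f"
proof (cases k)
  case (Suc m)
  moreover assume "Ck_on k S f"
  ultimately show ?thesis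
    unfolding continuous_on_eq_continuous_within using Ck_on_has_derivative has_derivative_continuous by blast
qed simp

lemma Ck_on_Suc_imp: "Ck_on (Suc k) S f \<Longrightarrow> Ck_on k S f"
proof (induction k arbitrary: f)
  case 0 then show ?case unfolding Ck_on.simps(1) by (rule Ck_on_continuous)
next
  case (Suc k)
  then obtain D where D: "\<forall>x\<in>S. (f has_derivative D x) (at x within S)"
    "\<forall>v. Ck_on (Suc k) S (\<lambda>x. D x v)" by auto
  then show ?case using Suc.IH by (intro Ck_on_SucI[of S f D]) blast+
qed

lemma Ck_on_const [simp]: "Ck_on k S (\<lambda>x. c)"
proof (induction k arbitrary: c)
  case (Suc k)
  show ?case by (rule Ck_on_SucI[where D = "\<lambda>x v. 0"]) (use Suc in simp_all)
qed simp

lemma Ck_on_add: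
  "Ck_on k S f \<Longrightarrow> Ck_on k S g \<Longrightarrow> Ck_on k S (\<lambda>x. f x + g x)"
proof (induction k arbitrary: f g)
  case 0 then show ?case by (simp add: continuous_on_add)
next
  case (Suc k)
  obtain D where D: "\<forall>x\<in>S. (f has_derivative D x) (at x within S)" "\<forall>v. Ck_on k S (\<lambda>x. D x v)"
    using Suc.prems by auto
  obtain E where E: "\<forall>x\<in>S. (g has_derivative E x) (at x within S)" "\<forall>v. Ck_on k S (\<lambda>x. E x v)"
    using Suc.prems by auto
  show ?case
    using D E Suc.IH by (intro Ck_on_SucI[of S _ "\<lambda>x v. D x v + E x v"] has_derivative_add) blast+
qed

lemma Ck_on_bilinear:
  assumes b: "bounded_bilinear b"
  shows "Ck_on k S f \<Longrightarrow> Ck_on k S g \<Longrightarrow> Ck_on k S (\<lambda>x. b (f x) (g x))"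
proof (induction k arbitrary: f g)
  case 0 then show ?case by (simp add: bounded_bilinear.continuous_on[OF b])
next
  case (Suc k)
  obtain D where D: "\<forall>x\<in>S. (f has_derivative D x) (at x within S)" "\<forall>v. Ck_on k S (\<lambda>x. D x v)"
    using Suc.prems by auto
  obtain E where E: "\<forall>x\<in>S. (g has_derivative E x) (at x within S)" "\<forall>v. Ck_on k S (\<lambda>x. E x v)"
    using Suc.prems by auto
  have f: "Ck_on k S f" and g: "Ck_on k S g" using Suc.prems Ck_on_Suc_imp by blast+
  show ?case
  proof (rule Ck_on_SucI)
    show "((\<lambda>x. b (f x) (g x)) has_derivative (\<lambda>v. b (f x) (E x v) + b (D x v) (g x))) (at x within S)"
      if "x \<in> S" for x
      using bounded_bilinear.FDERIV[OF b] D(1) E(1) that by blast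
    show "Ck_on k S (\<lambda>x. b (f x) (E x v) + b (D x v) (g x))" for v
      using Suc.IH f g D(2) E(2) by (intro Ck_on_add) blast+
  qed
qed

lemma Ck_on_bounded_linear:
  assumes L: "bounded_linear L"
  shows "Ck_on k S f \<Longrightarrow> Ck_on k S (\<lambda>x. L (f x))"
proof (induction k arbitrary: f)
  case 0 then show ?case by (simp add: bounded_linear.continuous_on[OF L])
next
  case (Suc k)
  obtain D where D: "\<forall>x\<in>S. (f has_derivative D x) (at x within S)" "\<forall>v. Ck_on k S (\<lambda>x. D x v)"
    using Suc.prems by auto
  show ?case
    using D Suc.IH bounded_linear.has_derivative[OF L]
    by (intro Ck_on_SucI[of S _ "\<lambda>x v. L (D x v)"]) blast+
qed

lemma Ck_on_sum:
  "finite A \<Longrightarrow> (\<And>i. i \<in> A \<Longrightarrow> Ck_on k S (f i)) \<Longrightarrow> Ck_on k S (\<lambda>x. \<Sum>i\<in>A. f i x)"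
  by (induction A rule: finite_induct) (auto intro: Ck_on_add)

lemma Ck_on_compose:
  fixes P :: "'a::euclidean_space \<Rightarrow> 'b::euclidean_space" and f :: "'b \<Rightarrow> 'c::real_normed_vector"
  assumes "P ` S' \<subseteq> S"
  shows "Ck_on k S' P \<Longrightarrow> Ck_on k S f \<Longrightarrow> Ck_on k S' (\<lambda>x. f (P x))"
proof (induction k arbitrary: f)
  case 0 then show ?case using assms by (auto intro: continuous_on_compose2)
next
  case (Suc k)
  obtain D where D: "\<forall>x\<in>S'. (P has_derivative D x) (at x within S')" "\<forall>v. Ck_on k S' (\<lambda>x. D x v)"
    using Suc.prems by auto
  obtain E where E: "\<forall>x\<in>S. (f has_derivative E x) (at x within S)" "\<forall>v. Ck_on k S (\<lambda>x. E x v)"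
    using Suc.prems by auto
  have P: "Ck_on k S' P" using Suc.prems Ck_on_Suc_imp by blast
  show ?case
  proof (rule Ck_on_SucI)
    fix x assume x: "x \<in> S'"
    have *: "((\<lambda>x. f (P x)) has_derivative (\<lambda>v. E (P x) (D x v))) (at x within S')"
      using has_derivative_in_compose2[of S f E P S' x "D x"] D(1) E(1) assms x by blast
    interpret L: bounded_linear "E (P x)"
      using E(1) assms x has_derivative_bounded_linear by blast
    \<comment> \<open>The direction \<open>D x v\<close> moves with \<open>x\<close>, whereas
      \<open>Ck_on\<close> controls derivatives in fixed directions only. Expanding it over the
      basis separates the two dependences, and the induction hypothesis applies to each
      \<open>E (P x) i\<close>.\<close>
    have "E (P x) (D x v) = (\<Sum>i\<in>Basis. (D x v \<bullet> i) *\<^sub>R E (P x) i)" for v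
      by (subst euclidean_representation[of "D x v", symmetric]) (simp add: L.sum L.scaleR)
    with * show "((\<lambda>x. f (P x)) has_derivative (\<lambda>v. \<Sum>i\<in>Basis. (D x v \<bullet> i) *\<^sub>R E (P x) i)) (at x within S')"
      by simp
  next
    fix v
    show "Ck_on k S' (\<lambda>x. \<Sum>i\<in>Basis. (D x v \<bullet> i) *\<^sub>R E (P x) i)"
      using D(2) E(2) Suc.IH[OF P]
      by (intro Ck_on_sum finite_Basis Ck_on_bilinear[OF bounded_bilinear_scaleR]
        Ck_on_bounded_linear[OF bounded_linear_inner_left]) blast+
  qed
qed

lemma smooth_on_continuous: "smooth_on S f \<Longrightarrow> continuous_on S f"
  by (auto simp: smooth_on_def intro: Ck_on_continuous)

lemma smooth_on_has_derivative:
  "smooth_on S f \<Longrightarrow> x \<in> S \<Longrightarrow> (f has_derivative (\<lambda>v. dd S v f x)) (at x within S)"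
  using Ck_on_has_derivative unfolding smooth_on_def by blast

lemma smooth_on_dd: "approachable S \<Longrightarrow> smooth_on S f \<Longrightarrow> smooth_on S (dd S v f)"
  using Ck_on_dd unfolding smooth_on_def by blast

lemma smooth_on_cong: "(\<And>x. x \<in> S \<Longrightarrow> f x = g x) \<Longrightarrow> smooth_on S f \<longleftrightarrow> smooth_on S g"
  using Ck_on_cong unfolding smooth_on_def by blast

lemma smooth_on_const [simp]: "smooth_on S (\<lambda>x. c)"
  unfolding smooth_on_def by simp

lemma smooth_on_add: "smooth_on S f \<Longrightarrow> smooth_on S g \<Longrightarrow> smooth_on S (\<lambda>x. f x + g x)"
  unfolding smooth_on_def using Ck_on_add by blast

lemma smooth_on_bounded_linear:
  "bounded_linear L \<Longrightarrow> smooth_on S f \<Longrightarrow> smooth_on S (\<lambda>x. L (f x))"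
  unfolding smooth_on_def using Ck_on_bounded_linear by blast

lemma smooth_on_bilinear:
  "bounded_bilinear b \<Longrightarrow> smooth_on S f \<Longrightarrow> smooth_on S g \<Longrightarrow> smooth_on S (\<lambda>x. b (f x) (g x))"
  unfolding smooth_on_def using Ck_on_bilinear by blast

lemmas smooth_on_mult = smooth_on_bilinear[OF bounded_bilinear_mult]
lemmas smooth_on_inner = smooth_on_bilinear[OF bounded_bilinear_inner]
lemmas smooth_on_scaleR = smooth_on_bilinear[OF bounded_bilinear_scaleR]
lemmas smooth_on_minus = smooth_on_bounded_linear[OF bounded_linear_minus[OF bounded_linear_ident]]

lemma smooth_on_diff: "smooth_on S f \<Longrightarrow> smooth_on S g \<Longrightarrow> smooth_on S (\<lambda>x. f x - g x)"
  using smooth_on_add[of S f "\<lambda>x. - g x"] smooth_on_minus[of S g] by simp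

lemma smooth_on_power:
  fixes f :: "'a::euclidean_space \<Rightarrow> real"
  shows "smooth_on S f \<Longrightarrow> smooth_on S (\<lambda>x. f x ^ n)"
  by (induction n) (auto intro: smooth_on_mult)

lemma smooth_on_sum:
  "finite A \<Longrightarrow> (\<And>i. i \<in> A \<Longrightarrow> smooth_on S (f i)) \<Longrightarrow> smooth_on S (\<lambda>x. \<Sum>i\<in>A. f i x)"
  unfolding smooth_on_def using Ck_on_sum by blast

lemma smooth_on_compose:
  fixes P :: "'a::euclidean_space \<Rightarrow> 'b::euclidean_space"
  shows "P ` S' \<subseteq> S \<Longrightarrow> smooth_on S' P \<Longrightarrow> smooth_on S f \<Longrightarrow> smooth_on S' (\<lambda>x. f (P x))"
  unfolding smooth_on_def using Ck_on_compose by blast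

lemma smooth_on_ident [simp]: "smooth_on S (\<lambda>x. x)"
proof -
  have "Ck_on k S (\<lambda>x. x)" for k
  proof (cases k)
    case (Suc m)
    show ?thesis unfolding Suc by (rule Ck_on_SucI[where D = "\<lambda>x v. v"]) simp_all
  qed simp
  then show ?thesis by (simp add: smooth_on_def)
qed

lemma smooth_on_linear: "bounded_linear L \<Longrightarrow> smooth_on S L"
  using smooth_on_bounded_linear[of L S "\<lambda>x. x"] by simp

text \<open>Multiples of powers form a family closed under differentiation, so the induction runs
  over \<open>c\<close> and \<open>p\<close> at once. The exponents 1/2 and -1 are the ones that
  later extract \<open>K\<close> and \<open>N\<close> from the velocity.\<close>

lemma Ck_on_powr: "Ck_on k {0<..} (\<lambda>x::real. c * x powr p)"
proof (induction k arbitrary: c p)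
  case 0 show ?case by (auto intro!: continuous_intros)
next
  case (Suc k)
  show ?case
  proof (rule Ck_on_SucI)
    fix x :: real assume "x \<in> {0<..}"
    then show "((\<lambda>x. c * x powr p) has_derivative (\<lambda>v. v * (c * p * x powr (p - 1)))) (at x within {0<..})"
      by (auto intro!: derivative_eq_intros simp: has_field_derivative_def[symmetric] powr_diff field_simps)
  next
    fix v :: real
    show "Ck_on k {0<..} (\<lambda>x. v * (c * p * x powr (p - 1)))"
      using Suc.IH[of "v * (c * p)" "p - 1"] by (simp add: mult.assoc)
  qed
qed

lemma smooth_on_powr:
  fixes f :: "'a::euclidean_space \<Rightarrow> real"
  assumes "smooth_on S f" "\<And>x. x \<in> S \<Longrightarrow> f x > 0"
  shows "smooth_on S (\<lambda>x. f x powr p)"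
proof -
  have "smooth_on {0<..} (\<lambda>x::real. x powr p)"
    unfolding smooth_on_def using Ck_on_powr[of _ 1 p] by simp
  then show ?thesis using smooth_on_compose[of f S "{0<..}" "\<lambda>x. x powr p"] assms by auto
qed

lemma dd_cong:
  assumes "x \<in> S" "\<And>y. y \<in> S \<Longrightarrow> f y = g y"
  shows "dd S v f x = dd S v g x"
proof -
  have "(f has_derivative D) (at x within S) \<longleftrightarrow> (g has_derivative D) (at x within S)" for D
    using has_derivative_transform[of x S f g D] has_derivative_transform[of x S g f D] assms by auto
  then show ?thesis by (simp add: dd_def frechet_derivative_def)
qed

lemma dd_const [simp]: "approachable S \<Longrightarrow> x \<in> S \<Longrightarrow> dd S v (\<lambda>x. c) x = 0"
  using dd_eq[of S x "\<lambda>x. c" "\<lambda>_. 0" v] by simp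

lemma dd_add:
  assumes "approachable S" "x \<in> S" "smooth_on S f" "smooth_on S g"
  shows "dd S v (\<lambda>x. f x + g x) x = dd S v f x + dd S v g x"
  by (rule dd_eq[OF assms(1,2)])
    (rule has_derivative_add smooth_on_has_derivative assms)+

lemma dd_bilinear:
  assumes "bounded_bilinear b"
    and "approachable S" "x \<in> S" "smooth_on S f" "smooth_on S g"
  shows "dd S v (\<lambda>x. b (f x) (g x)) x = b (f x) (dd S v g x) + b (dd S v f x) (g x)"
  by (rule dd_eq[OF assms(2,3)])
    (rule bounded_bilinear.FDERIV[OF assms(1)] smooth_on_has_derivative assms)+

lemmas dd_mult = dd_bilinear[OF bounded_bilinear_mult]
lemmas dd_inner = dd_bilinear[OF bounded_bilinear_inner]
lemmas dd_scaleR = dd_bilinear[OF bounded_bilinear_scaleR]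

lemma dd_bounded_linear:
  assumes "bounded_linear L" and "approachable S" "x \<in> S" "smooth_on S f"
  shows "dd S v (\<lambda>x. L (f x)) x = L (dd S v f x)"
  by (rule dd_eq[OF assms(2,3)])
    (rule bounded_linear.has_derivative[OF assms(1)] smooth_on_has_derivative assms)+

lemmas dd_minus = dd_bounded_linear[OF bounded_linear_minus[OF bounded_linear_ident]]

lemma dd_diff:
  assumes "approachable S" "x \<in> S" "smooth_on S f" "smooth_on S g"
  shows "dd S v (\<lambda>x. f x - g x) x = dd S v f x - dd S v g x"
  by (rule dd_eq[OF assms(1,2)])
    (rule has_derivative_diff smooth_on_has_derivative assms)+

lemma dd_linear:
  assumes "bounded_linear L" and "approachable S" "x \<in> S"
  shows "dd S v L x = L v"
  by (rule dd_eq[OF assms(2,3)]) (rule bounded_linear_imp_has_derivative[OF assms(1)])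

lemma dd_sum:
  assumes "finite A" "approachable S" "x \<in> S" "\<And>i. i \<in> A \<Longrightarrow> smooth_on S (f i)"
  shows "dd S v (\<lambda>x. \<Sum>i\<in>A. f i x) x = (\<Sum>i\<in>A. dd S v (f i) x)"
  by (rule dd_eq[OF assms(2,3)])
    (intro has_derivative_sum smooth_on_has_derivative assms)

lemma dd_linear_direction:
  assumes "smooth_on S f" "x \<in> S"
  shows "dd S (u + v) f x = dd S u f x + dd S v f x"
    and "dd S (c *\<^sub>R v) f x = c *\<^sub>R dd S v f x"
  by (rule linear_add linear_scale, rule has_derivative_linear[OF smooth_on_has_derivative[OF assms]])+

lemma dd_compose:
  fixes P :: "'a::euclidean_space \<Rightarrow> 'b::euclidean_space"
  assumes "approachable S'" "P ` S' \<subseteq> S" "smooth_on S' P" "smooth_on S f" "x \<in> S'"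
  shows "dd S' v (\<lambda>x. f (P x)) x = dd S (dd S' v P x) f (P x)"
proof -
  have "((\<lambda>x. f (P x)) has_derivative (\<lambda>v. dd S (dd S' v P x) f (P x))) (at x within S')"
    by (rule has_derivative_in_compose2[of S f "\<lambda>y w. dd S w f y" P S' x "\<lambda>v. dd S' v P x"])
      (use smooth_on_has_derivative[OF assms(4)] smooth_on_has_derivative[OF assms(3,5)] assms in auto)
  from dd_eq[OF assms(1,5) this] show ?thesis .
qed

lemma smooth_on_line_derivative:
  assumes "smooth_on S f" "open J" "\<And>s. s \<in> J \<Longrightarrow> x + s *\<^sub>R v \<in> S" "s \<in> J"
  shows "((\<lambda>s. f (x + s *\<^sub>R v)) has_vector_derivative dd S v f (x + s *\<^sub>R v)) (at s)"
proof -
  have "((\<lambda>s. f (x + s *\<^sub>R v)) has_derivative (\<lambda>h. dd S (h *\<^sub>R v) f (x + s *\<^sub>R v))) (at s within J)"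
  proof (rule has_derivative_in_compose2[of S f "\<lambda>y w. dd S w f y" _ J])
    show "(f has_derivative (\<lambda>w. dd S w f y)) (at y within S)" if "y \<in> S" for y
      by (rule smooth_on_has_derivative[OF assms(1) that])
    show "((\<lambda>s. x + s *\<^sub>R v) has_derivative (\<lambda>h. h *\<^sub>R v)) (at s within J)"
      by (auto intro!: derivative_eq_intros)
  qed (use assms in auto)
  moreover have "dd S (h *\<^sub>R v) f (x + s *\<^sub>R v) = h *\<^sub>R dd S v f (x + s *\<^sub>R v)" for h
    by (rule dd_linear_direction(2)[OF assms(1) assms(3)[OF assms(4)]])
  ultimately show ?thesis
    unfolding has_vector_derivative_def at_within_open[OF assms(4,2)] by simp
qed

section \<open>Symmetry of second derivatives up to the boundary, and the second derivative
  test\<close>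

lemma second_difference:
  fixes f :: "'a::euclidean_space \<Rightarrow> real"
  assumes "approachable S" "smooth_on S f" "0 < e"
    and "ball x r \<subseteq> S" "e * (norm v + norm w) < r"
  shows "\<exists>y\<in>S. dist y x \<le> e * (norm v + norm w) \<and>
    f (x + e *\<^sub>R v + e *\<^sub>R w) - f (x + e *\<^sub>R v) - f (x + e *\<^sub>R w) + f x
      = e * e * dd S w (dd S v f) y"
proof -
  have bd: "norm (s *\<^sub>R v + t *\<^sub>R w) \<le> e * (norm v + norm w)"
    if "\<bar>s\<bar> \<le> e" "\<bar>t\<bar> \<le> e" for s t
  proof -
    have "norm (s *\<^sub>R v + t *\<^sub>R w) \<le> \<bar>s\<bar> * norm v + \<bar>t\<bar> * norm w"
      using norm_triangle_ineq[of "s *\<^sub>R v" "t *\<^sub>R w"] by simp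
    also have "\<dots> \<le> e * norm v + e * norm w"
      using that by (intro add_mono mult_right_mono) auto
    finally show ?thesis by (simp add: algebra_simps)
  qed
  have in_ball: "x + s *\<^sub>R v + t *\<^sub>R w \<in> ball x r" if "0 \<le> s" "s \<le> e" "0 \<le> t" "t \<le> e" for s t
    using bd[of s t] that assms(5) norm_minus_commute[of x "x + s *\<^sub>R v + t *\<^sub>R w"]
    by (simp add: dist_norm add.assoc)
  have line: "((\<lambda>s. g (y + s *\<^sub>R u)) has_real_derivative dd S u g (y + s *\<^sub>R u)) (at s)"
    if g: "smooth_on S g" and "y + s *\<^sub>R u \<in> ball x r" for g :: "'a \<Rightarrow> real" and y u s
  proof -
    define J where "J = (\<lambda>s. y + s *\<^sub>R u) -` ball x r"
    have "open J" unfolding J_def by (intro open_vimage continuous_intros open_ball)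
    moreover have "y + s *\<^sub>R u \<in> S" if "s \<in> J" for s using that assms(4) by (auto simp: J_def)
    moreover have "s \<in> J" using that(2) by (simp add: J_def)
    ultimately show ?thesis
      unfolding has_real_derivative_iff_has_vector_derivative
      by (rule smooth_on_line_derivative[OF g])
  qed
  define F where "F s = f (x + s *\<^sub>R v + e *\<^sub>R w) - f (x + s *\<^sub>R v)" for s
  have dF: "(F has_real_derivative
      dd S v f (x + s *\<^sub>R v + e *\<^sub>R w) - dd S v f (x + s *\<^sub>R v)) (at s)"
    if "0 \<le> s" "s \<le> e" for s
    unfolding F_def
    using line[OF assms(2), of "x + e *\<^sub>R w" s v] line[OF assms(2), of x s v]
      in_ball[of s e] in_ball[of s 0] that assms(3)
    by (intro DERIV_diff) (auto simp: algebra_simps)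
  obtain s where s: "0 < s" "s < e"
    and Fs: "F e - F 0 = (e - 0) * (dd S v f (x + s *\<^sub>R v + e *\<^sub>R w) - dd S v f (x + s *\<^sub>R v))"
    using MVT2[OF assms(3) dF] by auto
  have dG: "((\<lambda>t. dd S v f (x + s *\<^sub>R v + t *\<^sub>R w)) has_real_derivative
      dd S w (dd S v f) (x + s *\<^sub>R v + t *\<^sub>R w)) (at t)" if "0 \<le> t" "t \<le> e" for t
    using line[OF smooth_on_dd[OF assms(1,2)], of "x + s *\<^sub>R v" t w] in_ball[of s t] s that by simp
  obtain t where t: "0 < t" "t < e"
    and Gt: "dd S v f (x + s *\<^sub>R v + e *\<^sub>R w) - dd S v f (x + s *\<^sub>R v + 0 *\<^sub>R w)
      = (e - 0) * dd S w (dd S v f) (x + s *\<^sub>R v + t *\<^sub>R w)"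
    using MVT2[OF assms(3) dG] by auto
  have "F e - F 0 = e * e * dd S w (dd S v f) (x + s *\<^sub>R v + t *\<^sub>R w)"
    using Fs Gt by simp
  moreover have "x + s *\<^sub>R v + t *\<^sub>R w \<in> S" using in_ball[of s t] s t assms(4) by auto
  moreover have "dist (x + s *\<^sub>R v + t *\<^sub>R w) x \<le> e * (norm v + norm w)"
    using bd[of s t] s t by (simp add: dist_norm add.assoc)
  ultimately show ?thesis
    by (intro bexI[of _ "x + s *\<^sub>R v + t *\<^sub>R w"]) (auto simp: F_def)
qed

text \<open>The mixed second difference is symmetric in \<open>v\<close> and \<open>w\<close>, and
  \<open>second_difference\<close> writes it with either order of differentiation at a point close
  to \<open>x\<close>. Continuity of both derivatives finishes the argument.\<close>

lemma dd_commute_interior: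
  fixes f :: "'a::euclidean_space \<Rightarrow> real"
  assumes S: "approachable S" and f: "smooth_on S f" and x: "x \<in> interior S"
  shows "dd S v (dd S w f) x = dd S w (dd S v f) x"
proof -
  obtain r where r: "r > 0" "ball x r \<subseteq> S" using x by (meson mem_interior)
  have xS: "x \<in> S" using x interior_subset by blast
  define G where "G = dd S w (dd S v f)"
  define H where "H = dd S v (dd S w f)"
  define n where "n = norm v + norm w + 1"
  have n: "n > 0" "norm v + norm w < n" by (auto simp: n_def add_nonneg_pos)
  have cont: "continuous (at x within S) G" "continuous (at x within S) H"
    using smooth_on_continuous smooth_on_dd[OF S] f xS
    unfolding G_def H_def continuous_on_eq_continuous_within by blast+
  have "\<bar>G x - H x\<bar> \<le> 2 * e" if "e > 0" for e
  proof -
    obtain d where d: "d > 0" "\<forall>y\<in>S. dist y x < d \<longrightarrow> dist (G y) (G x) < e"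
      using cont(1) \<open>e > 0\<close> unfolding continuous_within_eps_delta by blast
    obtain d' where d': "d' > 0" "\<forall>y\<in>S. dist y x < d' \<longrightarrow> dist (H y) (H x) < e"
      using cont(2) \<open>e > 0\<close> unfolding continuous_within_eps_delta by blast
    define s where "s = min r (min d d') / n"
    have s: "s > 0" "s * n \<le> r" "s * n \<le> d" "s * n \<le> d'"
      using r(1) d(1) d'(1) n(1) by (auto simp: s_def)
    have lt: "s * (norm v + norm w) < s * n" using s(1) n(2) by simp
    obtain y where y: "y \<in> S" "dist y x \<le> s * (norm v + norm w)"
      "f (x + s *\<^sub>R v + s *\<^sub>R w) - f (x + s *\<^sub>R v) - f (x + s *\<^sub>R w) + f x = s * s * G y"
      using second_difference[OF S f s(1) r(2), of v w] lt s(2) by (auto simp: G_def)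
    obtain z where z: "z \<in> S" "dist z x \<le> s * (norm v + norm w)"
      "f (x + s *\<^sub>R w + s *\<^sub>R v) - f (x + s *\<^sub>R w) - f (x + s *\<^sub>R v) + f x = s * s * H z"
      using second_difference[OF S f s(1) r(2), of w v] lt s(2) by (auto simp: H_def add.commute)
    have "s * s * G y = s * s * H z" using y(3) z(3) by (simp add: algebra_simps)
    then have "G y = H z" using s(1) by simp
    moreover have "dist (G y) (G x) < e" using d(2) y s(3) lt by auto
    moreover have "dist (H z) (H x) < e" using d'(2) z s(4) lt by auto
    ultimately show ?thesis by (simp add: dist_real_def)
  qed
  from this[of "\<bar>G x - H x\<bar> / 4"] have "G x = H x" by (cases "G x = H x") auto
  then show ?thesis by (simp add: G_def H_def)
qed

text \<open>The commutator is continuous on \<open>S\<close> and vanishes on the interior, which is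
  dense in \<open>S\<close>. This is what allows space and time derivatives to be exchanged even at
  time 0.\<close>

lemma dd_commute:
  fixes f :: "'a::euclidean_space \<Rightarrow> 'b::euclidean_space"
  assumes S: "approachable S" "S \<subseteq> closure (interior S)" and f: "smooth_on S f" and x: "x \<in> S"
  shows "dd S v (dd S w f) x = dd S w (dd S v f) x"
proof (rule euclidean_eqI)
  fix b :: 'b assume "b \<in> Basis"
  define h where "h y = f y \<bullet> b" for y
  have h: "smooth_on S h" unfolding h_def by (intro smooth_on_inner f smooth_on_const)
  have eq: "dd S v (dd S w f) y \<bullet> b = dd S v (dd S w h) y" if "y \<in> S" for v w y
  proof -
    have hw: "dd S w h z = dd S w f z \<bullet> b" if "z \<in> S" for z
      unfolding h_def using S that f by (subst dd_inner) auto
    have "dd S v (dd S w h) y = dd S v (\<lambda>z. dd S w f z \<bullet> b) y"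
      by (rule dd_cong[OF that hw])
    then show ?thesis using S f that by (subst (asm) dd_inner) (auto intro: smooth_on_dd)
  qed
  define k where "k y = dd S v (dd S w h) y - dd S w (dd S v h) y" for y
  have "continuous_on S k"
    unfolding k_def using S h
    by (intro continuous_on_diff smooth_on_continuous smooth_on_dd)
  moreover have "k y = 0" if "y \<in> interior S" for y
    using dd_commute_interior[OF S(1) h that] by (simp add: k_def)
  ultimately have "k x = 0"
  proof -
    assume k: "continuous_on S k" "\<And>y. y \<in> interior S \<Longrightarrow> k y = 0"
    obtain u where u: "\<forall>n. u n \<in> interior S" "u \<longlonglongrightarrow> x"
      using S(2) x closure_sequential by blast
    have "\<forall>n. u n \<in> S" using u(1) interior_subset by blast
    then have "(k \<circ> u) \<longlonglongrightarrow> k x"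
      using k(1) u(2) x unfolding continuous_on_sequentially by blast
    moreover have "k \<circ> u = (\<lambda>_. 0)" using k(2) u(1) by auto
    ultimately show ?thesis using LIMSEQ_unique[OF tendsto_const] by metis
  qed
  then show "dd S v (dd S w f) x \<bullet> b = dd S w (dd S v f) x \<bullet> b"
    using eq[OF x] by (simp add: k_def)
qed

text \<open>Only a segment through \<open>x\<close> has to lie in \<open>S\<close>. In a cylinder
  the spatial directions always leave such a two-sided segment, so the test is available at time 0
  as well.\<close>

lemma second_derivative_test_line:
  fixes f :: "'a::euclidean_space \<Rightarrow> real"
  assumes S: "approachable S" and f: "smooth_on S f" and r: "r > 0"
    and line: "\<And>s. \<bar>s\<bar> < r \<Longrightarrow> x + s *\<^sub>R v \<in> S \<and> f (x + s *\<^sub>R v) \<le> f x"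
  shows "dd S v f x = 0" and "dd S v (dd S v f) x \<le> 0"
proof -
  define J where "J = {-r<..<r}"
  have J: "open J" "\<And>s. s \<in> J \<Longrightarrow> x + s *\<^sub>R v \<in> S" using line by (auto simp: J_def)
  define p where "p s = f (x + s *\<^sub>R v)" for s
  define q where "q s = dd S v f (x + s *\<^sub>R v)" for s
  have dp: "(p has_real_derivative q s) (at s)" if "s \<in> J" for s
    unfolding p_def q_def has_real_derivative_iff_has_vector_derivative
    by (rule smooth_on_line_derivative[OF f J that])
  have dq: "(q has_real_derivative dd S v (dd S v f) (x + s *\<^sub>R v)) (at s)" if "s \<in> J" for s
    unfolding q_def has_real_derivative_iff_has_vector_derivative
    by (rule smooth_on_line_derivative[OF smooth_on_dd[OF S f] J that])
  have 0: "0 \<in> J" using r by (simp add: J_def)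
  have q0: "q 0 = 0"
    using line by (intro DERIV_local_max[OF dp[OF 0] r]) (auto simp: p_def)
  then show "dd S v f x = 0" by (simp add: q_def)
  show "dd S v (dd S v f) x \<le> 0"
  proof (rule ccontr)
    assume "\<not> ?thesis"
    then have pos: "0 < dd S v (dd S v f) (x + 0 *\<^sub>R v)" by simp
    obtain d where d: "d > 0" "\<forall>h>0. h < d \<longrightarrow> q 0 < q (0 + h)"
      using DERIV_pos_inc_right[OF dq[OF 0] pos] by blast
    define e where "e = min d r / 2"
    have e: "0 < e" "e < d" "e < r" using d(1) r by (auto simp: e_def)
    obtain z where z: "0 < z" "z < e" "p e - p 0 = (e - 0) * q z"
      using MVT2[OF e(1), of p q] dp e by (auto simp: J_def)
    have "q z > 0" using d(2) z e q0 by auto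
    then have "p e > p 0" using z e(1) by (metis diff_gt_0_iff_gt diff_zero mult_pos_pos)
    then show False using line[of e] e by (simp add: p_def)
  qed
qed

section \<open>Space-time cylinders and short-time persistence of an inequality\<close>

lemma cylinder_closure_interior:
  assumes "open U" shows "U \<times> time_interval T \<subseteq> closure (interior (U \<times> time_interval T))"
proof
  fix z assume z: "z \<in> U \<times> time_interval T"
  obtain x t where xt: "z = (x, t)" "x \<in> U" "0 \<le> t" "ereal t < T"
    using z by (auto simp: time_interval_def)
  obtain r where r: "t < r" "ereal r < T" using ereal_dense2[OF xt(4)] by auto
  have sub: "U \<times> {t<..<r} \<subseteq> interior (U \<times> time_interval T)"
  proof (rule interior_maximal)
    show "open (U \<times> {t<..<r})" using assms by (intro open_Times) auto
    show "U \<times> {t<..<r} \<subseteq> U \<times> time_interval T"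
      using xt r by (auto simp: time_interval_def) (meson ereal_less_eq(3) less_le order.strict_trans1)
  qed
  have "t \<in> closure {t<..<r}" using r(1) by (simp add: closure_greaterThanLessThan)
  then have "z \<in> closure (U \<times> {t<..<r})"
    using xt closure_subset[of U] by (auto simp: closure_Times)
  then show "z \<in> closure (interior (U \<times> time_interval T))" using closure_mono[OF sub] by blast
qed

lemma cylinder_approachable:
  "open U \<Longrightarrow> approachable (U \<times> time_interval T)"
  by (intro approachable_Times open_approachable approachable_time_interval)

lemma time_interval_between:
  "t \<in> time_interval T \<Longrightarrow> s \<in> time_interval T \<Longrightarrow> {s..t} \<subseteq> time_interval T"
  by (auto simp: time_interval_def) (meson ereal_less_eq(3) order.strict_trans1)

text \<open>For each \<open>c\<close> one of two open conditions holds at \<open>(x0, t0)\<close>: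
  either \<open>f c\<close> is negative, or its time derivative is. Near the base point the first
  gives the claim at once, and the second gives it by the mean value theorem from the slice
  \<open>t0\<close>, where \<open>f c\<close> is nonpositive on all of \<open>U\<close>. Compactness
  of \<open>C\<close> leaves finitely many such neighbourhoods.\<close>

lemma nonpos_persists:
  fixes f :: "'c::metric_space \<Rightarrow> 'a::euclidean_space \<times> real \<Rightarrow> real"
  assumes U: "open U" and C: "compact C" and S: "S = U \<times> time_interval T"
    and f: "\<And>c. c \<in> C \<Longrightarrow> smooth_on S (f c)"
    and cf: "continuous_on (S \<times> C) (\<lambda>(z, c). f c z)"
    and cd: "continuous_on (S \<times> C) (\<lambda>(z, c). dd S (0, 1) (f c) z)"
    and z0: "(x0, t0) \<in> S"
    and le: "\<And>x c. x \<in> U \<Longrightarrow> c \<in> C \<Longrightarrow> f c (x, t0) \<le> 0"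
    and dec: "\<And>c. c \<in> C \<Longrightarrow> f c (x0, t0) = 0 \<Longrightarrow> dd S (0, 1) (f c) (x0, t0) < 0"
  obtains V d where "open V" "x0 \<in> V" "V \<subseteq> U" "d > 0"
    "\<And>x t c. x \<in> V \<Longrightarrow> t \<in> time_interval T \<Longrightarrow> t0 \<le> t \<Longrightarrow> t < t0 + d \<Longrightarrow> c \<in> C \<Longrightarrow> f c (x, t) \<le> 0"
proof -
  have small: "\<exists>e>0. \<forall>z\<in>S. \<forall>c'\<in>C. dist (z, c') ((x0, t0), c) < e \<longrightarrow> g (z, c') < 0"
    if gc: "continuous_on (S \<times> C) g" "c \<in> C" "g ((x0, t0), c) < 0" for g :: "_ \<Rightarrow> real" and c
  proof -
    have "((x0, t0), c) \<in> S \<times> C" using z0 gc(2) by auto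
    then obtain e where e: "e > 0" and
      d: "\<forall>y\<in>S \<times> C. dist y ((x0, t0), c) < e \<longrightarrow> dist (g y) (g ((x0, t0), c)) < - g ((x0, t0), c)"
      using gc unfolding continuous_on_iff by (metis neg_0_less_iff_less)
    have "g (z, c') < 0" if "z \<in> S" "c' \<in> C" "dist (z, c') ((x0, t0), c) < e" for z c'
      using bspec[OF d, of "(z, c')"] that gc(3) by (auto simp: dist_real_def)
    with e show ?thesis by blast
  qed
  have "\<forall>c\<in>C. \<exists>e>0. (\<forall>z\<in>S. \<forall>c'\<in>C. dist (z, c') ((x0, t0), c) < e \<longrightarrow> f c' z < 0) \<or>
      (\<forall>z\<in>S. \<forall>c'\<in>C. dist (z, c') ((x0, t0), c) < e \<longrightarrow> dd S (0, 1) (f c') z < 0)"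
  proof
    fix c assume c: "c \<in> C"
    have x0: "x0 \<in> U" using z0 S by simp
    show "\<exists>e>0. (\<forall>z\<in>S. \<forall>c'\<in>C. dist (z, c') ((x0, t0), c) < e \<longrightarrow> f c' z < 0) \<or>
      (\<forall>z\<in>S. \<forall>c'\<in>C. dist (z, c') ((x0, t0), c) < e \<longrightarrow> dd S (0, 1) (f c') z < 0)"
    proof (cases "f c (x0, t0) = 0")
      case True
      from small[OF cd c] dec[OF c True] show ?thesis by auto
    next
      case False
      with le[OF x0 c] have "f c (x0, t0) < 0" by simp
      with small[OF cf c] show ?thesis by auto
    qed
  qed
  then obtain e where e: "\<And>c. c \<in> C \<Longrightarrow> e c > 0" and
    e2: "\<And>c. c \<in> C \<Longrightarrow> (\<forall>z\<in>S. \<forall>c'\<in>C. dist (z, c') ((x0, t0), c) < e c \<longrightarrow> f c' z < 0) \<or>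
      (\<forall>z\<in>S. \<forall>c'\<in>C. dist (z, c') ((x0, t0), c) < e c \<longrightarrow> dd S (0, 1) (f c') z < 0)"
    by metis
  have "C \<subseteq> (\<Union>c\<in>C. ball c (e c / 2))" using e by force
  then obtain D where D: "D \<subseteq> C" "finite D" "C \<subseteq> (\<Union>c\<in>D. ball c (e c / 2))"
    using compactE_image[OF C, of C "\<lambda>c. ball c (e c / 2)"] by (metis open_ball)
  \<comment> \<open>The halves feed the triangle inequality: \<open>m / 2\<close> in space,
    \<open>m / 2\<close> in time and \<open>e c / 2\<close> in the parameter add up to at most
    \<open>e c\<close>. The entry 1 keeps the minimum meaningful when \<open>D\<close> is
    empty.\<close>
  define m where "m = Min (insert 1 ((\<lambda>c. e c / 2) ` D))"
  have m: "m > 0" "\<And>c. c \<in> D \<Longrightarrow> m \<le> e c / 2"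
  proof -
    show "m > 0" using D e by (auto simp: m_def)
    show "m \<le> e c / 2" if "c \<in> D" for c
      unfolding m_def using D(2) that by (intro Min_le) auto
  qed
  define V where "V = U \<inter> ball x0 (m / 2)"
  have "f c (x, t) \<le> 0"
    if x: "x \<in> V" and t: "t \<in> time_interval T" "t0 \<le> t" "t < t0 + m / 2" and c: "c \<in> C" for x t c
  proof -
    obtain c0 where c0: "c0 \<in> D" "dist c c0 < e c0 / 2"
      using D(3) c by (auto simp: dist_commute)
    have near: "dist ((x, s), c) ((x0, t0), c0) < e c0" if "s \<in> {t0..t}" for s
    proof -
      have "dist ((x, s), c) ((x0, t0), c0) \<le> dist (x, s) (x0, t0) + dist c c0"
        unfolding dist_Pair_Pair[of "(x, s)" c] by (rule sqrt_sum_squares_le_sum) auto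
      also have "dist (x, s) (x0, t0) \<le> dist x x0 + dist s t0"
        unfolding dist_Pair_Pair by (rule sqrt_sum_squares_le_sum) auto
      also have "dist x x0 < m / 2" using x by (auto simp: V_def dist_commute)
      also have "dist s t0 < m / 2" using that t by (auto simp: dist_real_def)
      finally show ?thesis using m(2)[OF c0(1)] c0(2) by simp
    qed
    have t0: "t0 \<in> time_interval T" using z0 S by simp
    have inS: "(x, s) \<in> S" if "s \<in> {t0..t}" for s
      using that time_interval_between[OF t(1) t0] x S by (auto simp: V_def)
    consider "\<forall>z\<in>S. \<forall>c'\<in>C. dist (z, c') ((x0, t0), c0) < e c0 \<longrightarrow> f c' z < 0"
      | "\<forall>z\<in>S. \<forall>c'\<in>C. dist (z, c') ((x0, t0), c0) < e c0 \<longrightarrow> dd S (0, 1) (f c') z < 0"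
      using e2 c0 D(1) by blast
    then show ?thesis
    proof cases
      case 1
      then show ?thesis using near[of t] inS[of t] t c by force
    next
      case 2
      show ?thesis
      proof (cases "t0 < t")
        case True
        have der: "((\<lambda>s. f c (x, s)) has_derivative (\<lambda>h. dd S (0, h) (f c) (x, s))) (at s within {t0..t})"
          if "s \<in> {t0..t}" for s
        proof (rule has_derivative_in_compose2[of S "f c" "\<lambda>y w. dd S w (f c) y" _ "{t0..t}"])
          show "(f c has_derivative (\<lambda>w. dd S w (f c) y)) (at y within S)" if "y \<in> S" for y
            by (rule smooth_on_has_derivative[OF f[OF c] that])
          show "((\<lambda>s. (x, s)) has_derivative (\<lambda>h. (0, h))) (at s within {t0..t})"
            by (auto intro!: derivative_eq_intros)
        qed (use inS that in auto)
        obtain s where s: "s \<in> {t0<..<t}" "f c (x, t) - f c (x, t0) = dd S (0, t - t0) (f c) (x, s)"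
          using mvt_simple[OF True, of "\<lambda>s. f c (x, s)" "\<lambda>s h. dd S (0, h) (f c) (x, s)"] der by auto
        have sS: "(x, s) \<in> S" using inS s by auto
        have "dd S (0, t - t0) (f c) (x, s) = (t - t0) * dd S (0, 1) (f c) (x, s)"
          using dd_linear_direction(2)[OF f[OF c] sS, of "t - t0" "(0, 1)"] by simp
        also have "\<dots> < 0" using 2 near[of s] sS s c by (intro mult_pos_neg) auto
        finally show ?thesis using s le[of x c] x c by (auto simp: V_def)
      next
        case False
        then show ?thesis using t le[of x c] x c by (auto simp: V_def)
      qed
    qed
  qed
  moreover have "open V" "x0 \<in> V" "V \<subseteq> U" using U m z0 S by (auto simp: V_def)
  ultimately show thesis using that[of V "m / 2"] m(1) by auto
qed

subsection \<open>Algebraic inequalities for the gradient terms\<close>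

definition psd_form :: "real \<Rightarrow> real \<Rightarrow> real \<Rightarrow> real \<Rightarrow> real \<Rightarrow> real \<Rightarrow> real \<Rightarrow> real \<Rightarrow> real \<Rightarrow> real" where
  "psd_form A B C D E F x y z =
     A * x^2 + B * y^2 + C * z^2 + 2 * D * (x * y) + 2 * E * (x * z) + 2 * F * (y * z)"

text \<open>Completing the square twice. The last hypothesis is \<open>A\<close> times the
  determinant of the form, so these are Sylvester's leading minors, with the last one allowed to
  vanish.\<close>

lemma psd_form_nonneg:
  assumes "A > 0" "A * B - D^2 > 0"
    and "(A * B - D^2) * (A * C - E^2) - (A * F - D * E)^2 \<ge> 0"
  shows "psd_form A B C D E F x y z \<ge> 0"
proof -
  let ?d = "A * B - D^2"
  have "A * ?d * psd_form A B C D E F x y z =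
      ?d * (A * x + D * y + E * z)^2 + (?d * y + (A * F - D * E) * z)^2
      + (?d * (A * C - E^2) - (A * F - D * E)^2) * z^2"
    unfolding psd_form_def by algebra
  also have "\<dots> \<ge> 0" using assms by (intro add_nonneg_nonneg mult_nonneg_nonneg) auto
  finally have "0 \<le> (A * ?d) * psd_form A B C D E F x y z" .
  moreover have "A * ?d > 0" using assms(1,2) by simp
  ultimately show ?thesis by (metis linorder_not_le mult_pos_neg)
qed

text \<open>One of three similar blocks making up a quarter of the gradient terms in
  \<open>psi_gradient_terms\<close>. Here \<open>x\<close>, \<open>y\<close>, \<open>z\<close> stand
  for the derivatives of the three diagonal entries of the second fundamental form in the direction
  belonging to \<open>a\<close>.\<close>

definition gradient_form :: "real \<Rightarrow> real \<Rightarrow> real \<Rightarrow> real \<Rightarrow> real \<Rightarrow> real \<Rightarrow> real" where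
  "gradient_form a b c x y z =
     b * c * (b^2 + c^2 - b * c) * x^2
     + c * (a^2 * b + 3 * b * c^2 - 2 * a * b * c + 2 * a * c^2) * y^2
     + b * (a^2 * c + 3 * b^2 * c - 2 * a * b * c + 2 * a * b^2) * z^2
     + c * (2 * a * b^2 - 2 * a * c^2 - b^2 * c) * (x * y)
     + b * (2 * a * c^2 - 2 * a * b^2 - c^2 * b) * (x * z)
     + (4 * b^2 * c^2 - 2 * a^2 * b^2 - 2 * a^2 * c^2 + a^2 * b * c - a * b^2 * c - a * b * c^2) * (y * z)"

text \<open>Each order of \<open>a\<close>, \<open>b\<close>, \<open>c\<close> cuts out a simplicial part of the pinching cone. In coordinates
  along its edges every coefficient of the form is itself positive semidefinite.\<close>

lemma gradient_form_a_min:
  fixes p q r x y z :: real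
  assumes "p \<ge> 0" "q \<ge> 0" "r \<ge> 0"
  shows "gradient_form (p + q + r) (p + 2 * q + 2 * r) (p + q + 2 * r) x y z \<ge> 0"
proof -
  \<comment> \<open>The factor 2 makes the off-diagonal entries integral, since
    \<open>psd_form\<close> counts them twice. The summands run over the 15 monomials of degree 4 in
    the edge coordinates.\<close>
  have "2 * gradient_form (p + q + r) (p + 2 * q + 2 * r) (p + q + 2 * r) x y z =
        (r^4) * psd_form 32 104 104 (-16) (-16) 36 x y z
      + (q * r^3) * psd_form 96 252 380 (-32) (-64) 98 x y z
      + (q^2 * r^2) * psd_form 112 220 516 (-16) (-96) 90 x y z
      + (q^3 * r) * psd_form 60 84 308 2 (-64) 30 x y z
      + (q^4) * psd_form 12 12 68 2 (-16) 2 x y z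
      + (p * r^3) * psd_form 64 216 216 (-32) (-32) 52 x y z
      + (p * q * r^2) * psd_form 144 390 598 (-40) (-104) 99 x y z
      + (p * q^2 * r) * psd_form 112 228 548 (-6) (-110) 51 x y z
      + (p * q^3) * psd_form 30 44 166 4 (-38) 4 x y z
      + (p^2 * r^2) * psd_form 48 170 170 (-24) (-24) 21 x y z
      + (p^2 * q * r) * psd_form 72 204 316 (-16) (-56) 21 x y z
      + (p^2 * q^2) * psd_form 28 60 146 1 (-31) 1 x y z
      + (p^3 * r) * psd_form 16 60 60 (-8) (-8) 0 x y z
      + (p^3 * q) * psd_form 12 36 56 (-2) (-10) (-2) x y z
      + (p^4) * psd_form 2 8 8 (-1) (-1) (-1) x y z"
    unfolding gradient_form_def psd_form_def by algebra
  also have "\<dots> \<ge> 0"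
    by (intro add_nonneg_nonneg mult_nonneg_nonneg zero_le_power assms psd_form_nonneg) simp_all
  finally show ?thesis by simp
qed

lemma gradient_form_a_mid:
  fixes p q r x y z :: real
  assumes "p \<ge> 0" "q \<ge> 0" "r \<ge> 0"
  shows "gradient_form (p + q + 2 * r) (p + 2 * q + 2 * r) (p + q + r) x y z \<ge> 0"
proof -
  have "2 * gradient_form (p + q + 2 * r) (p + 2 * q + 2 * r) (p + q + r) x y z =
        (r^4) * psd_form 12 20 96 8 (-28) (-28) x y z
      + (q * r^3) * psd_form 48 68 352 26 (-100) (-74) x y z
      + (q^2 * r^2) * psd_form 72 88 484 30 (-132) (-62) x y z
      + (q^3 * r) * psd_form 48 52 296 14 (-76) (-14) x y z
      + (q^4) * psd_form 12 12 68 2 (-16) 2 x y z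
      + (p * r^3) * psd_form 30 62 208 14 (-52) (-52) x y z
      + (p * q * r^2) * psd_form 90 162 576 32 (-142) (-91) x y z
      + (p * q^2 * r) * psd_form 90 144 534 22 (-128) (-35) x y z
      + (p * q^3) * psd_form 30 44 166 4 (-38) 4 x y z
      + (p^2 * r^2) * psd_form 28 74 168 5 (-35) (-35) x y z
      + (p^2 * q * r) * psd_form 56 132 312 6 (-66) (-31) x y z
      + (p^2 * q^2) * psd_form 28 60 146 1 (-31) 1 x y z
      + (p^3 * r) * psd_form 12 40 60 (-2) (-10) (-10) x y z
      + (p^3 * q) * psd_form 12 36 56 (-2) (-10) (-2) x y z
      + (p^4) * psd_form 2 8 8 (-1) (-1) (-1) x y z"
    unfolding gradient_form_def psd_form_def by algebra
  also have "\<dots> \<ge> 0"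
    by (intro add_nonneg_nonneg mult_nonneg_nonneg zero_le_power assms psd_form_nonneg) simp_all
  finally show ?thesis by simp
qed

lemma gradient_form_a_max:
  fixes p q r x y z :: real
  assumes "p \<ge> 0" "q \<ge> 0" "r \<ge> 0"
  shows "gradient_form (p + 2 * q + 2 * r) (p + q + 2 * r) (p + q + r) x y z \<ge> 0"
proof -
  have "2 * gradient_form (p + 2 * q + 2 * r) (p + q + 2 * r) (p + q + r) x y z =
        (r^4) * psd_form 12 20 96 8 (-28) (-28) x y z
      + (q * r^3) * psd_form 30 74 240 20 (-64) (-90) x y z
      + (q^2 * r^2) * psd_form 28 102 220 15 (-49) (-108) x y z
      + (q^3 * r) * psd_form 12 62 90 2 (-14) (-58) x y z
      + (q^4) * psd_form 2 14 14 (-1) (-1) (-12) x y z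
      + (p * r^3) * psd_form 30 62 208 14 (-52) (-52) x y z
      + (p * q * r^2) * psd_form 56 172 384 20 (-84) (-135) x y z
      + (p * q^2 * r) * psd_form 36 158 234 2 (-38) (-117) x y z
      + (p * q^3) * psd_form 8 48 48 (-4) (-4) (-34) x y z
      + (p^2 * r^2) * psd_form 28 74 168 5 (-35) (-35) x y z
      + (p^2 * q * r) * psd_form 36 136 204 (-2) (-34) (-69) x y z
      + (p^2 * q^2) * psd_form 12 62 62 (-6) (-6) (-33) x y z
      + (p^3 * r) * psd_form 12 40 60 (-2) (-10) (-10) x y z
      + (p^3 * q) * psd_form 8 36 36 (-4) (-4) (-12) x y z
      + (p^4) * psd_form 2 8 8 (-1) (-1) (-1) x y z"
    unfolding gradient_form_def psd_form_def by algebra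
  also have "\<dots> \<ge> 0"
    by (intro add_nonneg_nonneg mult_nonneg_nonneg zero_le_power assms psd_form_nonneg) simp_all
  finally show ?thesis by simp
qed

lemma gradient_form_nonneg:
  assumes pinched: "a \<le> 2 * b" "a \<le> 2 * c" "b \<le> 2 * a" "b \<le> 2 * c" "c \<le> 2 * a" "c \<le> 2 * b"
  shows "gradient_form a b c x y z \<ge> 0"
proof -
  have *: "gradient_form a b c x y z \<ge> 0"
    if "c \<le> b" "a \<le> 2 * c" "b \<le> 2 * a" "b \<le> 2 * c" for a b c x y z
  proof -
    consider "a \<le> c" | "c \<le> a" "a \<le> b" | "b \<le> a" by linarith
    then show ?thesis
    proof cases
      case 1
      \<comment> \<open>The edge coordinates are the slacks of the bounding facets: in each case one
        pinching inequality and two order inequalities.\<close>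
      from gradient_form_a_min[of "2 * a - b" "b - c" "c - a" x y z] 1 that show ?thesis by simp
    next
      case 2
      from gradient_form_a_mid[of "2 * c - b" "b - a" "a - c" x y z] 2 that show ?thesis by simp
    next
      case 3
      from gradient_form_a_max[of "2 * c - a" "a - b" "b - c" x y z] 3 that show ?thesis by simp
    qed
  qed
  show ?thesis
  proof (cases "c \<le> b")
    case True then show ?thesis using * pinched by simp
  next
    case False
    \<comment> \<open>Only the first eigenvalue is distinguished in the form; exchanging the other
      two together with \<open>y\<close> and \<open>z\<close> covers the opposite order of
      \<open>b\<close> and \<open>c\<close>.\<close>
    have "gradient_form a b c x y z = gradient_form a c b x z y"
      unfolding gradient_form_def by algebra
    then show ?thesis using *[of b c a x z y] False pinched by simp
  qed
qed

section \<open>Gradient terms of psi and of the pinching condition\<close>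

definition psi_deriv :: "real \<Rightarrow> real \<Rightarrow> real \<Rightarrow> real" where
  "psi_deriv a b c = 4 * a * (b^2 + c^2 - b * c) - 2 * b * c * (b + c)"

definition det_hess :: "real \<Rightarrow> real \<Rightarrow> real \<Rightarrow> real \<Rightarrow> real \<Rightarrow> real \<Rightarrow> real \<Rightarrow> real \<Rightarrow> real \<Rightarrow> real" where
  "det_hess a b c e11 e22 e33 e12 e13 e23 =
     2 * (c * (e11 * e22 - e12^2) + b * (e11 * e33 - e13^2) + a * (e22 * e33 - e23^2))"

text \<open>Second derivative of 2 E_2^2 - 6 E_1 E_3 at diag(a, b, c) along the symmetric matrix
  \<open>e\<close>. The summands are 4 (E_2')^2, 4 E_2 E_2'', -12 E_1' E_3' and -6 E_1 E_3'', with
  \<open>det_hess\<close> as E_3''. In the same way \<open>psi_deriv\<close> is the partial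
  derivative in its first argument.\<close>

definition psi_hess :: "real \<Rightarrow> real \<Rightarrow> real \<Rightarrow> real \<Rightarrow> real \<Rightarrow> real \<Rightarrow> real \<Rightarrow> real \<Rightarrow> real \<Rightarrow> real" where
  "psi_hess a b c e11 e22 e33 e12 e13 e23 =
     4 * ((b + c) * e11 + (a + c) * e22 + (a + b) * e33)^2
     + 8 * (a * b + a * c + b * c) *
         (e11 * e22 - e12^2 + e11 * e33 - e13^2 + e22 * e33 - e23^2)
     - 12 * (e11 + e22 + e33) * (b * c * e11 + a * c * e22 + a * b * e33)
     - 6 * (a + b + c) * det_hess a b c e11 e22 e33 e12 e13 e23"

text \<open>By Codazzi the derivatives form a totally symmetric tensor with ten entries. Reflecting
  one frame vector leaves the difference of the two sides invariant, so entries of different index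
  parity do not interact: there remain three blocks, each a \<open>gradient_form\<close>, and the
  isolated \<open>t123\<close> with a visibly nonnegative coefficient.\<close>

lemma psi_gradient_terms:
  assumes pinched: "a \<le> 2 * b" "a \<le> 2 * c" "b \<le> 2 * a" "b \<le> 2 * c" "c \<le> 2 * a" "c \<le> 2 * b"
  shows "psi_deriv a b c * det_hess a b c t111 t122 t133 t112 t113 t123
    + psi_deriv b a c * det_hess a b c t112 t222 t233 t122 t123 t223
    + psi_deriv c a b * det_hess a b c t113 t223 t333 t123 t133 t233
    \<le> b * c * psi_hess a b c t111 t122 t133 t112 t113 t123
    + a * c * psi_hess a b c t112 t222 t233 t122 t123 t223
    + a * b * psi_hess a b c t113 t223 t333 t123 t133 t233"
    (is "?L \<le> ?R")
proof -
  have "?R - ?L = 4 * gradient_form a b c t111 t122 t133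
     + 4 * gradient_form b a c t222 t112 t233
     + 4 * gradient_form c a b t333 t113 t223
     + (4 * (a * b + a * c + b * c)^2
        + 2 * ((a * b - a * c)^2 + (a * b - b * c)^2 + (a * c - b * c)^2)) * t123^2"
    unfolding gradient_form_def psi_hess_def det_hess_def psi_deriv_def by algebra
  also have "\<dots> \<ge> 0"
    using pinched by (intro add_nonneg_nonneg mult_nonneg_nonneg gradient_form_nonneg) auto
  finally show ?thesis by simp
qed

text \<open>The equations \<open>t\<close> are the first order conditions at a point where pinching
  is attained. The coefficients on the right are the gains, called \<open>L\<close> in
  \<open>pinching_defect_decreasing\<close>, from turning the two test vectors as the point moves.
  The difference of the sides is a sum of squares whose coefficients are nonnegative by
  pinching.\<close>

lemma pinching_gradient_terms:
  fixes a b c :: real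
  assumes pos: "b > 0" "c > 0" and ac: "a = 2 * c" and pinched: "a \<le> 2 * b" "b \<le> 2 * c"
    and t: "t111 = 2 * t133" "t112 = 2 * t233" "t113 = 2 * t333"
  shows "det_hess a b c t111 t122 t133 t112 t113 t123
      - 2 * det_hess a b c t113 t223 t333 t123 t133 t233
    \<le> b * c * ((6 * b - 2 * a) / b^2 * t112^2 + 6 / c * t113^2 + (4 * b + 4 * c) / b^2 * t123^2)
    + a * c * ((6 * b - 2 * a) / b^2 * t122^2 + 6 / c * t123^2 + (4 * b + 4 * c) / b^2 * t223^2)
    + a * b * ((6 * b - 2 * a) / b^2 * t123^2 + 6 / c * t133^2 + (4 * b + 4 * c) / b^2 * t233^2)"
proof -
  \<comment> \<open>Dividing each derivative by the eigenvalue that is differentiated evens out the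
    coefficients, and the mixed terms fit into squares.\<close>
  define X Y Z W where "X = t133 / c" and "Y = t122 / b" and "Z = t333 / c" and "W = t223 / b"
  have s: "t133 = c * X" "t122 = b * Y" "t333 = c * Z" "t223 = b * W"
    using pos by (auto simp: X_def Y_def Z_def W_def)
  \<comment> \<open>The inequality \<open>a \<le> 2 * b\<close> amounts to
    \<open>k1 \<ge> 2\<close>, just what the coefficient \<open>2 * (k1 - 2)\<close> below requires;
    \<open>b \<le> 2 * c\<close> yields \<open>k2 \<ge> 6\<close>.\<close>
  define k1 k2 where "k1 = (6 * b - 2 * a) / b" and "k2 = (4 * b + 4 * c) / b"
  have k: "(6 * b - 2 * a) / b^2 = k1 / b" "(4 * b + 4 * c) / b^2 = k2 / b" "k1 \<ge> 2" "k2 \<ge> 6"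
    using pos pinched ac by (auto simp: k1_def k2_def power2_eq_square field_simps)
  have pw: "u / b * (b * v)^2 = u * b * v^2" "u / c * (2 * (c * v))^2 = 4 * u * c * v^2"
    "u / c * (c * v)^2 = u * c * v^2" for u v
    using pos by (auto simp: power2_eq_square field_simps)
  have "b * c * (k1 / b * t112^2 + 6 / c * t113^2 + k2 / b * t123^2)
    + a * c * (k1 / b * t122^2 + 6 / c * t123^2 + k2 / b * t223^2)
    + a * b * (k1 / b * t123^2 + 6 / c * t133^2 + k2 / b * t233^2)
    - (det_hess a b c t111 t122 t133 t112 t113 t123
      - 2 * det_hess a b c t113 t223 t333 t123 t133 t233)
    = b * c^2 * (4 * (X - Y)^2 + 2 * (k1 - 2) * Y^2)
    + b * c^2 * (24 * Z^2 + 16 * (Z + W / 2)^2 + (2 * k2 - 4) * W^2)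
    + c * (4 * k1 + 2 * k2) * t233^2
    + (c * k2 + 12 * c + 2 * c * k1) * t123^2"
    unfolding t s pw ac det_hess_def using pos by (simp add: field_simps power2_eq_square)
  also have "\<dots> \<ge> 0"
    using pos k(3,4) by (intro add_nonneg_nonneg mult_nonneg_nonneg) auto
  finally show ?thesis unfolding k(1,2) by linarith
qed

subsection \<open>Jets of determinants\<close>

lemma orthonormal_frame_eqI:
  fixes e :: "3 \<Rightarrow> real^4" and n u w :: "real^4"
  assumes e: "\<And>i j. e i \<bullet> e j = (if i = j then 1 else 0)" and en: "\<And>i. e i \<bullet> n = 0" and n: "n \<bullet> n = 1"
    and eq: "\<And>i. u \<bullet> e i = w \<bullet> e i" "u \<bullet> n = w \<bullet> n"
  shows "u = w"
proof -
  let ?B = "insert n (range e)"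
  have inj: "inj e" using e by (metis injI zero_neq_one)
  have "n \<notin> range e" using en n by (metis imageE zero_neq_one inner_commute)
  then have card: "card ?B = 4" using card_image[OF inj] by simp
  have "independent ?B"
  proof (rule pairwise_orthogonal_independent)
    show "pairwise orthogonal ?B"
      using e en unfolding pairwise_def orthogonal_def by (auto simp: inner_commute)
    show "0 \<notin> ?B" using e n by (metis imageE inner_zero_left insertE zero_neq_one)
  qed
  moreover have "dim (UNIV :: (real^4) set) \<le> card ?B" by (simp add: card dim_UNIV)
  ultimately have span: "span ?B = UNIV"
    using card_ge_dim_independent[of ?B UNIV] by auto
  have "orthogonal (u - w) x" if "x \<in> ?B" for x
    using that eq by (auto simp: orthogonal_def inner_diff_left)
  then have "orthogonal (u - w) (u - w)"
    using orthogonal_to_span[of "u - w" ?B "u - w"] span by auto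
  then show ?thesis by (simp add: orthogonal_def)
qed

text \<open>Smoothness is bundled with the derivatives along one direction at one point. The
  calculus rules leave the outcome schematic, so a polynomial in matrix entries is expanded by
  resolution alone, and \<open>jet1_eq\<close> or \<open>jet2_eq\<close> reduces the rest to one
  algebraic identity per order.\<close>

definition jet1 :: "'a::euclidean_space set \<Rightarrow> 'a \<Rightarrow> 'a \<Rightarrow> ('a \<Rightarrow> real) \<Rightarrow> real \<Rightarrow> real \<Rightarrow> bool" where
  "jet1 S v z f a b \<longleftrightarrow> smooth_on S f \<and> f z = a \<and> dd S v f z = b"

definition jet2 :: "'a::euclidean_space set \<Rightarrow> 'a \<Rightarrow> 'a \<Rightarrow> ('a \<Rightarrow> real) \<Rightarrow> real \<Rightarrow> real \<Rightarrow> real \<Rightarrow> bool" where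
  "jet2 S v z f a b c \<longleftrightarrow> smooth_on S f \<and> f z = a \<and> dd S v f z = b \<and> dd S v (dd S v f) z = c"

lemma jet1_eq: "jet1 S v z f a b \<Longrightarrow> a = a' \<Longrightarrow> b = b' \<Longrightarrow> jet1 S v z f a' b'"
  by simp

lemma jet2_eq: "jet2 S v z f a b c \<Longrightarrow> a = a' \<Longrightarrow> b = b' \<Longrightarrow> c = c' \<Longrightarrow> jet2 S v z f a' b' c'"
  by simp

context
  fixes S :: "'a::euclidean_space set" and z :: 'a
  assumes S: "approachable S" and z: "z \<in> S"
begin

lemma jet1_const: "jet1 S v z (\<lambda>x. k) k 0"
  using S z by (simp add: jet1_def)

lemma jet1_add:
  "jet1 S v z f a b \<Longrightarrow> jet1 S v z g a' b' \<Longrightarrow> jet1 S v z (\<lambda>x. f x + g x) (a + a') (b + b')"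
  using S z by (auto simp: jet1_def dd_add intro: smooth_on_add)

lemma jet1_diff:
  "jet1 S v z f a b \<Longrightarrow> jet1 S v z g a' b' \<Longrightarrow> jet1 S v z (\<lambda>x. f x - g x) (a - a') (b - b')"
  using S z by (auto simp: jet1_def dd_diff intro: smooth_on_diff)

lemma jet1_mult:
  "jet1 S v z f a b \<Longrightarrow> jet1 S v z g a' b' \<Longrightarrow> jet1 S v z (\<lambda>x. f x * g x) (a * a') (a * b' + b * a')"
  using S z by (auto simp: jet1_def dd_mult intro: smooth_on_mult)

lemma jet1_power2:
  assumes "jet1 S v z f a b" shows "jet1 S v z (\<lambda>x. (f x)\<^sup>2) (a\<^sup>2) (2 * a * b)"
  by (rule jet1_eq[OF jet1_mult[OF assms assms], folded power2_eq_square]) simp_all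

lemma jet2_const: "jet2 S v z (\<lambda>x. k) k 0 0"
proof -
  have "dd S v (dd S v (\<lambda>x. k)) z = dd S v (\<lambda>x. 0 :: real) z"
    by (rule dd_cong[OF z]) (simp add: S)
  then show ?thesis using S z by (simp add: jet2_def)
qed

lemma jet2_add:
  assumes "jet2 S v z f a b c" "jet2 S v z g a' b' c'"
  shows "jet2 S v z (\<lambda>x. f x + g x) (a + a') (b + b') (c + c')"
proof -
  have f: "smooth_on S f" and g: "smooth_on S g" using assms by (simp_all add: jet2_def)
  have "dd S v (dd S v (\<lambda>x. f x + g x)) z = dd S v (\<lambda>x. dd S v f x + dd S v g x) z"
    by (rule dd_cong[OF z]) (rule dd_add[OF S _ f g])
  also have "\<dots> = dd S v (dd S v f) z + dd S v (dd S v g) z"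
    by (intro dd_add S z smooth_on_dd f g)
  finally show ?thesis using assms S z by (auto simp: jet2_def dd_add intro: smooth_on_add)
qed

lemma jet2_diff:
  assumes "jet2 S v z f a b c" "jet2 S v z g a' b' c'"
  shows "jet2 S v z (\<lambda>x. f x - g x) (a - a') (b - b') (c - c')"
proof -
  have f: "smooth_on S f" and g: "smooth_on S g" using assms by (simp_all add: jet2_def)
  have "dd S v (dd S v (\<lambda>x. f x - g x)) z = dd S v (\<lambda>x. dd S v f x - dd S v g x) z"
    by (rule dd_cong[OF z]) (rule dd_diff[OF S _ f g])
  also have "\<dots> = dd S v (dd S v f) z - dd S v (dd S v g) z"
    by (intro dd_diff S z smooth_on_dd f g)
  finally show ?thesis using assms S z by (auto simp: jet2_def dd_diff intro: smooth_on_diff)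
qed

lemma dd_dd_bilinear:
  assumes "bounded_bilinear b" and f: "smooth_on S f" and g: "smooth_on S g"
  shows "dd S w (dd S v (\<lambda>x. b (f x) (g x))) z =
    b (f z) (dd S w (dd S v g) z) + b (dd S w f z) (dd S v g z)
    + b (dd S v f z) (dd S w g z) + b (dd S w (dd S v f) z) (g z)"
proof -
  note sm = smooth_on_add smooth_on_bilinear[OF assms(1)] smooth_on_dd S f g
  have "dd S w (dd S v (\<lambda>x. b (f x) (g x))) z
      = dd S w (\<lambda>x. b (f x) (dd S v g x) + b (dd S v f x) (g x)) z"
    by (rule dd_cong[OF z]) (rule dd_bilinear[OF assms(1) S _ f g])
  also have "\<dots> = dd S w (\<lambda>x. b (f x) (dd S v g x)) z + dd S w (\<lambda>x. b (dd S v f x) (g x)) z"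
    by (intro dd_add S z sm)
  also have "dd S w (\<lambda>x. b (f x) (dd S v g x)) z = b (f z) (dd S w (dd S v g) z) + b (dd S w f z) (dd S v g z)"
    by (intro dd_bilinear assms S z sm)
  also have "dd S w (\<lambda>x. b (dd S v f x) (g x)) z = b (dd S v f z) (dd S w g z) + b (dd S w (dd S v f) z) (g z)"
    by (intro dd_bilinear assms S z sm)
  finally show ?thesis by simp
qed

lemma jet2_mult:
  assumes "jet2 S v z f a b c" "jet2 S v z g a' b' c'"
  shows "jet2 S v z (\<lambda>x. f x * g x) (a * a') (a * b' + b * a') (a * c' + 2 * (b * b') + c * a')"
  using assms S z dd_dd_bilinear[OF bounded_bilinear_mult, of f g v v]
  by (auto simp: jet2_def dd_mult intro: smooth_on_mult)

lemma jet2_power2: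
  assumes "jet2 S v z f a b c"
  shows "jet2 S v z (\<lambda>x. (f x)\<^sup>2) (a\<^sup>2) (2 * a * b) (2 * a * c + 2 * b\<^sup>2)"
  by (rule jet2_eq[OF jet2_mult[OF assms assms], folded power2_eq_square])
    (simp_all add: power2_eq_square)

lemmas jet1_intros = jet1_const jet1_add jet1_diff jet1_mult jet1_power2
lemmas jet2_intros = jet2_const jet2_add jet2_diff jet2_mult jet2_power2

end

text \<open>Only entries on and above the diagonal are used: the matrices are symmetric.\<close>

definition det3 :: "(3 \<Rightarrow> 3 \<Rightarrow> real) \<Rightarrow> real" where
  "det3 m = m 1 1 * m 2 2 * m 3 3 + 2 * (m 1 2 * m 1 3 * m 2 3)
     - m 1 1 * (m 2 3)\<^sup>2 - m 2 2 * (m 1 3)\<^sup>2 - m 3 3 * (m 1 2)\<^sup>2"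

text \<open>The derivative of \<^const>\<open>det3\<close> at \<open>g\<close> in direction \<open>h\<close>.\<close>

definition mixed_det :: "(3 \<Rightarrow> 3 \<Rightarrow> real) \<Rightarrow> (3 \<Rightarrow> 3 \<Rightarrow> real) \<Rightarrow> real" where
  "mixed_det g h =
     h 1 1 * (g 2 2 * g 3 3 - (g 2 3)\<^sup>2) + h 2 2 * (g 1 1 * g 3 3 - (g 1 3)\<^sup>2)
     + h 3 3 * (g 1 1 * g 2 2 - (g 1 2)\<^sup>2)
     + 2 * (h 1 2 * (g 1 3 * g 2 3 - g 3 3 * g 1 2) + h 1 3 * (g 1 2 * g 2 3 - g 2 2 * g 1 3)
       + h 2 3 * (g 1 2 * g 1 3 - g 1 1 * g 2 3))"

text \<open>For the identity metric, \<open>mixed_det g h\<close>, \<open>mixed_det h g\<close> and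
  \<open>det3 h\<close> are E_1, E_2 and E_3 of the principal curvatures. Each picks up the squared
  determinant of a change of frame, so for a general metric this is psi times
  \<open>(det3 g)^2\<close>: psi with its denominator cleared.\<close>

definition psi_numerator :: "(3 \<Rightarrow> 3 \<Rightarrow> real) \<Rightarrow> (3 \<Rightarrow> 3 \<Rightarrow> real) \<Rightarrow> real" where
  "psi_numerator g h = 2 * (mixed_det h g)\<^sup>2 - 6 * (mixed_det g h * det3 h)"

definition psi_fun :: "real \<Rightarrow> real \<Rightarrow> real \<Rightarrow> real" where
  "psi_fun a b c = 2 * (a * b + a * c + b * c)\<^sup>2 - 6 * ((a + b + c) * (a * b * c))"

definition diag3 :: "(3 \<Rightarrow> real) \<Rightarrow> 3 \<Rightarrow> 3 \<Rightarrow> real" where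
  "diag3 m i j = (if i = j then m i else 0)"

abbreviation "id3 \<equiv> diag3 (\<lambda>_. 1)"

context
  fixes S :: "'a::euclidean_space set" and z v :: 'a
  assumes S: "approachable S" and z: "z \<in> S"
begin

text \<open>This serves the time direction, in which the metric moves too. Subtracting the constant
  multiple of \<open>(det3 g)^2\<close> cancels the trace of \<open>g'\<close>; the rest groups into
  the derivatives \<open>h' - m g'\<close> of the diagonal of the Weingarten map. Off-diagonal
  entries drop out to first order at a diagonal matrix.\<close>

lemma jet1_psi_numerator:
  assumes g: "\<And>i j. jet1 S v z (g i j) (id3 i j) (g' i j)"
    and h: "\<And>i j. jet1 S v z (h i j) (diag3 m i j) (h' i j)"
  shows "jet1 S v z (\<lambda>x. psi_numerator (\<lambda>i j. g i j x) (\<lambda>i j. h i j x)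
        - psi_fun (m 1) (m 2) (m 3) * (det3 (\<lambda>i j. g i j x))\<^sup>2) 0
      (psi_deriv (m 1) (m 2) (m 3) * (h' 1 1 - m 1 * g' 1 1)
       + psi_deriv (m 2) (m 1) (m 3) * (h' 2 2 - m 2 * g' 2 2)
       + psi_deriv (m 3) (m 1) (m 2) * (h' 3 3 - m 3 * g' 3 3))"
  unfolding psi_numerator_def mixed_det_def det3_def
  apply (rule jet1_eq)
    apply (rule jet1_intros[OF S z] g h)+
   apply (simp_all add: diag3_def psi_fun_def psi_deriv_def)
   apply algebra+
  done

lemma jet2_det3:
  assumes m: "\<And>i j. jet2 S v z (h i j) (diag3 m i j) (h' i j) (h'' i j)"
  shows "jet2 S v z (\<lambda>x. det3 (\<lambda>i j. h i j x)) (m 1 * m 2 * m 3)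
      (m 2 * m 3 * h' 1 1 + m 1 * m 3 * h' 2 2 + m 1 * m 2 * h' 3 3)
      (m 2 * m 3 * h'' 1 1 + m 1 * m 3 * h'' 2 2 + m 1 * m 2 * h'' 3 3
       + det_hess (m 1) (m 2) (m 3) (h' 1 1) (h' 2 2) (h' 3 3) (h' 1 2) (h' 1 3) (h' 2 3))"
  unfolding det3_def
  apply (rule jet2_eq)
     apply (rule jet2_intros[OF S z] m)+
   apply (simp_all add: diag3_def det_hess_def)
   apply algebra+
  done

lemma jet2_mixed_det1:
  assumes g: "\<And>i j. jet2 S v z (g i j) (id3 i j) 0 (g'' i j)"
    and h: "\<And>i j. jet2 S v z (h i j) (diag3 m i j) (h' i j) (h'' i j)"
  shows "jet2 S v z (\<lambda>x. mixed_det (\<lambda>i j. g i j x) (\<lambda>i j. h i j x)) (m 1 + m 2 + m 3)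
      (h' 1 1 + h' 2 2 + h' 3 3)
      (h'' 1 1 + h'' 2 2 + h'' 3 3
       + (m 2 + m 3) * g'' 1 1 + (m 1 + m 3) * g'' 2 2 + (m 1 + m 2) * g'' 3 3)"
  unfolding mixed_det_def
  apply (rule jet2_eq)
     apply (rule jet2_intros[OF S z] g h)+
   apply (simp_all add: diag3_def)
   apply algebra+
  done

lemma jet2_mixed_det2:
  assumes g: "\<And>i j. jet2 S v z (g i j) (id3 i j) 0 (g'' i j)"
    and h: "\<And>i j. jet2 S v z (h i j) (diag3 m i j) (h' i j) (h'' i j)"
  shows "jet2 S v z (\<lambda>x. mixed_det (\<lambda>i j. h i j x) (\<lambda>i j. g i j x)) (m 1 * m 2 + m 1 * m 3 + m 2 * m 3)
      ((m 2 + m 3) * h' 1 1 + (m 1 + m 3) * h' 2 2 + (m 1 + m 2) * h' 3 3)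
      ((m 2 + m 3) * h'' 1 1 + (m 1 + m 3) * h'' 2 2 + (m 1 + m 2) * h'' 3 3
       + 2 * (h' 1 1 * h' 2 2 - (h' 1 2)\<^sup>2 + h' 1 1 * h' 3 3 - (h' 1 3)\<^sup>2 + h' 2 2 * h' 3 3 - (h' 2 3)\<^sup>2)
       + m 2 * m 3 * g'' 1 1 + m 1 * m 3 * g'' 2 2 + m 1 * m 2 * g'' 3 3)"
  unfolding mixed_det_def
  apply (rule jet2_eq)
     apply (rule jet2_intros[OF S z] g h)+
   apply (simp_all add: diag3_def)
   apply algebra+
  done

text \<open>This serves the spatial directions of a normal parametrization, where the metric has no
  first derivatives. Products of first derivatives then come from \<open>h\<close> alone and are
  collected in \<open>psi_hess\<close>; as in the first order case, \<open>g''\<close> only corrects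
  \<open>h''\<close>.\<close>

lemma jet2_psi_numerator:
  assumes g: "\<And>i j. jet2 S v z (g i j) (id3 i j) 0 (g'' i j)"
    and h: "\<And>i j. jet2 S v z (h i j) (diag3 m i j) (h' i j) (h'' i j)"
  shows "jet2 S v z (\<lambda>x. psi_numerator (\<lambda>i j. g i j x) (\<lambda>i j. h i j x)
        - psi_fun (m 1) (m 2) (m 3) * (det3 (\<lambda>i j. g i j x))\<^sup>2) 0
      (psi_deriv (m 1) (m 2) (m 3) * h' 1 1 + psi_deriv (m 2) (m 1) (m 3) * h' 2 2
       + psi_deriv (m 3) (m 1) (m 2) * h' 3 3)
      (psi_deriv (m 1) (m 2) (m 3) * (h'' 1 1 - m 1 * g'' 1 1)
       + psi_deriv (m 2) (m 1) (m 3) * (h'' 2 2 - m 2 * g'' 2 2)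
       + psi_deriv (m 3) (m 1) (m 2) * (h'' 3 3 - m 3 * g'' 3 3)
       + psi_hess (m 1) (m 2) (m 3) (h' 1 1) (h' 2 2) (h' 3 3) (h' 1 2) (h' 1 3) (h' 2 3))"
  unfolding psi_numerator_def
  apply (rule jet2_eq)
     apply (rule jet2_intros[OF S z] jet2_mixed_det1[of g g'' h m h' h''] jet2_mixed_det2[of g g'' h m h' h'']
      jet2_det3[of h m h' h''] jet2_det3[of g "\<lambda>_. 1" "\<lambda>_ _. 0" g''] g h)+
   apply (simp_all add: psi_fun_def psi_deriv_def psi_hess_def det_hess_def)
   apply algebra+
  done

end

subsection \<open>Local solutions of the flow\<close>

definition space_dir :: "3 \<Rightarrow> (real^3) \<times> real" where
  "space_dir i = (axis i 1, 0)"

definition time_dir :: "(real^3) \<times> real" where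
  "time_dir = (0, 1)"

text \<open>\<open>K\<close> and \<open>N\<close> are smooth functions tied to the parametrization
  only by the listed equations. In determinant form the equation for the Gauss curvature stays true
  at points where the parametrization degenerates, which the quadratic change of parameters used
  later may do away from its base point.\<close>

locale flow_chart =
  fixes U :: "(real^3) set" and T :: ereal and S :: "((real^3) \<times> real) set"
    and Y :: "(real^3) \<times> real \<Rightarrow> real^4" and K :: "(real^3) \<times> real \<Rightarrow> real"
    and N :: "(real^3) \<times> real \<Rightarrow> real^4"
  assumes open_U: "open U" and S_eq: "S = U \<times> time_interval T"
    and smooth_Y: "smooth_on S Y" and smooth_K: "smooth_on S K" and smooth_N: "smooth_on S N"
    and evolution: "z \<in> S \<Longrightarrow> dd S time_dir Y z = - (K z *\<^sub>R N z)"
    and unit_N: "z \<in> S \<Longrightarrow> N z \<bullet> N z = 1"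
    and normal_N: "z \<in> S \<Longrightarrow> dd S (space_dir i) Y z \<bullet> N z = 0"
    and gauss_equation: "z \<in> S \<Longrightarrow>
      K z * det3 (\<lambda>i j. dd S (space_dir i) Y z \<bullet> dd S (space_dir j) Y z)
      = det3 (\<lambda>i j. - (dd S (space_dir j) (dd S (space_dir i) Y) z \<bullet> N z))"
begin

definition "Y1 i = dd S (space_dir i) Y"
definition "Y2 i j = dd S (space_dir j) (Y1 i)"
definition "g i j z = Y1 i z \<bullet> Y1 j z"
definition "h i j z = - (Y2 i j z \<bullet> N z)"

abbreviation "I \<equiv> time_interval T"
abbreviation "gm z \<equiv> \<lambda>i j. g i j z"
abbreviation "hm z \<equiv> \<lambda>i j. h i j z"
abbreviation "DX i \<equiv> dd S (space_dir i)"
abbreviation "DT \<equiv> dd S time_dir"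
abbreviation "psi_gap c z \<equiv> psi_numerator (gm z) (hm z) - c * (det3 (gm z))\<^sup>2"

lemma appr_S: "approachable S"
  unfolding S_eq by (rule cylinder_approachable[OF open_U])

lemma smooth_dd [intro]: "smooth_on S f \<Longrightarrow> smooth_on S (dd S v f)"
  by (rule smooth_on_dd[OF appr_S])

lemma smooth_Y1: "smooth_on S (Y1 i)"
  unfolding Y1_def by (intro smooth_dd smooth_Y)

lemma smooth_Y2: "smooth_on S (Y2 i j)"
  unfolding Y2_def by (intro smooth_dd smooth_Y1)

lemmas smooth_basic = smooth_Y smooth_K smooth_N smooth_Y1 smooth_Y2
lemmas smooths = smooth_basic smooth_dd smooth_on_inner smooth_on_scaleR smooth_on_mult
  smooth_on_add smooth_on_diff smooth_on_minus smooth_on_const smooth_on_power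

lemma smooth_g: "smooth_on S (g i j)"
  unfolding g_def[abs_def] by (intro smooths)

lemma smooth_h: "smooth_on S (h i j)"
  unfolding h_def[abs_def] by (intro smooths)

lemma commute:
  fixes f :: "(real^3) \<times> real \<Rightarrow> 'b::euclidean_space"
  shows "smooth_on S f \<Longrightarrow> z \<in> S \<Longrightarrow> dd S v (dd S w f) z = dd S w (dd S v f) z"
  using dd_commute[OF appr_S] cylinder_closure_interior[OF open_U] unfolding S_eq by blast

lemma Y2_commute: "z \<in> S \<Longrightarrow> Y2 i j z = Y2 j i z"
  unfolding Y2_def Y1_def by (rule commute[OF smooth_Y])

lemma Y3_commute: "z \<in> S \<Longrightarrow> dd S v (Y2 i j) z = dd S v (Y2 j i) z"
  by (rule dd_cong[OF _ Y2_commute])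

lemma Y3_commute': "z \<in> S \<Longrightarrow> DX k (Y2 i j) z = DX j (Y2 i k) z"
  unfolding Y2_def by (rule commute[OF smooth_Y1])

lemma h_commute: "z \<in> S \<Longrightarrow> h i j z = h j i z"
  by (simp add: h_def Y2_commute)

lemma dd_inner_eq_const:
  assumes "smooth_on S f" "smooth_on S f'" "\<And>z. z \<in> S \<Longrightarrow> f z \<bullet> f' z = c" "z \<in> S"
  shows "f z \<bullet> dd S v f' z + dd S v f z \<bullet> f' z = 0"
proof -
  have "dd S v (\<lambda>z. f z \<bullet> f' z) z = dd S v (\<lambda>_. c) z"
    by (rule dd_cong[OF assms(4)]) (simp add: assms)
  then show ?thesis using assms appr_S by (simp add: dd_inner)
qed

lemma N_dd_N: "z \<in> S \<Longrightarrow> N z \<bullet> dd S v N z = 0"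
  using dd_inner_eq_const[OF smooth_N smooth_N unit_N, of z v] by (simp add: inner_commute)

lemma Y1_N: "z \<in> S \<Longrightarrow> Y1 i z \<bullet> N z = 0"
  unfolding Y1_def by (rule normal_N)

lemma Y1_dd_N: "z \<in> S \<Longrightarrow> Y1 i z \<bullet> DX j N z = h i j z"
  using dd_inner_eq_const[OF smooth_Y1 smooth_N Y1_N, of z i "space_dir j"] by (simp add: h_def Y2_def)

lemma N_dd_dd_N: "z \<in> S \<Longrightarrow> N z \<bullet> dd S w (dd S v N) z = - (dd S w N z \<bullet> dd S v N z)"
  using dd_inner_eq_const[OF smooth_N smooth_dd[OF smooth_N] N_dd_N, of z w v] by simp

lemma dd_time_Y:
  assumes "z \<in> S"
  shows "DT (Y1 i) z
    = - (K z *\<^sub>R DX i N z + DX i K z *\<^sub>R N z)"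
proof -
  have "DT (Y1 i) z = DX i (DT Y) z"
    unfolding Y1_def by (rule commute[OF smooth_Y assms])
  also have "\<dots> = DX i (\<lambda>z. - (K z *\<^sub>R N z)) z"
    by (rule dd_cong[OF assms evolution])
  finally show ?thesis
    using assms appr_S smooth_K smooth_N by (simp add: dd_minus dd_scaleR smooths)
qed

lemma dd_time_Y2:
  assumes z: "z \<in> S"
  shows "DT (Y2 i j) z
    = - (K z *\<^sub>R DX j (DX i N) z
       + DX j K z *\<^sub>R DX i N z
       + DX i K z *\<^sub>R DX j N z
       + DX j (DX i K) z *\<^sub>R N z)"
proof -
  have "DT (Y2 i j) z = DX j (DT (Y1 i)) z"
    unfolding Y2_def by (rule commute[OF smooth_Y1 z])
  also have "\<dots> = DX j
      (\<lambda>z. - (K z *\<^sub>R DX i N z + DX i K z *\<^sub>R N z)) z"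
    by (rule dd_cong[OF z dd_time_Y])
  also have "\<dots> = - DX j
      (\<lambda>z. K z *\<^sub>R DX i N z + DX i K z *\<^sub>R N z) z"
    by (intro dd_minus appr_S z smooths)
  also have "DX j
      (\<lambda>z. K z *\<^sub>R DX i N z + DX i K z *\<^sub>R N z) z
    = DX j (\<lambda>z. K z *\<^sub>R DX i N z) z
      + DX j (\<lambda>z. DX i K z *\<^sub>R N z) z"
    by (intro dd_add appr_S z smooths)
  finally show ?thesis
    using z appr_S smooth_K smooth_N by (simp add: dd_scaleR smooths)
qed

lemma dd_g:
  "z \<in> S \<Longrightarrow> dd S v (g i j) z = Y1 i z \<bullet> dd S v (Y1 j) z + dd S v (Y1 i) z \<bullet> Y1 j z"
  unfolding g_def[abs_def] by (intro dd_inner appr_S smooths)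

lemma dd_h:
  assumes "z \<in> S"
  shows "dd S v (h i j) z = - (Y2 i j z \<bullet> dd S v N z + dd S v (Y2 i j) z \<bullet> N z)"
proof -
  have "dd S v (h i j) z = - dd S v (\<lambda>z. Y2 i j z \<bullet> N z) z"
    unfolding h_def[abs_def] by (intro dd_minus appr_S assms smooths)
  also have "dd S v (\<lambda>z. Y2 i j z \<bullet> N z) z = Y2 i j z \<bullet> dd S v N z + dd S v (Y2 i j) z \<bullet> N z"
    by (intro dd_inner appr_S assms smooths)
  finally show ?thesis .
qed

lemma dd_dd_g:
  "z \<in> S \<Longrightarrow> dd S v (dd S v (g i j)) z = Y1 i z \<bullet> dd S v (dd S v (Y1 j)) z
    + 2 * (dd S v (Y1 i) z \<bullet> dd S v (Y1 j) z) + dd S v (dd S v (Y1 i)) z \<bullet> Y1 j z"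
  unfolding g_def[abs_def]
  using dd_dd_bilinear[OF appr_S _ bounded_bilinear_inner smooth_Y1 smooth_Y1] by simp

lemma dd_dd_h:
  assumes z: "z \<in> S"
  shows "dd S v (dd S v (h i j)) z = - (Y2 i j z \<bullet> dd S v (dd S v N) z
    + 2 * (dd S v (Y2 i j) z \<bullet> dd S v N z) + dd S v (dd S v (Y2 i j)) z \<bullet> N z)"
proof -
  have "dd S v (dd S v (h i j)) z = dd S v (\<lambda>z. - dd S v (\<lambda>z. Y2 i j z \<bullet> N z) z) z"
    unfolding h_def[abs_def]
    by (rule dd_cong[OF z]) (rule dd_minus[OF appr_S], assumption, intro smooths)
  also have "\<dots> = - dd S v (dd S v (\<lambda>z. Y2 i j z \<bullet> N z)) z"
    by (intro dd_minus appr_S z smooths)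
  finally show ?thesis
    using dd_dd_bilinear[OF appr_S z bounded_bilinear_inner smooth_Y2 smooth_N] by simp
qed

end

text \<open>At \<open>z0\<close> the Gauss and Weingarten formulas reduce to single terms, and
  partial derivatives of the second fundamental form agree with covariant ones. The normalization
  concerns this one point only, so second derivatives of the metric have to be kept.\<close>

locale normal_chart = flow_chart +
  fixes z0 :: "(real^3) \<times> real" and m :: "3 \<Rightarrow> real"
  assumes z0: "z0 \<in> S"
    and g_z0: "g i j z0 = id3 i j"
    and h_z0: "h i j z0 = diag3 m i j"
    and normal_Y2: "Y2 i j z0 \<bullet> Y1 k z0 = 0"
begin

lemma frame_eqI:
  assumes "\<And>i. u \<bullet> Y1 i z0 = w \<bullet> Y1 i z0" "u \<bullet> N z0 = w \<bullet> N z0"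
  shows "u = w"
  using g_z0 Y1_N[OF z0] unit_N[OF z0] assms
  by (intro orthonormal_frame_eqI[of "\<lambda>i. Y1 i z0" "N z0"]) (auto simp: g_def diag3_def)

lemma weingarten: "DX i N z0 = m i *\<^sub>R Y1 i z0"
proof (rule frame_eqI)
  fix j
  show "DX i N z0 \<bullet> Y1 j z0 = (m i *\<^sub>R Y1 i z0) \<bullet> Y1 j z0"
    using Y1_dd_N[OF z0, of j i] h_z0[of j i] g_z0[of i j]
    by (auto simp: inner_commute diag3_def g_def)
  show "DX i N z0 \<bullet> N z0 = (m i *\<^sub>R Y1 i z0) \<bullet> N z0"
    using N_dd_N[OF z0, of "space_dir i"] Y1_N[OF z0] by (simp add: inner_commute)
qed

lemma gauss_formula: "Y2 i j z0 = - (diag3 m i j *\<^sub>R N z0)"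
proof (rule frame_eqI)
  fix k
  show "Y2 i j z0 \<bullet> Y1 k z0 = - (diag3 m i j *\<^sub>R N z0) \<bullet> Y1 k z0"
    using normal_Y2 Y1_N[OF z0, of k] by (simp add: inner_commute)
  show "Y2 i j z0 \<bullet> N z0 = - (diag3 m i j *\<^sub>R N z0) \<bullet> N z0"
    using h_z0[of i j] unit_N[OF z0] by (simp add: h_def)
qed

text \<open>\<open>ddw k i\<close> is the second derivative in direction \<open>k\<close> of the \<open>i\<close>-th diagonal entry of the
  Weingarten map, since the first derivatives of the metric vanish at \<open>z0\<close>.\<close>

definition "dh i j k = DX k (h i j) z0"
definition "ddg k i j = DX k (DX k (g i j)) z0"
definition "ddh k i j = DX k (DX k (h i j)) z0"
definition "ddw k i = ddh k i i - m i * ddg k i i"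

lemma dg_zero: "DX k (g i j) z0 = 0"
  using normal_Y2[of j k i] normal_Y2[of i k j] by (simp add: dd_g[OF z0] inner_commute Y2_def)

lemma dh_eq: "dh i j k = - (DX k (Y2 i j) z0 \<bullet> N z0)"
  unfolding dh_def dd_h[OF z0] weingarten using normal_Y2 by simp

text \<open>The Codazzi equations: as \<open>Y2\<close> has no tangential part at \<open>z0\<close>,
  a first derivative of \<open>h\<close> is the normal component of a third derivative of
  \<open>Y\<close>.\<close>

lemma dh_commute: "dh i j k = dh j i k" "dh i j k = dh i k j"
  unfolding dh_eq using Y3_commute[OF z0, of _ i j] Y3_commute'[OF z0, of k i j] by auto

lemma ddg_eq: "ddg k i i = 2 * (DX k (Y2 i k) z0 \<bullet> Y1 i z0) + 2 * (diag3 m i k)\<^sup>2"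
  unfolding ddg_def dd_dd_g[OF z0] Y2_def[symmetric] gauss_formula
  using unit_N[OF z0] by (simp add: inner_commute power2_eq_square)

lemma ddh_eq: "ddh k i i = - (DX k (DX k (Y2 i i)) z0 \<bullet> N z0)
    - 2 * m k * (DX k (Y2 i i) z0 \<bullet> Y1 k z0) - m i * (m k)\<^sup>2"
proof -
  have "N z0 \<bullet> DX k (DX k N) z0 = - (m k)\<^sup>2"
    unfolding N_dd_dd_N[OF z0] weingarten using g_z0[of k k]
    by (simp add: g_def diag3_def power2_eq_square)
  then show ?thesis
    unfolding ddh_def dd_dd_h[OF z0] weingarten gauss_formula by (simp add: diag3_def)
qed

text \<open>Simons' identity: the fourth derivatives of the parametrization commute.\<close>

lemma ddw_exchange: "ddw k i - ddw i k = m k * (m i)\<^sup>2 - m i * (m k)\<^sup>2"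
proof -
  have 4: "DX k (DX k (Y2 i i)) z0
      = DX i (DX i (Y2 k k)) z0"
  proof -
    have "DX k (DX k (Y2 i i)) z0
        = DX k (DX i (Y2 i k)) z0"
      by (rule dd_cong[OF z0 Y3_commute'])
    also have "\<dots> = DX i (DX k (Y2 i k)) z0"
      by (rule commute[OF smooth_Y2 z0])
    also have "\<dots> = DX i (DX k (Y2 k i)) z0"
      by (rule dd_cong[OF z0 Y3_commute])
    also have "\<dots> = DX i (DX i (Y2 k k)) z0"
      by (rule dd_cong[OF z0 Y3_commute'])
    finally show ?thesis .
  qed
  have 3: "DX k (Y2 i k) z0 = DX i (Y2 k k) z0" for i k
    using Y3_commute[OF z0, of _ i k] Y3_commute'[OF z0, of i k k] by simp
  have "diag3 m k i = diag3 m i k" by (simp add: diag3_def)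
  moreover have "m i * (diag3 m i k)\<^sup>2 = m k * (diag3 m i k)\<^sup>2" by (simp add: diag3_def)
  ultimately show ?thesis
    unfolding ddw_def ddg_eq ddh_eq 4 3[of i k] 3[of k i] by (auto simp: algebra_simps)
qed

lemma jet2_g: "jet2 S (space_dir k) z0 (g i j) (id3 i j) 0 (ddg k i j)"
  using smooth_g g_z0 dg_zero by (simp add: jet2_def ddg_def)

lemma jet2_h: "jet2 S (space_dir k) z0 (h i j) (diag3 m i j) (dh i j k) (ddh k i j)"
  using smooth_h h_z0 by (simp add: jet2_def ddh_def dh_def)

lemma K_z0: "K z0 = m 1 * m 2 * m 3"
  using gauss_equation[OF z0] g_z0 h_z0
  by (simp add: Y1_def[symmetric] Y2_def[symmetric] g_def[symmetric] h_def[symmetric] det3_def diag3_def)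

text \<open>Two differentiations of \<open>K * det g = det h\<close>. The first derivatives of
  \<open>det g\<close> vanish at \<open>z0\<close>, so there is no cross term with the derivative of
  \<open>K\<close>, and the second derivatives of the metric combine with those of \<open>h\<close>
  into \<open>ddw\<close>.\<close>

lemma ddK:
  "DX k (DX k K) z0
   = m 2 * m 3 * ddw k 1 + m 1 * m 3 * ddw k 2 + m 1 * m 2 * ddw k 3
     + det_hess (m 1) (m 2) (m 3) (dh 1 1 k) (dh 2 2 k) (dh 3 3 k) (dh 1 2 k) (dh 1 3 k) (dh 2 3 k)"
proof -
  let ?v = "space_dir k"
  let ?G = "\<lambda>z. det3 (gm z)" and ?H = "\<lambda>z. det3 (hm z)"
  have eq: "K z * ?G z = ?H z" if "z \<in> S" for z
    using gauss_equation[OF that]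
    by (simp add: Y1_def[symmetric] Y2_def[symmetric] g_def[symmetric] h_def[symmetric])
  note jG = jet2_det3[OF appr_S z0 jet2_g, of k]
  note jH = jet2_det3[OF appr_S z0 jet2_h, of k]
  have "jet2 S ?v z0 K (K z0) (dd S ?v K z0) (dd S ?v (dd S ?v K) z0)"
    using smooth_K by (simp add: jet2_def)
  note jKG = jet2_mult[OF appr_S z0 this jG]
  have smG: "smooth_on S ?G" and smH: "smooth_on S ?H" using jG jH by (auto simp: jet2_def)
  have "dd S ?v (dd S ?v (\<lambda>z. K z * ?G z)) z0 = dd S ?v (dd S ?v ?H) z0"
    by (rule dd_cong[OF z0 dd_cong[OF _ eq]])
  then have "dd S ?v (dd S ?v K) z0 = - K z0 * (ddg k 1 1 + ddg k 2 2 + ddg k 3 3)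
     + (m 2 * m 3 * ddh k 1 1 + m 1 * m 3 * ddh k 2 2 + m 1 * m 2 * ddh k 3 3
       + det_hess (m 1) (m 2) (m 3) (dh 1 1 k) (dh 2 2 k) (dh 3 3 k) (dh 1 2 k) (dh 1 3 k) (dh 2 3 k))"
    using jKG jH by (simp add: jet2_def det_hess_def)
  then show ?thesis unfolding K_z0 ddw_def by (simp add: algebra_simps)
qed

lemma dt_g: "DT (g i j) z0 = - 2 * K z0 * diag3 m i j"
proof -
  have "Y1 i z0 \<bullet> Y1 j z0 = id3 i j" for i j using g_z0 by (simp add: g_def)
  then show ?thesis
    unfolding dd_g[OF z0] dd_time_Y[OF z0] weingarten inner_add_left inner_add_right
      inner_minus_left inner_minus_right inner_scaleR_left inner_scaleR_right
    using Y1_N[OF z0] by (simp add: inner_add_right inner_add_left inner_commute[of "N z0" "Y1 _ z0"] diag3_def)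
qed

lemma dt_h: "DT (h i i) z0
    = DX i (DX i K) z0 - K z0 * (m i)\<^sup>2"
proof -
  have "DX i (DX i N) z0 \<bullet> N z0 = - (m i)\<^sup>2"
    unfolding inner_commute[of _ "N z0"] N_dd_dd_N[OF z0] weingarten using g_z0[of i i]
    by (simp add: g_def diag3_def power2_eq_square)
  then show ?thesis
    unfolding dd_h[OF z0] dd_time_Y2[OF z0] weingarten gauss_formula
      inner_add_left inner_minus_left inner_scaleR_left
    using N_dd_N[OF z0, of time_dir] Y1_N[OF z0] unit_N[OF z0] by simp
qed

text \<open>The evolution of a diagonal entry of the Weingarten map: the metric changes at the rate
  -2 K m_i, which turns -K m_i^2 in the evolution of \<open>h\<close> into +K m_i^2.\<close>

lemma dt_w: "DT (h i i) z0 - m i * DT (g i i) z0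
    = DX i (DX i K) z0 + K z0 * (m i)\<^sup>2"
  unfolding dt_h dt_g by (simp add: diag3_def power2_eq_square)

end

section \<open>Quadratic forms and the pinching defect\<close>

definition qform :: "(3 \<Rightarrow> 3 \<Rightarrow> real) \<Rightarrow> real^3 \<Rightarrow> real" where
  "qform m v = (\<Sum>i\<in>UNIV. \<Sum>j\<in>UNIV. m i j * (v $ i * v $ j))"

definition upper_qform :: "(3 \<Rightarrow> 3 \<Rightarrow> real) \<Rightarrow> real \<Rightarrow> real \<Rightarrow> real \<Rightarrow> real" where
  "upper_qform m a b c = m 1 1 * a\<^sup>2 + m 2 2 * b\<^sup>2 + m 3 3 * c\<^sup>2
    + 2 * (m 1 2 * (a * b) + m 1 3 * (a * c) + m 2 3 * (b * c))"

lemma qform_upper: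
  assumes "\<And>i j. m i j = m j i"
  shows "qform m v = upper_qform m (v $ 1) (v $ 2) (v $ 3)"
  unfolding qform_def upper_qform_def sum_3 assms[of 2 1] assms[of 3 1] assms[of 3 2]
  by (simp add: power2_eq_square algebra_simps)

text \<open>Cross-multiplied comparison of two Rayleigh quotients, hence polynomial in the entries
  of both matrices and in both vectors.\<close>

definition pinching_defect :: "(3 \<Rightarrow> 3 \<Rightarrow> real) \<Rightarrow> (3 \<Rightarrow> 3 \<Rightarrow> real) \<Rightarrow> real^3 \<Rightarrow> real^3 \<Rightarrow> real" where
  "pinching_defect g h v w = qform h v * qform g w - 2 * (qform h w * qform g v)"

context
  fixes S :: "'a::euclidean_space set" and z d :: 'a
  assumes S: "approachable S" and z: "z \<in> S"
begin

lemma jet2_qform_1: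
  assumes m: "\<And>i j. jet2 S d z (h i j) (diag3 m i j) (h' i j) (h'' i j)"
    and v: "jet2 S d z v1 1 0 0" "jet2 S d z v2 0 p 0" "jet2 S d z v3 0 q 0"
  shows "jet2 S d z (\<lambda>x. upper_qform (\<lambda>i j. h i j x) (v1 x) (v2 x) (v3 x))
    (m 1) (h' 1 1) (h'' 1 1 + 4 * (h' 1 2 * p + h' 1 3 * q) + 2 * (m 2 * p\<^sup>2 + m 3 * q\<^sup>2))"
  unfolding upper_qform_def
  apply (rule jet2_eq)
     apply (rule jet2_intros[OF S z] m v)+
   apply (simp_all add: diag3_def)
  done

lemma jet2_qform_3:
  assumes m: "\<And>i j. jet2 S d z (h i j) (diag3 m i j) (h' i j) (h'' i j)"
    and v: "jet2 S d z v1 0 p 0" "jet2 S d z v2 0 q 0" "jet2 S d z v3 1 0 0"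
  shows "jet2 S d z (\<lambda>x. upper_qform (\<lambda>i j. h i j x) (v1 x) (v2 x) (v3 x))
    (m 3) (h' 3 3) (h'' 3 3 + 4 * (h' 1 3 * p + h' 2 3 * q) + 2 * (m 1 * p\<^sup>2 + m 2 * q\<^sup>2))"
  unfolding upper_qform_def
  apply (rule jet2_eq)
     apply (rule jet2_intros[OF S z] m v)+
   apply (simp_all add: diag3_def)
  done

end

abbreviation (in flow_chart) "defect v w z \<equiv> pinching_defect (gm z) (hm z) v w"

lemma (in flow_chart) space_line:
  assumes "z \<in> S"
  obtains r where "r > 0"
    "\<And>s. \<bar>s\<bar> < r \<Longrightarrow> fst (z + s *\<^sub>R space_dir k) \<in> U \<and> z + s *\<^sub>R space_dir k \<in> S
      \<and> snd (z + s *\<^sub>R space_dir k) = snd z"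
proof -
  have "fst z \<in> U" using assms S_eq by auto
  then obtain r where r: "r > 0" "ball (fst z) r \<subseteq> U" using open_U open_contains_ball by metis
  show thesis
  proof (rule that[OF r(1)])
    fix s :: real assume "\<bar>s\<bar> < r"
    then have "fst z + s *\<^sub>R axis k 1 \<in> ball (fst z) r" by (simp add: dist_norm norm_axis_1)
    then show "fst (z + s *\<^sub>R space_dir k) \<in> U \<and> z + s *\<^sub>R space_dir k \<in> S
      \<and> snd (z + s *\<^sub>R space_dir k) = snd z"
      using r(2) assms S_eq by (auto simp: space_dir_def mem_Times_iff)
  qed
qed

section \<open>Signs of the time derivatives at a spatial maximum, in normal form\<close>

context normal_chart
begin

lemma jet1_time_g: "jet1 S time_dir z0 (g i j) (id3 i j) (DT (g i j) z0)"
  by (simp add: jet1_def smooth_g g_z0)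

lemma jet1_time_h: "jet1 S time_dir z0 (h i j) (diag3 m i j) (DT (h i j) z0)"
  by (simp add: jet1_def smooth_h h_z0)

lemma psi_numerator_decreasing:
  assumes pos: "\<And>i. m i > 0" and pinched: "\<And>i j. m i \<le> 2 * m j"
    and max: "\<And>x. x \<in> U \<Longrightarrow> psi_numerator (gm (x, snd z0)) (hm (x, snd z0))
      \<le> psi_fun (m 1) (m 2) (m 3) * (det3 (gm (x, snd z0)))\<^sup>2"
  shows "DT (\<lambda>z. psi_gap (psi_fun (m 1) (m 2) (m 3)) z) z0 \<le> 0"
proof -
  define f where "f z = psi_gap (psi_fun (m 1) (m 2) (m 3)) z" for z
  define P where "P = psi_deriv (m 1) (m 2) (m 3)"
  define Q where "Q = psi_deriv (m 2) (m 1) (m 3)"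
  define R where "R = psi_deriv (m 3) (m 1) (m 2)"
  define H where "H k = psi_hess (m 1) (m 2) (m 3) (dh 1 1 k) (dh 2 2 k) (dh 3 3 k) (dh 1 2 k) (dh 1 3 k) (dh 2 3 k)" for k
  define F where "F k = det_hess (m 1) (m 2) (m 3) (dh 1 1 k) (dh 2 2 k) (dh 3 3 k) (dh 1 2 k) (dh 1 3 k) (dh 2 3 k)" for k
  have space: "P * ddw k 1 + Q * ddw k 2 + R * ddw k 3 + H k \<le> 0" for k
  proof -
    have jet: "jet2 S (space_dir k) z0 f 0
        (P * dh 1 1 k + Q * dh 2 2 k + R * dh 3 3 k) (P * ddw k 1 + Q * ddw k 2 + R * ddw k 3 + H k)"
      unfolding f_def[abs_def] P_def Q_def R_def H_def ddw_def
      by (rule jet2_psi_numerator[OF appr_S z0 jet2_g jet2_h])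
    obtain r where r: "r > 0" "\<And>s. \<bar>s\<bar> < r \<Longrightarrow> fst (z0 + s *\<^sub>R space_dir k) \<in> U \<and>
        z0 + s *\<^sub>R space_dir k \<in> S \<and> snd (z0 + s *\<^sub>R space_dir k) = snd z0"
      using space_line[OF z0, of k] by blast
    have f0: "f z0 = 0" using jet by (simp add: jet2_def)
    have "f (z0 + s *\<^sub>R space_dir k) \<le> f z0" if "\<bar>s\<bar> < r" for s
    proof -
      have "z0 + s *\<^sub>R space_dir k = (fst (z0 + s *\<^sub>R space_dir k), snd z0)"
        using r(2)[OF that] by (metis prod.collapse)
      then show ?thesis using max[of "fst (z0 + s *\<^sub>R space_dir k)"] r(2)[OF that] f0 by (simp add: f_def)
    qed
    then have "DX k (DX k f) z0 \<le> 0"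
      using r jet by (intro second_derivative_test_line(2)[OF appr_S, of f r]) (auto simp: jet2_def)
    then show ?thesis using jet by (simp add: jet2_def)
  qed
  have "jet1 S time_dir z0 f 0
      (P * (DT (h 1 1) z0 - m 1 * DT (g 1 1) z0)
       + Q * (DT (h 2 2) z0 - m 2 * DT (g 2 2) z0)
       + R * (DT (h 3 3) z0 - m 3 * DT (g 3 3) z0))"
    unfolding f_def[abs_def] P_def Q_def R_def
    by (rule jet1_psi_numerator[OF appr_S z0 jet1_time_g jet1_time_h])
  then have time: "DT f z0
      = P * (m 2 * m 3 * ddw 1 1 + m 1 * m 3 * ddw 1 2 + m 1 * m 2 * ddw 1 3 + F 1 + m 1 * m 2 * m 3 * (m 1)\<^sup>2)
      + Q * (m 2 * m 3 * ddw 2 1 + m 1 * m 3 * ddw 2 2 + m 1 * m 2 * ddw 2 3 + F 2 + m 1 * m 2 * m 3 * (m 2)\<^sup>2)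
      + R * (m 2 * m 3 * ddw 3 1 + m 1 * m 3 * ddw 3 2 + m 1 * m 2 * ddw 3 3 + F 3 + m 1 * m 2 * m 3 * (m 3)\<^sup>2)"
    unfolding dt_w ddK K_z0 F_def by (simp add: jet1_def)
  have "P * F 1 + Q * F 2 + R * F 3 \<le> m 2 * m 3 * H 1 + m 1 * m 3 * H 2 + m 1 * m 2 * H 3"
    using psi_gradient_terms[of "m 1" "m 2" "m 3" "dh 1 1 1" "dh 1 2 2" "dh 1 3 3" "dh 1 1 2" "dh 1 1 3"
        "dh 1 2 3" "dh 2 2 2" "dh 2 3 3" "dh 2 2 3" "dh 3 3 3"] pinched
    unfolding F_def H_def P_def Q_def R_def
    using dh_commute(1)[of 1 2] dh_commute(1)[of 1 3] dh_commute(1)[of 2 3]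
      dh_commute(2)[of _ 2 1] dh_commute(2)[of _ 3 1] dh_commute(2)[of _ 3 2]
    by simp
  moreover
  \<comment> \<open>The weights are K / m_k, the coefficients in this frame of the elliptic operator
    K h^{ij} that linearizes the flow.\<close>
  have "m 2 * m 3 * (P * ddw 1 1 + Q * ddw 1 2 + R * ddw 1 3 + H 1)
      + m 1 * m 3 * (P * ddw 2 1 + Q * ddw 2 2 + R * ddw 2 3 + H 2)
      + m 1 * m 2 * (P * ddw 3 1 + Q * ddw 3 2 + R * ddw 3 3 + H 3) \<le> 0"
    using pos[of 1] pos[of 2] pos[of 3]
    by (intro add_nonpos_nonpos mult_nonneg_nonpos space) auto
  moreover
  have w: "ddw 2 1 = ddw 1 2 + m 2 * (m 1)\<^sup>2 - m 1 * (m 2)\<^sup>2"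
    "ddw 3 1 = ddw 1 3 + m 3 * (m 1)\<^sup>2 - m 1 * (m 3)\<^sup>2"
    "ddw 3 2 = ddw 2 3 + m 3 * (m 2)\<^sup>2 - m 2 * (m 3)\<^sup>2"
    using ddw_exchange[of 2 1] ddw_exchange[of 3 1] ddw_exchange[of 3 2] by simp_all
  \<comment> \<open>After the exchange of \<open>ddw\<close> the reaction terms are K times the sum
    of P_i (m_i E_1 - 2 m_i^2), where P_i are the partial derivatives of psi. By homogeneity the sum
    of P_i m_i is 4 psi, and the sum of P_i m_i^2 is 2 E_1 psi, so they cancel.\<close>
  have "DT f z0
      - (m 2 * m 3 * (P * ddw 1 1 + Q * ddw 1 2 + R * ddw 1 3 + H 1)
        + m 1 * m 3 * (P * ddw 2 1 + Q * ddw 2 2 + R * ddw 2 3 + H 2)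
        + m 1 * m 2 * (P * ddw 3 1 + Q * ddw 3 2 + R * ddw 3 3 + H 3))
    = P * F 1 + Q * F 2 + R * F 3 - (m 2 * m 3 * H 1 + m 1 * m 3 * H 2 + m 1 * m 2 * H 3)"
    unfolding time w P_def Q_def R_def psi_deriv_def by algebra
  ultimately show ?thesis unfolding f_def[abs_def] by linarith
qed

lemma qform_g: "qform (gm z) v = upper_qform (gm z) (v $ 1) (v $ 2) (v $ 3)"
  by (rule qform_upper) (simp add: g_def inner_commute)

lemma pinching_defect_decreasing:
  assumes pos: "m 2 > 0" "m 3 > 0" and boundary: "m 1 = 2 * m 3"
    and pinched: "m 1 \<le> 2 * m 2" "m 2 \<le> 2 * m 3"
    and max: "\<And>x v w. x \<in> U \<Longrightarrow>
      defect v w (x, snd z0) \<le> 0"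
  shows "DT (defect (axis 1 1) (axis 3 1)) z0 < 0"
proof -
  define F where "F k = det_hess (m 1) (m 2) (m 3) (dh 1 1 k) (dh 2 2 k) (dh 3 3 k) (dh 1 2 k) (dh 1 3 k) (dh 2 3 k)" for k
  define L where "L k = (6 * m 2 - 2 * m 1) / (m 2)\<^sup>2 * (dh 1 2 k)\<^sup>2 + 6 / m 3 * (dh 1 3 k)\<^sup>2
      + (4 * m 2 + 4 * m 3) / (m 2)\<^sup>2 * (dh 2 3 k)\<^sup>2" for k
  have space: "dh 1 1 k = 2 * dh 3 3 k \<and> ddw k 1 - 2 * ddw k 3 + L k \<le> 0" for k
  proof -
    let ?d = "space_dir k"
    \<comment> \<open>This coordinate is affine with slope 1 along the line, so multiples of it have
      no second derivative and the test vectors below move linearly.\<close>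
    define s where "s z = fst z $ k - fst z0 $ k" for z :: "(real^3) \<times> real"
    \<comment> \<open>With v = (1, p s, q s) and w = (p' s, q' s, 1) the second derivative of the
      defect is a quadratic polynomial in the four slopes. The values \<open>q\<close> and
      \<open>p'\<close> maximize it. For \<open>p\<close> and \<open>q'\<close> the maximizers have
      the denominators \<open>m 1 - m 2\<close> and \<open>m 2 - m 3\<close>, which may vanish;
      \<open>m 2\<close> in their place stays positive and still gains enough, giving the
      coefficients of \<open>L\<close>.\<close>
    define p q where "p = dh 1 2 k / m 2" and "q = dh 1 3 k / m 3"
    define p' q' where "p' = - dh 1 3 k / m 3" and "q' = - dh 2 3 k / m 2"
    have bl: "bounded_linear (\<lambda>z :: (real^3) \<times> real. fst z $ k)"
      by (rule bounded_linear_compose[OF bounded_linear_vec_nth bounded_linear_fst])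
    have sm: "smooth_on S (\<lambda>z. fst z $ k)" by (rule smooth_on_linear[OF bl])
    have js: "jet2 S ?d z0 s 0 1 0"
    proof -
      have ds: "dd S ?d s z = 1" if "z \<in> S" for z
        unfolding s_def[abs_def]
        using that appr_S sm dd_linear[OF bl appr_S that, of ?d]
        by (simp add: dd_diff space_dir_def)
      have "dd S ?d (dd S ?d s) z0 = dd S ?d (\<lambda>_. 1) z0"
        by (rule dd_cong[OF z0 ds])
      moreover have "smooth_on S s" unfolding s_def[abs_def] by (intro smooth_on_diff sm smooth_on_const)
      ultimately show ?thesis
        using ds[OF z0] appr_S z0 by (simp add: jet2_def s_def)
    qed
    have jc: "jet2 S ?d z0 (\<lambda>z. c * s z) 0 c 0" for c
      using jet2_mult[OF appr_S z0 jet2_const[OF appr_S z0] js] by simp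
    have j1: "jet2 S ?d z0 (\<lambda>z. 1) 1 0 0" by (rule jet2_const[OF appr_S z0])
    define v where "v z = (vector [1, p * s z, q * s z] :: real^3)" for z
    define w where "w z = (vector [p' * s z, q' * s z, 1] :: real^3)" for z
    have comp: "v z $ 1 = 1" "v z $ 2 = p * s z" "v z $ 3 = q * s z"
      "w z $ 1 = p' * s z" "w z $ 2 = q' * s z" "w z $ 3 = 1" for z
      by (simp_all add: v_def w_def)
    define f where "f z = pinching_defect (gm z) (hm z) (v z) (w z)" for z
    have qh: "z \<in> S \<Longrightarrow> qform (hm z) u = upper_qform (hm z) (u $ 1) (u $ 2) (u $ 3)" for z u
      by (rule qform_upper) (rule h_commute)
    define hv where "hv z = upper_qform (hm z) (v z $ 1) (v z $ 2) (v z $ 3)" for z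
    define hw where "hw z = upper_qform (hm z) (w z $ 1) (w z $ 2) (w z $ 3)" for z
    define gv where "gv z = upper_qform (gm z) (v z $ 1) (v z $ 2) (v z $ 3)" for z
    define gw where "gw z = upper_qform (gm z) (w z $ 1) (w z $ 2) (w z $ 3)" for z
    define F' where "F' z = hv z * gw z - 2 * (hw z * gv z)" for z
    have fF: "f z = F' z" if "z \<in> S" for z
      using that by (simp add: f_def F'_def pinching_defect_def qh qform_g hv_def hw_def gv_def gw_def)
    have jhv: "jet2 S ?d z0 hv (m 1) (dh 1 1 k) (ddh k 1 1 + 4 * (dh 1 2 k * p + dh 1 3 k * q) + 2 * (m 2 * p\<^sup>2 + m 3 * q\<^sup>2))"
      unfolding hv_def[abs_def] comp
      by (rule jet2_qform_1[OF appr_S z0 jet2_h j1 jc jc])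
    have jhw: "jet2 S ?d z0 hw (m 3) (dh 3 3 k) (ddh k 3 3 + 4 * (dh 1 3 k * p' + dh 2 3 k * q') + 2 * (m 1 * p'\<^sup>2 + m 2 * q'\<^sup>2))"
      unfolding hw_def[abs_def] comp
      by (rule jet2_qform_3[OF appr_S z0 jet2_h jc jc j1])
    have jgv: "jet2 S ?d z0 gv 1 0 (ddg k 1 1 + 2 * (p\<^sup>2 + q\<^sup>2))"
      unfolding gv_def[abs_def] comp
      using jet2_qform_1[OF appr_S z0 jet2_g j1 jc jc] by simp
    have jgw: "jet2 S ?d z0 gw 1 0 (ddg k 3 3 + 2 * (p'\<^sup>2 + q'\<^sup>2))"
      unfolding gw_def[abs_def] comp
      using jet2_qform_3[OF appr_S z0 jet2_g jc jc j1] by simp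
    note jF = jet2_diff[OF appr_S z0 jet2_mult[OF appr_S z0 jhv jgw]
        jet2_mult[OF appr_S z0 jet2_const[OF appr_S z0, of _ 2]
          jet2_mult[OF appr_S z0 jhw jgv]], folded F'_def]
    obtain r where r: "r > 0" "\<And>s. \<bar>s\<bar> < r \<Longrightarrow> fst (z0 + s *\<^sub>R ?d) \<in> U \<and>
        z0 + s *\<^sub>R ?d \<in> S \<and> snd (z0 + s *\<^sub>R ?d) = snd z0"
      using space_line[OF z0, of k] by blast
    have F0: "F' z0 = 0" using jF boundary by (simp add: jet2_def)
    have le: "F' (z0 + s *\<^sub>R ?d) \<le> F' z0" if "\<bar>s\<bar> < r" for s
    proof -
      have "z0 + s *\<^sub>R ?d = (fst (z0 + s *\<^sub>R ?d), snd z0)"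
        using r(2)[OF that] by (metis prod.collapse)
      then show ?thesis
        using max[of "fst (z0 + s *\<^sub>R ?d)" "v (z0 + s *\<^sub>R ?d)" "w (z0 + s *\<^sub>R ?d)"] r(2)[OF that] F0
          fF[of "z0 + s *\<^sub>R ?d"] by (simp add: f_def)
    qed
    have smF: "smooth_on S F'" using jF by (simp add: jet2_def F'_def[abs_def])
    have "dd S ?d F' z0 = 0" "dd S ?d (dd S ?d F') z0 \<le> 0"
      using second_derivative_test_line[OF appr_S smF r(1), of z0 ?d] r(2) le by auto
    then have "dh 1 1 k = 2 * dh 3 3 k" and
      le2: "ddw k 1 - 2 * ddw k 3 + 4 * (dh 1 2 k * p + dh 1 3 k * q) + 2 * (m 2 * p\<^sup>2 + m 3 * q\<^sup>2)
        + 2 * m 1 * (p'\<^sup>2 + q'\<^sup>2) - 8 * (dh 1 3 k * p' + dh 2 3 k * q')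
        - 4 * (m 1 * p'\<^sup>2 + m 2 * q'\<^sup>2) - 4 * m 3 * (p\<^sup>2 + q\<^sup>2) \<le> 0"
      using jF boundary by (simp_all add: jet2_def ddw_def F'_def[abs_def] algebra_simps)
    moreover have "4 * (dh 1 2 k * p + dh 1 3 k * q) + 2 * (m 2 * p\<^sup>2 + m 3 * q\<^sup>2)
        + 2 * m 1 * (p'\<^sup>2 + q'\<^sup>2) - 8 * (dh 1 3 k * p' + dh 2 3 k * q')
        - 4 * (m 1 * p'\<^sup>2 + m 2 * q'\<^sup>2) - 4 * m 3 * (p\<^sup>2 + q\<^sup>2) = L k"
      unfolding L_def p_def q_def p'_def q'_def boundary using pos
      by (simp add: field_simps power2_eq_square)
    ultimately show ?thesis by linarith
  qed
  have "jet1 S time_dir z0 (\<lambda>z. h 1 1 z * g 3 3 z - 2 * (h 3 3 z * g 1 1 z)) (m 1 - 2 * m 3)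
      (m 1 * DT (g 3 3) z0 + DT (h 1 1) z0
       - 2 * (m 3 * DT (g 1 1) z0 + DT (h 3 3) z0))"
    apply (rule jet1_eq)
      apply (rule jet1_intros[OF appr_S z0] jet1_time_g jet1_time_h)+
     apply (simp_all add: diag3_def)
    done
  moreover have "defect (axis 1 1) (axis 3 1) z
      = h 1 1 z * g 3 3 z - 2 * (h 3 3 z * g 1 1 z)" for z
    by (simp add: pinching_defect_def qform_def sum_3 axis_def)
  ultimately have time: "DT (defect (axis 1 1) (axis 3 1)) z0
      = (DT (h 1 1) z0 - m 1 * DT (g 1 1) z0)
        - 2 * (DT (h 3 3) z0 - m 3 * DT (g 3 3) z0)"
    using boundary by (simp add: jet1_def)
  have "F 1 - 2 * F 3 \<le> m 2 * m 3 * L 1 + m 1 * m 3 * L 2 + m 1 * m 2 * L 3"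
    unfolding F_def L_def
    using pinching_gradient_terms[OF pos boundary pinched, of "dh 1 1 1" "dh 1 3 3" "dh 1 1 2" "dh 2 3 3"
        "dh 1 1 3" "dh 3 3 3" "dh 1 2 2" "dh 1 2 3" "dh 2 2 3"] space[of 1] space[of 2] space[of 3]
    using dh_commute(1)[of 1 2] dh_commute(1)[of 1 3] dh_commute(1)[of 2 3]
      dh_commute(2)[of _ 2 1] dh_commute(2)[of _ 3 1] dh_commute(2)[of _ 3 2]
    by simp
  moreover have "m 2 * m 3 * (ddw 1 1 - 2 * ddw 1 3 + L 1) + m 1 * m 3 * (ddw 2 1 - 2 * ddw 2 3 + L 2)
      + m 1 * m 2 * (ddw 3 1 - 2 * ddw 3 3 + L 3) \<le> 0"
    using add_nonpos_nonpos[OF add_nonpos_nonpos[OF mult_nonneg_nonpos mult_nonneg_nonpos] mult_nonneg_nonpos,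
        OF _ conjunct2[OF space] _ conjunct2[OF space] _ conjunct2[OF space]] pos boundary by simp
  moreover have w: "ddw 2 1 = ddw 1 2 + m 2 * (m 1)\<^sup>2 - m 1 * (m 2)\<^sup>2"
    "ddw 3 1 = ddw 1 3 + m 3 * (m 1)\<^sup>2 - m 1 * (m 3)\<^sup>2"
    "ddw 3 2 = ddw 2 3 + m 3 * (m 2)\<^sup>2 - m 2 * (m 3)\<^sup>2"
    using ddw_exchange[of 2 1] ddw_exchange[of 3 1] ddw_exchange[of 3 2] by simp_all
  \<comment> \<open>The exchange leaves K (m_i E_1 - 2 m_i^2) as reaction term of the i-th
    eigenvalue. For i = 1 minus twice i = 3, with \<open>m 1 = 2 * m 3\<close>, the terms with E_1
    cancel and -4 K m_3^2 remains, which is the last summand.\<close>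
  have "DT (defect (axis 1 1) (axis 3 1)) z0
    = (m 2 * m 3 * (ddw 1 1 - 2 * ddw 1 3 + L 1) + m 1 * m 3 * (ddw 2 1 - 2 * ddw 2 3 + L 2)
      + m 1 * m 2 * (ddw 3 1 - 2 * ddw 3 3 + L 3))
      + (F 1 - 2 * F 3 - (m 2 * m 3 * L 1 + m 1 * m 3 * L 2 + m 1 * m 2 * L 3))
      - 8 * m 2 * m 3 ^ 4"
    unfolding time dt_w ddK K_z0 F_def[symmetric] w unfolding boundary by algebra
  moreover have "8 * m 2 * m 3 ^ 4 > 0" using pos by simp
  ultimately show ?thesis by linarith
qed

end

subsection \<open>Normalization of the parametrization\<close>

definition bform :: "(3 \<Rightarrow> 3 \<Rightarrow> real) \<Rightarrow> real^3 \<Rightarrow> real^3 \<Rightarrow> real" where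
  "bform m u v = (\<Sum>k\<in>UNIV. \<Sum>l\<in>UNIV. m k l * (u $ k * v $ l))"

lemma bform_sum_left: "bform m (\<Sum>i\<in>A. f i) v = (\<Sum>i\<in>A. bform m (f i) v)"
  unfolding bform_def by (induction A rule: infinite_finite_induct) (auto simp: algebra_simps sum.distrib)

lemma bform_scale_left: "bform m (c *\<^sub>R u) v = c * bform m u v"
  unfolding bform_def by (simp add: sum_distrib_left mult.left_commute mult.assoc)

lemma bform_minus_left: "bform m (- u) v = - bform m u v"
  using bform_scale_left[of m "-1" u v] by simp

lemma bform_add: "bform (\<lambda>i j. m i j + s * m' i j) u v = bform m u v + s * bform m' u v"
  unfolding bform_def by (simp add: sum.distrib sum_distrib_left algebra_simps)

lemma bform_commute: "(\<And>i j. m i j = m j i) \<Longrightarrow> bform m u v = bform m v u"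
  unfolding bform_def by (subst sum.swap) (simp add: mult.commute)

lemma qform_bform:
  "qform (\<lambda>i j. bform m (e i) (e j)) v = qform m (\<Sum>i\<in>UNIV. v $ i *\<^sub>R e i)"
  unfolding qform_def bform_def by (simp add: sum_3 algebra_simps)

lemma det3_det: "(\<And>i j. m i j = m j i) \<Longrightarrow> det3 m = det (\<chi> i j. m i j)"
  unfolding det3_def det_3 by (simp add: power2_eq_square algebra_simps)

lemma det3_bform:
  assumes "\<And>i j. m i j = m j i"
  shows "det3 (\<lambda>i j. bform m (e i) (e j)) = (det (\<chi> i. e i))\<^sup>2 * det3 m"
proof -
  have "(\<chi> i j. bform m (e i) (e j)) = (\<chi> i. e i) ** (\<chi> i j. m i j) ** transpose (\<chi> i. e i)"
    by (simp add: vec_eq_iff matrix_matrix_mult_def transpose_def bform_def sum_3 algebra_simps)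
  moreover have "det3 (\<lambda>i j. bform m (e i) (e j)) = det (\<chi> i j. bform m (e i) (e j))"
    by (rule det3_det) (rule bform_commute[OF assms])
  ultimately show ?thesis
    by (simp add: det_mul det_transpose det3_det[OF assms] power2_eq_square)
qed

lemma det3_pencil:
  "det3 (\<lambda>i j. g i j + s * h i j)
    = det3 g + s * mixed_det g h + s\<^sup>2 * mixed_det h g + s ^ 3 * det3 h"
  unfolding det3_def mixed_det_def by algebra

text \<open>Coefficient comparison in the pencil \<open>det3 (g + s h)\<close>. The outer
  coefficients transform by \<open>det3_bform\<close>, so the two values \<open>s = 1\<close> and
  \<open>s = -1\<close> determine the linear one.\<close>

lemma mixed_det_bform:
  assumes g: "\<And>i j. g i j = g j i" and h: "\<And>i j. h i j = h j i"
  shows "mixed_det (\<lambda>i j. bform g (e i) (e j)) (\<lambda>i j. bform h (e i) (e j))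
    = (det (\<chi> i. e i))\<^sup>2 * mixed_det g h"
proof -
  let ?d = "(det (\<chi> i. e i))\<^sup>2"
  let ?g = "\<lambda>i j. bform g (e i) (e j)" and ?h = "\<lambda>i j. bform h (e i) (e j)"
  have eq: "det3 (\<lambda>i j. ?g i j + s * ?h i j) = ?d * det3 (\<lambda>i j. g i j + s * h i j)" for s
    unfolding bform_add[symmetric] by (rule det3_bform) (simp add: g[of _ _] h[of _ _])
  from eq[of 1] eq[of "-1"] show ?thesis
    unfolding det3_pencil det3_bform[OF g] det3_bform[OF h] by (simp add: algebra_simps)
qed

lemma psi_numerator_bform:
  assumes g: "\<And>i j. g i j = g j i" and h: "\<And>i j. h i j = h j i"
  shows "psi_numerator (\<lambda>i j. bform g (e i) (e j)) (\<lambda>i j. bform h (e i) (e j))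
    = (det (\<chi> i. e i)) ^ 4 * psi_numerator g h"
  unfolding psi_numerator_def mixed_det_bform[OF g h] mixed_det_bform[OF h g] det3_bform[OF h]
  by algebra

lemma pinching_defect_bform:
  "pinching_defect (\<lambda>i j. bform g (e i) (e j)) (\<lambda>i j. bform h (e i) (e j)) v w
    = pinching_defect g h (\<Sum>i\<in>UNIV. v $ i *\<^sub>R e i) (\<Sum>i\<in>UNIV. w $ i *\<^sub>R e i)"
  unfolding pinching_defect_def qform_bform ..

lemma dd_time_slice:
  assumes U: "open U" and f: "smooth_on (U \<times> time_interval T) f" and "x \<in> U" "t \<in> time_interval T"
  shows "dd (U \<times> time_interval T) (0, 1) f (x, t) = dd (time_interval T) 1 (\<lambda>t. f (x, t)) t"
proof -
  let ?I = "time_interval T"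
  have sm: "smooth_on ?I (\<lambda>t. (x, t))"
  proof -
    have "smooth_on ?I (\<lambda>t. (x, 0) + (0, t))"
      by (intro smooth_on_add smooth_on_const smooth_on_linear bounded_linear_Pair bounded_linear_zero bounded_linear_ident)
    then show ?thesis by simp
  qed
  have "dd ?I 1 (\<lambda>t. (x, t)) t = (0, 1)"
    by (rule dd_eq[OF approachable_time_interval assms(4)]) (auto intro!: derivative_eq_intros)
  then show ?thesis
    using dd_compose[OF approachable_time_interval _ sm f assms(4), of 1] assms(3)
    by (metis (no_types, lifting) SigmaI image_subsetI)
qed

context flow_chart
begin

lemma mem_S: "z \<in> S \<longleftrightarrow> fst z \<in> U \<and> snd z \<in> I"
  unfolding S_eq by (simp add: mem_Times_iff)

lemma Pair_space_expand: "(u :: real^3, 0 :: real) = (\<Sum>k\<in>UNIV. u $ k *\<^sub>R space_dir k)"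
proof -
  have "u = (\<Sum>k\<in>UNIV. u $ k *\<^sub>R axis k 1)" by (simp add: vec_eq_iff axis_def sum_3 forall_3)
  then show ?thesis by (simp add: prod_eq_iff fst_sum snd_sum space_dir_def)
qed

lemma inner_Y1_combination:
  "(\<Sum>k\<in>UNIV. u $ k *\<^sub>R Y1 k z) \<bullet> (\<Sum>l\<in>UNIV. v $ l *\<^sub>R Y1 l z) = bform (gm z) u v"
  unfolding bform_def g_def sum_3 by (simp add: inner_add_left inner_add_right algebra_simps)

lemma dd_space_expand:
  assumes f: "smooth_on S f" and z: "z \<in> S"
  shows "dd S (u, 0) f z = (\<Sum>k\<in>UNIV. u $ k *\<^sub>R DX k f z)"
  unfolding Pair_space_expand sum_3 by (simp add: dd_linear_direction[OF f z])

end

text \<open>A frame at one point is completed to a parametrization quadratic in the coordinates whose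
  quadratic part removes the tangential component of the second derivatives at that point.\<close>

locale frame_chart = flow_chart +
  fixes z0 :: "(real^3) \<times> real" and e :: "3 \<Rightarrow> real^3" and m :: "3 \<Rightarrow> real"
  assumes z0: "z0 \<in> S"
    and g_frame: "bform (gm z0) (e i) (e j) = id3 i j"
    and h_frame: "bform (hm z0) (e i) (e j) = diag3 m i j"
begin

text \<open>Because the frame is orthonormal, lowered and raised Christoffel symbols coincide; hence
  the same numbers serve as coefficients of \<open>e k\<close> in \<open>quad\<close>.\<close>

definition "christoffel i j k =
  (\<Sum>a\<in>UNIV. \<Sum>b\<in>UNIV. (e i $ a * e j $ b) *\<^sub>R Y2 a b z0) \<bullet> (\<Sum>c\<in>UNIV. e k $ c *\<^sub>R Y1 c z0)"
definition "quad i j = - (\<Sum>k\<in>UNIV. christoffel i j k *\<^sub>R e k)"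
definition Q :: "(real^3) \<times> real \<Rightarrow> (real^3) \<times> real" where
  "Q z = (fst z0, 0) + (\<Sum>i\<in>UNIV. (fst z $ i) *\<^sub>R (e i, 0))
    + (1 / 2) *\<^sub>R (\<Sum>i\<in>UNIV. \<Sum>j\<in>UNIV. (fst z $ i * fst z $ j) *\<^sub>R (quad i j, 0)) + (0, snd z)"
definition "V = {y. fst (Q (y, 0)) \<in> U}"
definition "S' = V \<times> I"
definition J :: "3 \<Rightarrow> (real^3) \<times> real \<Rightarrow> real^3" where
  "J i z = e i + (\<Sum>j\<in>UNIV. (fst z $ j) *\<^sub>R quad i j)"

lemma quad_commute: "quad i j = quad j i"
proof -
  have "christoffel i j k = christoffel j i k" for k
  proof -
    have "(\<Sum>a\<in>UNIV. \<Sum>b\<in>UNIV. (e i $ a * e j $ b) *\<^sub>R Y2 a b z0)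
        = (\<Sum>a\<in>UNIV. \<Sum>b\<in>UNIV. (e j $ a * e i $ b) *\<^sub>R Y2 a b z0)"
      by (subst sum.swap) (simp add: Y2_commute[OF z0] mult.commute)
    then show ?thesis by (simp add: christoffel_def)
  qed
  then show ?thesis by (simp add: quad_def)
qed

lemma fst_Q: "fst (Q z) = fst (Q (fst z, 0))"
  and snd_Q: "snd (Q z) = snd z"
  unfolding Q_def by (simp_all add: sum_3)

lemma bounded_linear_coord: "bounded_linear (\<lambda>z :: (real^3) \<times> real. fst z $ k)"
  by (rule bounded_linear_compose[OF bounded_linear_vec_nth bounded_linear_fst])

lemma bounded_linear_time: "bounded_linear (\<lambda>z :: (real^3) \<times> real. (0 :: real^3, snd z))"
  by (intro bounded_linear_Pair bounded_linear_zero bounded_linear_snd)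

lemma smooth_coord: "smooth_on A (\<lambda>z :: (real^3) \<times> real. fst z $ k)"
  by (rule smooth_on_linear[OF bounded_linear_coord])

lemma smooth_time: "smooth_on A (\<lambda>z :: (real^3) \<times> real. (0 :: real^3, snd z))"
  by (rule smooth_on_linear[OF bounded_linear_time])

lemma smooth_Q: "smooth_on A Q"
  unfolding Q_def[abs_def]
  by (intro smooth_on_add smooth_on_const smooth_on_sum smooth_on_scaleR smooth_on_mult smooth_coord
      smooth_time finite)

lemma open_V: "open V"
proof -
  have "continuous_on UNIV (\<lambda>y. Q (y, 0))"
    by (rule continuous_on_compose2[OF smooth_on_continuous[OF smooth_Q, of UNIV]])
      (auto intro: continuous_on_Pair continuous_on_id continuous_on_const)
  then have "continuous_on UNIV (\<lambda>y. fst (Q (y, 0)))" by (rule continuous_on_fst)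
  then have "open ((\<lambda>y. fst (Q (y, 0))) -` U)" using open_U by (rule open_vimage[rotated])
  then show ?thesis by (simp add: V_def vimage_def)
qed

lemma appr_S': "approachable S'"
  unfolding S'_def by (rule cylinder_approachable[OF open_V])

lemma Q_in_S: "z \<in> S' \<Longrightarrow> Q z \<in> S"
  using fst_Q[of z] snd_Q[of z] by (simp add: S'_def mem_S V_def mem_Times_iff)

lemma Q_0: "Q (0, t) = (fst z0, t)"
  unfolding Q_def by (simp add: sum_3)

lemma base_in: "0 \<in> V" "(0, snd z0) \<in> S'"
  using z0 Q_0[of 0] by (auto simp: V_def S'_def mem_S mem_Times_iff)

lemma dd_Q:
  assumes z: "z \<in> S'"
  shows "dd S' (space_dir k) Q z = (J k z, 0)" and "dd S' time_dir Q z = time_dir"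
proof -
  have dc: "dd S' v (\<lambda>z. fst z $ i) z = fst v $ i" for v i
    by (rule dd_linear[OF bounded_linear_coord appr_S' z])
  have dt: "dd S' v (\<lambda>z. (0 :: real^3, snd z)) z = (0, snd v)" for v
    by (rule dd_linear[OF bounded_linear_time appr_S' z])
  note sm = smooth_on_add smooth_on_const smooth_on_sum smooth_on_scaleR smooth_on_mult smooth_coord
      smooth_time finite
  have scale: "dd S' v (\<lambda>z. f z *\<^sub>R c) z = dd S' v f z *\<^sub>R c"
    if "smooth_on S' f" for f :: "(real^3) \<times> real \<Rightarrow> real" and c :: "(real^3) \<times> real" and v
    using dd_scaleR[OF appr_S' z that smooth_on_const, of v c] appr_S' z by simp
  have all: "dd S' v Q z = (\<Sum>i\<in>UNIV. (fst v $ i) *\<^sub>R (e i, 0))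
    + (1 / 2) *\<^sub>R (\<Sum>i\<in>UNIV. \<Sum>j\<in>UNIV. (fst z $ i * fst v $ j + fst v $ i * fst z $ j) *\<^sub>R (quad i j, 0))
    + (0, snd v)" for v
  proof -
    have 1: "dd S' v (\<lambda>z. \<Sum>i\<in>UNIV. (fst z $ i) *\<^sub>R (e i, 0 :: real)) z = (\<Sum>i\<in>UNIV. (fst v $ i) *\<^sub>R (e i, 0))"
      by (subst dd_sum[OF finite appr_S' z]) (intro sm, simp only: scale[OF smooth_coord] dc)
    have 2: "dd S' v (\<lambda>z. \<Sum>i\<in>UNIV. \<Sum>j\<in>UNIV. (fst z $ i * fst z $ j) *\<^sub>R (quad i j, 0 :: real)) z
        = (\<Sum>i\<in>UNIV. \<Sum>j\<in>UNIV. (fst z $ i * fst v $ j + fst v $ i * fst z $ j) *\<^sub>R (quad i j, 0))"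
      by (subst dd_sum[OF finite appr_S' z], intro sm, rule sum.cong[OF refl],
        subst dd_sum[OF finite appr_S' z], intro sm, rule sum.cong[OF refl],
        subst scale, intro sm, subst dd_mult[OF appr_S' z smooth_coord smooth_coord], simp only: dc)
    have 3: "dd S' v (\<lambda>z. (1 / 2 :: real) *\<^sub>R (\<Sum>i\<in>UNIV. \<Sum>j\<in>UNIV. (fst z $ i * fst z $ j) *\<^sub>R (quad i j, 0 :: real))) z
        = (1 / 2) *\<^sub>R (\<Sum>i\<in>UNIV. \<Sum>j\<in>UNIV. (fst z $ i * fst v $ j + fst v $ i * fst z $ j) *\<^sub>R (quad i j, 0))"
      unfolding 2[symmetric] by (intro dd_bounded_linear bounded_linear_scaleR_right appr_S' z sm)
    show ?thesis
      unfolding Q_def[abs_def]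
      apply (subst dd_add[OF appr_S' z], (intro sm)+)
      apply (subst dd_add[OF appr_S' z], (intro sm)+)
      apply (subst dd_add[OF appr_S' z], (intro sm)+)
      using appr_S' z by (simp only: 1 3 dt dd_const add_0)
  qed
  have "fst (space_dir k) $ i = (if i = k then 1 else 0)" for i
    by (auto simp: space_dir_def axis_def)
  then show "dd S' (space_dir k) Q z = (J k z, 0)"
    unfolding all J_def using exhaust_3[of k]
    by (auto simp: sum_3 prod_eq_iff space_dir_def vec_eq_iff axis_def quad_commute[of 2 1]
        quad_commute[of 3 1] quad_commute[of 3 2] field_simps)
  show "dd S' time_dir Q z = time_dir"
    unfolding all by (simp add: time_dir_def sum_3 prod_eq_iff)
qed

lemma dd_compose_Q:
  assumes f: "smooth_on S f" and z: "z \<in> S'"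
  shows "dd S' (space_dir i) (\<lambda>z. f (Q z)) z = (\<Sum>k\<in>UNIV. J i z $ k *\<^sub>R DX k f (Q z))"
    and "dd S' time_dir (\<lambda>z. f (Q z)) z = DT f (Q z)"
proof -
  have "Q ` S' \<subseteq> S" using Q_in_S by blast
  note * = dd_compose[OF appr_S' this smooth_Q f z]
  show "dd S' (space_dir i) (\<lambda>z. f (Q z)) z = (\<Sum>k\<in>UNIV. J i z $ k *\<^sub>R DX k f (Q z))"
    unfolding * dd_Q(1)[OF z] by (rule dd_space_expand[OF f Q_in_S[OF z]])
  show "dd S' time_dir (\<lambda>z. f (Q z)) z = DT f (Q z)"
    unfolding * dd_Q(2)[OF z] ..
qed

lemma smooth_compose_Q: "smooth_on S f \<Longrightarrow> smooth_on S' (\<lambda>z. f (Q z))"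
  using smooth_on_compose[OF _ smooth_Q] Q_in_S by blast

lemma smooth_J: "smooth_on A (\<lambda>z. J i z $ k)"
  unfolding J_def by (simp add: sum_3) (intro smooth_on_add smooth_on_const smooth_on_mult smooth_coord)

lemma dd_J: "z \<in> S' \<Longrightarrow> dd S' (space_dir j) (\<lambda>z. J i z $ k) z = quad i j $ k"
proof -
  assume z: "z \<in> S'"
  have dc: "dd S' v (\<lambda>z. fst z $ i) z = fst v $ i" for v i
    by (rule dd_linear[OF bounded_linear_coord appr_S' z])
  have eq: "J i z $ k = e i $ k + (\<Sum>l\<in>UNIV. fst z $ l * quad i l $ k)" for z
    by (simp add: J_def)
  have "dd S' (space_dir j) (\<lambda>z. J i z $ k) z = (\<Sum>l\<in>UNIV. fst (space_dir j) $ l * quad i l $ k)"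
    unfolding eq sum_3
    using appr_S' z
    by (simp add: dd_add dd_mult smooth_coord smooth_on_mult smooth_on_add dc)
  also have "\<dots> = quad i j $ k"
    using exhaust_3[of j] by (auto simp: sum_3 space_dir_def axis_def)
  finally show ?thesis .
qed

lemma Y1_compose:
  "z \<in> S' \<Longrightarrow> dd S' (space_dir i) (\<lambda>z. Y (Q z)) z = (\<Sum>k\<in>UNIV. J i z $ k *\<^sub>R Y1 k (Q z))"
  unfolding Y1_def by (rule dd_compose_Q(1)[OF smooth_Y])

lemma Y2_compose:
  assumes z: "z \<in> S'"
  shows "dd S' (space_dir j) (dd S' (space_dir i) (\<lambda>z. Y (Q z))) z
    = (\<Sum>k\<in>UNIV. \<Sum>l\<in>UNIV. (J i z $ k * J j z $ l) *\<^sub>R Y2 k l (Q z)) + (\<Sum>k\<in>UNIV. quad i j $ k *\<^sub>R Y1 k (Q z))"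
proof -
  note sm = smooth_on_scaleR smooth_J smooth_compose_Q[OF smooth_Y1]
  have "dd S' (space_dir j) (dd S' (space_dir i) (\<lambda>z. Y (Q z))) z
      = dd S' (space_dir j) (\<lambda>z. \<Sum>k\<in>UNIV. J i z $ k *\<^sub>R Y1 k (Q z)) z"
    by (rule dd_cong[OF z Y1_compose])
  also have "\<dots> = (\<Sum>k\<in>UNIV. dd S' (space_dir j) (\<lambda>z. J i z $ k *\<^sub>R Y1 k (Q z)) z)"
    by (intro dd_sum finite appr_S' z sm)
  also have "\<dots> = (\<Sum>k\<in>UNIV. J i z $ k *\<^sub>R (\<Sum>l\<in>UNIV. J j z $ l *\<^sub>R Y2 k l (Q z)) + quad i j $ k *\<^sub>R Y1 k (Q z))"
    unfolding dd_scaleR[OF appr_S' z smooth_J smooth_compose_Q[OF smooth_Y1]] dd_J[OF z]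
      dd_compose_Q(1)[OF smooth_Y1 z] Y2_def ..
  finally show ?thesis by (simp add: sum.distrib scaleR_sum_right)
qed

lemma g_compose:
  "z \<in> S' \<Longrightarrow> dd S' (space_dir i) (\<lambda>z. Y (Q z)) z \<bullet> dd S' (space_dir j) (\<lambda>z. Y (Q z)) z
    = bform (gm (Q z)) (J i z) (J j z)"
  unfolding Y1_compose by (rule inner_Y1_combination)

lemma h_compose:
  assumes z: "z \<in> S'"
  shows "- (dd S' (space_dir j) (dd S' (space_dir i) (\<lambda>z. Y (Q z))) z \<bullet> N (Q z))
    = bform (hm (Q z)) (J i z) (J j z)"
  using Y1_N[OF Q_in_S[OF z]]
  by (simp add: Y2_compose[OF z] bform_def h_def inner_sum_left inner_add_left sum_negf mult_ac)

text \<open>Metric and second fundamental form pull back to \<open>bform\<close> in the vectors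
  \<open>J i z\<close>. Both determinants acquire the same square factor, so the equation for
  \<open>K\<close> survives even where these vectors are dependent. At the base point
  \<open>J i\<close> is \<open>e i\<close>, and the contribution of \<open>quad\<close> cancels the
  tangential part of the second derivatives.\<close>

lemma normal_chart_Q:
  "normal_chart V T S' (\<lambda>z. Y (Q z)) (\<lambda>z. K (Q z)) (\<lambda>z. N (Q z)) (0, snd z0) m"
proof -
  interpret C: flow_chart V T S' "\<lambda>z. Y (Q z)" "\<lambda>z. K (Q z)" "\<lambda>z. N (Q z)"
  proof
    show "smooth_on S' (\<lambda>z. Y (Q z))" "smooth_on S' (\<lambda>z. K (Q z))" "smooth_on S' (\<lambda>z. N (Q z))"
      by (intro smooth_compose_Q smooth_Y smooth_K smooth_N)+
    fix z assume z: "z \<in> S'"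
    note Qz = Q_in_S[OF z]
    show "dd S' time_dir (\<lambda>z. Y (Q z)) z = - (K (Q z) *\<^sub>R N (Q z))"
      unfolding dd_compose_Q(2)[OF smooth_Y z] by (rule evolution[OF Qz])
    show "N (Q z) \<bullet> N (Q z) = 1" by (rule unit_N[OF Qz])
    show "dd S' (space_dir i) (\<lambda>z. Y (Q z)) z \<bullet> N (Q z) = 0" for i
      using Y1_N[OF Qz] by (simp add: Y1_compose[OF z] inner_sum_left)
    have "K (Q z) * det3 (gm (Q z)) = det3 (hm (Q z))"
      using gauss_equation[OF Qz] by (simp add: g_def h_def Y1_def Y2_def)
    moreover have "g i j (Q z) = g j i (Q z)" for i j by (simp add: g_def inner_commute)
    ultimately show "K (Q z) * det3 (\<lambda>i j. dd S' (space_dir i) (\<lambda>z. Y (Q z)) z \<bullet> dd S' (space_dir j) (\<lambda>z. Y (Q z)) z)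
      = det3 (\<lambda>i j. - (dd S' (space_dir j) (dd S' (space_dir i) (\<lambda>z. Y (Q z))) z \<bullet> N (Q z)))"
      unfolding g_compose[OF z] h_compose[OF z]
      using det3_bform[of "gm (Q z)"] det3_bform[of "hm (Q z)"] h_commute[OF Qz]
      by (simp add: mult.left_commute)
  qed (simp_all add: open_V S'_def)
  let ?z = "(0, snd z0)"
  have Q: "Q ?z = z0" by (simp add: Q_0)
  have J: "J i ?z = e i" for i by (simp add: J_def)
  show ?thesis
  proof
    show "?z \<in> S'" by (rule base_in)
    fix i j k
    show "C.g i j ?z = id3 i j"
      using g_compose[OF base_in(2), of i j] g_frame by (simp add: C.g_def C.Y1_def Q J)
    show "C.h i j ?z = diag3 m i j"
      using h_compose[OF base_in(2), of j i] h_frame by (simp add: C.h_def C.Y2_def C.Y1_def Q J)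
    have "(\<Sum>k\<in>UNIV. quad i j $ k *\<^sub>R Y1 k z0) \<bullet> (\<Sum>c\<in>UNIV. e k $ c *\<^sub>R Y1 c z0)
        = bform (gm z0) (quad i j) (e k)"
      by (rule inner_Y1_combination)
    also have "\<dots> = - christoffel i j k"
      unfolding quad_def bform_minus_left bform_sum_left bform_scale_left g_frame
      using exhaust_3[of k] by (auto simp: diag3_def sum_3)
    finally show "C.Y2 i j ?z \<bullet> C.Y1 k ?z = 0"
      unfolding C.Y2_def C.Y1_def Y2_compose[OF base_in(2)] Y1_compose[OF base_in(2)] Q J inner_add_left
      by (simp add: christoffel_def)
  qed
qed

sublocale C: normal_chart V T S' "\<lambda>z. Y (Q z)" "\<lambda>z. K (Q z)" "\<lambda>z. N (Q z)" "(0, snd z0)" m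
  by (rule normal_chart_Q)

lemma Cg: "z \<in> S' \<Longrightarrow> C.g i j z = bform (gm (Q z)) (J i z) (J j z)"
  using g_compose by (simp add: C.g_def C.Y1_def)

lemma Ch: "z \<in> S' \<Longrightarrow> C.h i j z = bform (hm (Q z)) (J i z) (J j z)"
  using h_compose by (simp add: C.h_def C.Y2_def C.Y1_def)

lemma det_frame: "det (\<chi> i. e i) \<noteq> 0"
proof
  assume "det (\<chi> i. e i) = 0"
  then have "det3 (\<lambda>i j. bform (gm z0) (e i) (e j)) = 0"
    by (subst det3_bform) (simp_all add: g_def inner_commute)
  then show False unfolding g_frame by (simp add: det3_def diag3_def)
qed

text \<open>\<open>Q\<close> maps the time line over 0 to the time line over \<open>fst z0\<close>
  without changing the time, and a time derivative sees nothing but this line.\<close>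

lemma time_derivative_compose_Q:
  assumes "smooth_on S f" "smooth_on S' f'" "\<And>t. t \<in> I \<Longrightarrow> f' (0, t) = f (fst z0, t)"
  shows "dd S' time_dir f' (0, snd z0) = DT f z0"
proof -
  have "DT f z0 = dd (I) 1 (\<lambda>t. f (fst z0, t)) (snd z0)"
    using dd_time_slice[OF open_U assms(1)[unfolded S_eq], of "fst z0" "snd z0"] z0
    by (simp add: mem_S S_eq[symmetric] time_dir_def)
  also have "\<dots> = dd (I) 1 (\<lambda>t. f' (0, t)) (snd z0)"
    using z0 by (intro dd_cong) (simp_all add: mem_S assms(3))
  also have "\<dots> = dd S' time_dir f' (0, snd z0)"
    using dd_time_slice[OF open_V assms(2)[unfolded S'_def], of 0 "snd z0"] base_in z0
    by (simp add: mem_S S'_def[symmetric] time_dir_def)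
  finally show ?thesis ..
qed

lemma slice_in: "y \<in> V \<Longrightarrow> (y, snd z0) \<in> S' \<and> fst (Q (y, snd z0)) \<in> U
    \<and> Q (y, snd z0) = (fst (Q (y, snd z0)), snd z0)"
proof -
  assume "y \<in> V"
  then have "(y, snd z0) \<in> S'" using z0 by (simp add: S'_def mem_S)
  moreover have "Q (y, snd z0) = (fst (Q (y, snd z0)), snd z0)"
    by (simp add: prod_eq_iff snd_Q)
  ultimately show ?thesis using Q_in_S mem_S by blast
qed

text \<open>The gap pulls back with the factor det(J)^4. Being nonnegative everywhere, the factor
  carries the maximum over to the normal parametrization; at the base point it is positive and
  independent of time, so the sign of the derivative carries back.\<close>

lemma psi_numerator_decreasing:
  assumes pos: "\<And>i. m i > 0" and pinched: "\<And>i j. m i \<le> 2 * m j"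
    and max: "\<And>x. x \<in> U \<Longrightarrow> psi_numerator (gm (x, snd z0)) (hm (x, snd z0))
      \<le> psi_fun (m 1) (m 2) (m 3) * (det3 (gm (x, snd z0)))\<^sup>2"
  shows "DT (\<lambda>z. psi_gap (psi_fun (m 1) (m 2) (m 3)) z) z0 \<le> 0"
proof -
  let ?c = "psi_fun (m 1) (m 2) (m 3)"
  define f where "f z = psi_gap ?c z" for z
  define f' where "f' z = C.psi_gap ?c z" for z
  have f': "f' z = det (\<chi> i. J i z) ^ 4 * f (Q z)" if "z \<in> S'" for z
  proof -
    have sym: "g i j (Q z) = g j i (Q z)" "h i j (Q z) = h j i (Q z)" for i j
      using h_commute[OF Q_in_S[OF that]] by (auto simp: g_def inner_commute)
    show ?thesis
      unfolding f'_def f_def Cg[OF that] Ch[OF that]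
      using psi_numerator_bform[of "gm (Q z)" "hm (Q z)" "\<lambda>i. J i z", OF sym]
        det3_bform[of "gm (Q z)" "\<lambda>i. J i z", OF sym(1)]
      by algebra
  qed
  have sm: "smooth_on S f" "smooth_on S' f'"
    unfolding f_def[abs_def] f'_def[abs_def] psi_numerator_def mixed_det_def det3_def
    by (intro smooths smooth_g smooth_h C.smooth_g C.smooth_h)+
  have "dd S' time_dir f' (0, snd z0) \<le> 0"
    unfolding f'_def
  proof (rule C.psi_numerator_decreasing[OF pos pinched, unfolded snd_conv])
    fix y assume "y \<in> V"
    from slice_in[OF this] have y: "(y, snd z0) \<in> S'" "fst (Q (y, snd z0)) \<in> U"
      "Q (y, snd z0) = (fst (Q (y, snd z0)), snd z0)" by auto
    have "f (Q (y, snd z0)) \<le> 0" using max[OF y(2)] y(3) by (simp add: f_def)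
    then have "f' (y, snd z0) \<le> 0" unfolding f'[OF y(1)] by (simp add: mult_nonneg_nonpos)
    then show "psi_numerator (C.gm (y, snd z0)) (C.hm (y, snd z0))
         \<le> ?c * (det3 (C.gm (y, snd z0)))\<^sup>2"
      by (simp add: f'_def)
  qed
  moreover have "dd S' time_dir f' (0, snd z0) = DT (\<lambda>z. det (\<chi> i. e i) ^ 4 * f z) z0"
  proof (rule time_derivative_compose_Q[OF _ sm(2)])
    show "smooth_on S (\<lambda>z. det (\<chi> i. e i) ^ 4 * f z)" by (intro smooths sm)
    fix t assume "t \<in> I"
    then have "(0, t) \<in> S'" using base_in by (simp add: S'_def)
    then show "f' (0, t) = det (\<chi> i. e i) ^ 4 * f (fst z0, t)" by (simp add: f' Q_0 J_def)
  qed
  moreover have "DT (\<lambda>z. det (\<chi> i. e i) ^ 4 * f z) z0 = det (\<chi> i. e i) ^ 4 * DT f z0"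
    using appr_S z0 by (subst dd_mult) (simp_all add: sm)
  moreover have "det (\<chi> i. e i) ^ 4 > 0" using det_frame by simp
  ultimately have "DT f z0 \<le> 0" by (simp add: mult_le_0_iff)
  then show ?thesis by (simp add: f_def[abs_def])
qed

lemma pinching_defect_decreasing:
  assumes pos: "m 2 > 0" "m 3 > 0" and boundary: "m 1 = 2 * m 3"
    and pinched: "m 1 \<le> 2 * m 2" "m 2 \<le> 2 * m 3"
    and max: "\<And>x v w. x \<in> U \<Longrightarrow>
      defect v w (x, snd z0) \<le> 0"
  shows "DT (defect (e 1) (e 3)) z0 < 0"
proof -
  \<comment> \<open>The defect is invariant once vectors are pushed forward by \<open>J\<close>; at
    the base point \<open>axis 1 1\<close> and \<open>axis 3 1\<close> become \<open>e 1\<close> and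
    \<open>e 3\<close>.\<close>
  have defect: "C.defect v w z
    = pinching_defect (gm (Q z)) (hm (Q z))
        (\<Sum>i\<in>UNIV. v $ i *\<^sub>R J i z) (\<Sum>i\<in>UNIV. w $ i *\<^sub>R J i z)" if "z \<in> S'" for z v w
    unfolding Cg[OF that] Ch[OF that] by (rule pinching_defect_bform)
  have "dd S' time_dir (C.defect (axis 1 1) (axis 3 1)) (0, snd z0) < 0"
  proof (rule C.pinching_defect_decreasing[OF pos boundary pinched, unfolded snd_conv])
    fix y v w assume "y \<in> V"
    from slice_in[OF this] have y: "(y, snd z0) \<in> S'" "fst (Q (y, snd z0)) \<in> U"
      "Q (y, snd z0) = (fst (Q (y, snd z0)), snd z0)" by auto
    show "C.defect v w (y, snd z0) \<le> 0"
      unfolding defect[OF y(1)] using max[OF y(2)] y(3) by simp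
  qed
  moreover have "dd S' time_dir (C.defect (axis 1 1) (axis 3 1)) (0, snd z0)
    = DT (defect (e 1) (e 3)) z0"
  proof (rule time_derivative_compose_Q)
    show "smooth_on S (defect (e 1) (e 3))"
      unfolding pinching_defect_def qform_def sum_3 by (intro smooths smooth_g smooth_h)
    show "smooth_on S' (C.defect (axis 1 1) (axis 3 1))"
      unfolding pinching_defect_def qform_def sum_3 by (intro C.smooths C.smooth_g C.smooth_h)
    fix t assume "t \<in> I"
    then have "(0, t) \<in> S'" using base_in by (simp add: S'_def)
    then show "C.defect (axis 1 1) (axis 3 1) (0, t)
      = defect (e 1) (e 3) (fst z0, t)"
      by (simp add: defect Q_0 J_def sum_3 axis_def)
  qed
  ultimately show ?thesis by simp
qed

end

subsection \<open>Simultaneous diagonalization\<close>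

text \<open>With the eigenvectors as columns of \<open>E\<close> the relation reads
  \<open>(h + s g) E = g E D\<close> for a diagonal \<open>D\<close>, and the nonzero determinant of
  \<open>E\<close> cancels. At \<open>s = 0\<close> this says that the Gauss curvature is
  \<open>det h / det g\<close>.\<close>

lemma det3_eigen_pencil:
  fixes g h :: "real^3^3"
  assumes "relative_eigenvalues g h l"
  shows "det (h + s *\<^sub>R g) = det g * ((s + l $ 1) * (s + l $ 2) * (s + l $ 3))"
proof -
  obtain e where e: "inj e" "independent (range e)" "\<And>i. h *v e i = (l $ i) *\<^sub>R (g *v e i)"
    using assms unfolding relative_eigenvalues_def by blast
  define E where "E = (\<chi> i j. e j $ i)"
  define D :: "real^3^3" where "D = (\<chi> i j. if i = j then s + l $ i else 0)"
  have col: "column i E = e i" for i by (simp add: column_def E_def)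
  have "columns E = range e" unfolding columns_def col by auto
  then have "rank E = CARD(3)"
    using e(1,2) by (simp add: column_rank_def dim_eq_card_independent card_image)
  then have "inj ((*v) E)" by (simp only: full_rank_injective)
  then have detE: "det E \<noteq> 0"
    using det_nz_iff_inj[OF matrix_vector_mul_linear[of E]] by (simp add: matrix_of_matrix_vector_mul)
  have "(h + s *\<^sub>R g) ** E = g ** E ** D"
  proof -
    have "((h + s *\<^sub>R g) ** E) $ i $ j = (g ** E ** D) $ i $ j" for i j
    proof -
      have "((h + s *\<^sub>R g) ** E) $ i $ j = (h *v e j) $ i + s * (g *v e j) $ i"
        by (simp add: matrix_matrix_mult_def matrix_vector_mult_def E_def sum_3 algebra_simps)
      also have "\<dots> = (g *v e j) $ i * (s + l $ j)" unfolding e(3) by (simp add: algebra_simps)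
      also have "\<dots> = (g ** E ** D) $ i $ j"
        using exhaust_3[of j]
        by (auto simp: matrix_matrix_mult_def matrix_vector_mult_def E_def D_def sum_3 algebra_simps)
      finally show ?thesis .
    qed
    then show ?thesis by (simp add: vec_eq_iff)
  qed
  then have "det (h + s *\<^sub>R g) * det E = det g * det E * det D" by (metis det_mul)
  moreover have "det D = (s + l $ 1) * (s + l $ 2) * (s + l $ 3)" by (simp add: det_3 D_def)
  ultimately show ?thesis using detE by (simp add: mult_ac)
qed

lemma psd_null_vector:
  assumes sym: "\<And>i j. m i j = m j i" and psd: "\<And>v. bform m v v \<ge> 0" and null: "bform m v v = 0"
  shows "bform m v u = 0"
proof -
  have expand: "bform m (v + s *\<^sub>R u) (v + s *\<^sub>R u) = 2 * s * bform m v u + s\<^sup>2 * bform m u u" for s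
  proof -
    have "bform m (v + s *\<^sub>R u) (v + s *\<^sub>R u)
        = bform m v v + s * (bform m v u + bform m u v) + s\<^sup>2 * bform m u u"
      unfolding bform_def sum_3 by (simp add: algebra_simps power2_eq_square)
    then show ?thesis using null bform_commute[of m u v, OF sym] by simp
  qed
  define b c where "b = bform m v u" and "c = bform m u u"
  have ge: "0 \<le> 2 * s * b + s\<^sup>2 * c" for s using psd[of "v + s *\<^sub>R u"] expand[of s] by (simp add: b_def c_def)
  have "c \<ge> 0" using psd by (simp add: c_def)
  \<comment> \<open>The minimizer would be \<open>- b / c\<close>. The denominator
    \<open>c + 1\<close> also covers \<open>c = 0\<close> and still produces a negative value unless
    \<open>b = 0\<close>.\<close>
  have "0 \<le> 2 * (- b / (c + 1)) * b + (- b / (c + 1))\<^sup>2 * c" by (rule ge)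
  also have "\<dots> = - (b\<^sup>2 * (c + 2)) / (c + 1)\<^sup>2"
    using \<open>c \<ge> 0\<close> by (simp add: divide_simps power2_eq_square) (simp add: algebra_simps)
  finally have "b\<^sup>2 * (c + 2) / (c + 1)\<^sup>2 \<le> 0" by simp
  moreover have "(c + 1)\<^sup>2 > 0" using \<open>c \<ge> 0\<close> by simp
  ultimately have "b\<^sup>2 * (c + 2) \<le> 0" by (metis divide_le_0_iff not_le)
  then have "b = 0" using \<open>c \<ge> 0\<close> by (simp add: mult_le_0_iff)
  then show ?thesis by (simp add: b_def)
qed

section \<open>Orthonormal eigenframes of a pair of quadratic forms\<close>

locale metric_pair =
  fixes g h :: "3 \<Rightarrow> 3 \<Rightarrow> real"
  assumes g_sym: "\<And>i j. g i j = g j i" and h_sym: "\<And>i j. h i j = h j i"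
    and g_pos: "\<And>v. v \<noteq> 0 \<Longrightarrow> bform g v v > 0"
begin

lemma g_commute: "bform g u v = bform g v u" by (rule bform_commute[OF g_sym])
lemma h_commute: "bform h u v = bform h v u" by (rule bform_commute[OF h_sym])

lemma bform_simps:
  "bform k (u + v) w = bform k u w + bform k v w" "bform k (u - v) w = bform k u w - bform k v w"
  "bform k w (u + v) = bform k w u + bform k w v" "bform k w (u - v) = bform k w u - bform k w v"
  "bform k (c *\<^sub>R u) w = c * bform k u w" "bform k w (c *\<^sub>R u) = c * bform k w u"
  unfolding bform_def sum_3 by (simp_all add: algebra_simps)

definition eigenvector :: "real \<Rightarrow> real^3 \<Rightarrow> bool" where
  "eigenvector a u \<longleftrightarrow> (\<forall>v. bform h u v = a * bform g u v)"

lemma eigenvector_orthogonal: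
  assumes "eigenvector a u" "eigenvector b v" "a \<noteq> b" shows "bform g u v = 0"
proof -
  have "a * bform g u v = b * bform g u v"
    using assms(1,2) h_commute[of u v] g_commute[of u v] by (simp add: eigenvector_def)
  then show ?thesis using assms(3) by simp
qed

lemma eigenvector_scale: "eigenvector a u \<Longrightarrow> eigenvector a (c *\<^sub>R u)"
  by (simp add: eigenvector_def bform_simps)

text \<open>For equal eigenvalues the combination stays in the eigenspace; for different ones
  orthogonality makes the subtracted term zero. So Gram-Schmidt never mixes eigenvalues.\<close>

lemma eigenvector_project:
  assumes "eigenvector a u" "eigenvector b v"
  shows "eigenvector a (u - bform g u v *\<^sub>R v)"
proof (cases "a = b")
  case True then show ?thesis using assms by (simp add: eigenvector_def bform_simps algebra_simps)
next
  case False then show ?thesis using eigenvector_orthogonal[OF assms] assms(1) by simp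
qed

definition unit :: "real^3 \<Rightarrow> real^3" where
  "unit v = (1 / sqrt (bform g v v)) *\<^sub>R v"

lemma unit_unit: "v \<noteq> 0 \<Longrightarrow> bform g (unit v) (unit v) = 1"
  using g_pos[of v] by (simp add: unit_def bform_simps)

text \<open>Gram-Schmidt with respect to \<open>g\<close>. The i-th vector remains an eigenvector
  for \<open>l i\<close>, so the given order of the eigenvalues is retained, repetitions
  included.\<close>

lemma frame_exists:
  assumes "inj e" "independent (range e)" "\<And>i. eigenvector (l i) (e i)"
  obtains f where "\<And>i j. bform g (f i) (f j) = id3 i j"
    "\<And>i j. bform h (f i) (f j) = diag3 l i j"
proof -
  have indep: "e i \<notin> span (e ` (UNIV - {i}))" for i
  proof
    assume "e i \<in> span (e ` (UNIV - {i}))"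
    moreover have "e ` (UNIV - {i}) = range e - {e i}" using assms(1) by (auto dest: injD)
    ultimately show False using assms(2) unfolding dependent_def by auto
  qed
  define f1 where "f1 = unit (e 1)"
  define u2 where "u2 = e 2 - bform g (e 2) f1 *\<^sub>R f1"
  define f2 where "f2 = unit u2"
  define u3 where "u3 = (e 3 - bform g (e 3) f1 *\<^sub>R f1) - bform g (e 3 - bform g (e 3) f1 *\<^sub>R f1) f2 *\<^sub>R f2"
  define f3 where "f3 = unit u3"
  have s1: "f1 \<in> span {e 1}" by (simp add: f1_def unit_def span_base span_scale)
  have s2: "f2 \<in> span {e 1, e 2}"
    unfolding f2_def unit_def u2_def using s1 span_mono[of "{e 1}" "{e 1, e 2}"]
    by (intro span_scale span_diff) (auto intro: span_base)
  have "e 1 \<noteq> 0" using indep[of 1] span_0 by metis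
  have "u2 \<noteq> 0"
  proof
    assume "u2 = 0"
    then have "e 2 = bform g (e 2) f1 *\<^sub>R f1" by (simp add: u2_def)
    then have "e 2 \<in> span {e 1}" using s1 span_scale by metis
    then show False using indep[of 2] span_mono[of "{e 1}" "e ` (UNIV - {2})"] by auto
  qed
  have "u3 \<noteq> 0"
  proof
    assume "u3 = 0"
    then have "e 3 = bform g (e 3) f1 *\<^sub>R f1 + bform g (e 3 - bform g (e 3) f1 *\<^sub>R f1) f2 *\<^sub>R f2"
      by (simp add: u3_def algebra_simps)
    also have "\<dots> \<in> span {e 1, e 2}"
      using s1 s2 span_mono[of "{e 1}" "{e 1, e 2}"] by (intro span_add span_scale) auto
    finally show False using indep[of 3] span_mono[of "{e 1, e 2}" "e ` (UNIV - {3})"] by auto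
  qed
  have n: "bform g f1 f1 = 1" "bform g f2 f2 = 1" "bform g f3 f3 = 1"
    using \<open>e 1 \<noteq> 0\<close> \<open>u2 \<noteq> 0\<close> \<open>u3 \<noteq> 0\<close> by (simp_all add: f1_def f2_def f3_def unit_unit)
  have o12: "bform g f2 f1 = 0"
    using n(1) by (simp add: f2_def unit_def u2_def bform_simps)
  have o13: "bform g f3 f1 = 0" and o23: "bform g f3 f2 = 0"
    using n o12 by (simp_all add: f3_def unit_def u3_def bform_simps g_commute[of f1 f2])
  have e1: "eigenvector (l 1) f1" unfolding f1_def unit_def by (intro eigenvector_scale assms)
  have e2: "eigenvector (l 2) f2"
    unfolding f2_def unit_def u2_def
    by (rule eigenvector_scale[OF eigenvector_project[OF assms(3) e1]])
  have e3: "eigenvector (l 3) f3"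
    unfolding f3_def unit_def u3_def
    by (rule eigenvector_scale[OF eigenvector_project[OF eigenvector_project[OF assms(3) e1] e2]])
  define f where "f i = (if i = 1 then f1 else if i = 2 then f2 else f3)" for i :: 3
  have f: "bform g (f i) (f j) = id3 i j" for i j
    using exhaust_3[of i] exhaust_3[of j] n o12 o13 o23
    by (auto simp: f_def diag3_def g_commute[of f1 f2] g_commute[of f1 f3] g_commute[of f2 f3])
  moreover have "eigenvector (l i) (f i)" for i
    using exhaust_3[of i] e1 e2 e3 by (auto simp: f_def)
  then have "bform h (f i) (f j) = diag3 l i j" for i j
    using f[of i j] by (simp add: eigenvector_def diag3_def)
  ultimately show thesis using that by blast
qed

lemma frame_spans:
  assumes "\<And>i j. bform g (f i) (f j) = id3 i j"
  obtains a where "v = (\<Sum>i\<in>UNIV. a $ i *\<^sub>R f i)"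
proof -
  have "det (\<chi> i. f i) \<noteq> 0"
  proof
    assume "det (\<chi> i. f i) = 0"
    then have "det3 (\<lambda>i j. bform g (f i) (f j)) = 0" by (simp add: det3_bform[OF g_sym])
    then show False unfolding assms by (simp add: det3_def diag3_def)
  qed
  then have "invertible (transpose (\<chi> i. f i))" by (simp add: invertible_det_nz det_transpose)
  then obtain B where B: "transpose (\<chi> i. f i) ** B = mat 1" unfolding invertible_def by blast
  have comb: "transpose (\<chi> i. f i) *v x = (\<Sum>i\<in>UNIV. x $ i *\<^sub>R f i)" for x
    by (simp add: vec_eq_iff matrix_vector_mult_def transpose_def mult.commute)
  have "v = transpose (\<chi> i. f i) *v (B *v v)"
    unfolding matrix_vector_mul_assoc B by simp
  then have "v = (\<Sum>i\<in>UNIV. (B *v v) $ i *\<^sub>R f i)" unfolding comb .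
  then show thesis by (rule that)
qed

lemma qform_eq: "qform k v = bform k v v"
  by (simp add: qform_def bform_def)

text \<open>In an eigenframe the defect is the sum of (l_i - 2 l_j) a_i^2 b_j^2 over all i and j;
  frame vectors single out one coefficient.\<close>

lemma pinching_defect_nonpos_iff:
  assumes f: "\<And>i j. bform g (f i) (f j) = id3 i j" "\<And>i j. bform h (f i) (f j) = diag3 l i j"
  shows "(\<forall>v w. pinching_defect g h v w \<le> 0) \<longleftrightarrow> (\<forall>i j. l i \<le> 2 * l j)"
proof
  assume "\<forall>v w. pinching_defect g h v w \<le> 0"
  then have "pinching_defect g h (f i) (f j) \<le> 0" for i j by blast
  then show "\<forall>i j. l i \<le> 2 * l j" by (simp add: pinching_defect_def qform_eq f diag3_def)
next
  assume l: "\<forall>i j. l i \<le> 2 * l j"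
  show "\<forall>v w. pinching_defect g h v w \<le> 0"
  proof (intro allI)
    fix v w
    obtain a where a: "v = (\<Sum>i\<in>UNIV. a $ i *\<^sub>R f i)" using frame_spans[OF f(1)] .
    obtain b where b: "w = (\<Sum>i\<in>UNIV. b $ i *\<^sub>R f i)" using frame_spans[OF f(1)] .
    have "pinching_defect g h v w = pinching_defect id3 (diag3 l) a b"
      unfolding a b pinching_defect_bform[symmetric] f ..
    also have "\<dots> = (\<Sum>i\<in>UNIV. \<Sum>j\<in>UNIV. (l i - 2 * l j) * ((a $ i)\<^sup>2 * (b $ j)\<^sup>2))"
      by (simp add: pinching_defect_def qform_def sum_3 diag3_def power2_eq_square algebra_simps)
    also have "\<dots> \<le> 0"
      using l by (intro sum_nonpos mult_nonpos_nonneg) (auto simp: algebra_simps)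
    finally show "pinching_defect g h v w \<le> 0" .
  qed
qed

text \<open>At a zero of a nonpositive pinching defect the two arguments are eigenvectors for the
  extreme eigenvalues; a third eigenvector is orthogonal to both.\<close>

lemma pinching_boundary_frame:
  assumes h_pos: "\<And>v. v \<noteq> 0 \<Longrightarrow> bform h v v > 0"
    and le: "\<And>v w. pinching_defect g h v w \<le> 0"
    and zero: "pinching_defect g h v w = 0" and nz: "v \<noteq> 0" "w \<noteq> 0"
  obtains e m where "\<And>i j. bform g (e i) (e j) = id3 i j"
    "\<And>i j. bform h (e i) (e j) = diag3 m i j"
    "e 1 = (1 / sqrt (bform g v v)) *\<^sub>R v" "e 3 = (1 / sqrt (bform g w w)) *\<^sub>R w"
    "m 2 > 0" "m 3 > 0" "m 1 = 2 * m 3" "m 1 \<le> 2 * m 2" "m 2 \<le> 2 * m 3"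
proof -
  \<comment> \<open>\<open>c\<close> will be the smallest eigenvalue, attained at \<open>w\<close>,
    and \<open>2 * c\<close> the largest, attained at \<open>v\<close>: the forms h - c g and 2 c g
    - h are nonnegative with null vectors \<open>w\<close> and \<open>v\<close>.\<close>
  define c where "c = bform h w w / bform g w w"
  have gv: "bform g v v > 0" and gw: "bform g w w > 0" using nz g_pos by auto
  have c: "c > 0" "bform h w w = c * bform g w w" using gw h_pos nz by (auto simp: c_def)
  have "bform h v v * bform g w w = 2 * (c * bform g w w * bform g v v)"
    using zero c(2) by (simp add: pinching_defect_def qform_eq)
  then have hv: "bform h v v = 2 * c * bform g v v" using gw by simp
  have upper: "bform h u u \<le> 2 * c * bform g u u" for u
  proof -
    have "bform h u u * bform g w w \<le> 2 * (c * bform g w w * bform g u u)"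
      using le[of u w] c(2) by (simp add: pinching_defect_def qform_eq)
    then have "bform g w w * bform h u u \<le> bform g w w * (2 * c * bform g u u)" by (simp add: mult_ac)
    then show ?thesis using gw by simp
  qed
  have lower: "c * bform g u u \<le> bform h u u" for u
  proof -
    have "2 * c * bform g v v * bform g u u \<le> 2 * (bform h u u * bform g v v)"
      using le[of v u] hv by (simp add: pinching_defect_def qform_eq)
    then have "bform g v v * (c * bform g u u) \<le> bform g v v * bform h u u" by (simp add: mult_ac)
    then show ?thesis using gv by simp
  qed
  have ev: "eigenvector (2 * c) v"
  proof -
    have "bform (\<lambda>i j. h i j + (- 2 * c) * g i j) v u = 0" for u
    proof -
      have "bform (\<lambda>i j. - h i j + (2 * c) * g i j) v u = 0"
      proof (rule psd_null_vector)
        show "bform (\<lambda>i j. - h i j + 2 * c * g i j) u u \<ge> 0" for u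
          using upper[of u] by (simp only: bform_add) (simp add: bform_def sum_negf)
        show "bform (\<lambda>i j. - h i j + 2 * c * g i j) v v = 0"
          using hv by (simp only: bform_add) (simp add: bform_def sum_negf)
      qed (simp add: g_sym[of _ _] h_sym[of _ _])
      then show ?thesis by (simp only: bform_add) (simp add: bform_def sum_negf)
    qed
    then show ?thesis unfolding eigenvector_def bform_add by simp
  qed
  have ew: "eigenvector c w"
  proof -
    have "bform (\<lambda>i j. h i j + (- c) * g i j) w u = 0" for u
    proof (rule psd_null_vector)
      show "bform (\<lambda>i j. h i j + - c * g i j) u u \<ge> 0" for u
        using lower[of u] unfolding bform_add by simp
      show "bform (\<lambda>i j. h i j + - c * g i j) w w = 0"
        using c(2) unfolding bform_add by simp
    qed (simp add: g_sym[of _ _] h_sym[of _ _])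
    then show ?thesis unfolding eigenvector_def bform_add by simp
  qed
  have vw: "bform g v w = 0" using eigenvector_orthogonal[OF ev ew] c(1) by simp
  \<comment> \<open>Lowering an index turns \<open>g\<close>-orthogonality into Euclidean
    orthogonality, so a nonzero vector normal to \<open>G v\<close> and \<open>G w\<close> supplies
    the missing frame vector.\<close>
  define G where "G u = (\<chi> k. \<Sum>l\<in>UNIV. g k l * u $ l)" for u :: "real^3"
  have G: "bform g n u = n \<bullet> G u" for n u
    by (simp add: bform_def G_def inner_vec_def sum_3 algebra_simps)
  have "dim {G v, G w} < DIM(real^3)"
  proof -
    have "dim {G v, G w} \<le> card {G v, G w}" by (rule dim_le_card') simp
    also have "\<dots> \<le> 2" by (simp add: card_insert_if)
    finally show ?thesis by simp
  qed
  from orthogonal_to_subspace_exists[OF this] obtain n where n: "n \<noteq> 0"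
    "\<And>y. y \<in> span {G v, G w} \<Longrightarrow> orthogonal n y" by blast
  have nv: "bform g n v = 0" and nw: "bform g n w = 0"
    using n(2)[of "G v"] n(2)[of "G w"] by (auto simp: G orthogonal_def span_base)
  define e where "e i = unit (if i = 1 then v else if i = 2 then n else w)" for i :: 3
  define m where "m i = bform h (e i) (e i)" for i
  have og: "bform g (e i) (e j) = id3 i j" for i j
    using exhaust_3[of i] exhaust_3[of j] vw nv nw n(1) nz unit_unit
    by (auto simp: e_def diag3_def unit_def bform_simps g_commute[of v n] g_commute[of w n] g_commute[of w v])
  have ev': "eigenvector (2 * c) (e 1)" and ew': "eigenvector c (e 3)"
    using ev ew by (simp_all add: e_def unit_def eigenvector_scale)
  have oh: "bform h (e i) (e j) = diag3 m i j" for i j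
  proof (cases "i = j")
    case False
    then have "i = 1 \<or> i = 3 \<or> j = 1 \<or> j = 3" using exhaust_3[of i] exhaust_3[of j] by auto
    then have "bform h (e i) (e j) = 0"
      using ev' ew' og[of i j] og[of j i] False h_commute[of "e i" "e j"]
      unfolding eigenvector_def by (auto simp: diag3_def)
    then show ?thesis using False by (simp add: diag3_def)
  qed (simp add: m_def diag3_def)
  have m13: "m 1 = 2 * c" "m 3 = c" using ev' ew' og by (simp_all add: m_def eigenvector_def diag3_def)
  have m2: "c \<le> m 2" "m 2 \<le> 2 * c"
    using lower[of "e 2"] upper[of "e 2"] og[of 2 2] by (simp_all add: m_def diag3_def)
  show thesis
    by (rule that[of e m, OF og oh]) (use m13 m2 c in \<open>simp_all add: e_def unit_def\<close>)
qed

end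

subsection \<open>Persistence in a chart\<close>

lemma bform_matrix:
  assumes "\<And>i j. m i j = m j i"
  shows "bform m u v = ((\<chi> i j. m i j) *v u) \<bullet> v"
proof -
  have "((\<chi> i j. m i j) *v u) \<bullet> v = bform m v u"
    by (simp add: bform_def matrix_vector_mult_def inner_vec_def sum_distrib_left sum_distrib_right mult_ac)
  then show ?thesis using bform_commute[of m u v, OF assms] by simp
qed

lemma pinching_defect_scale:
  "pinching_defect g h (c *\<^sub>R v) (d *\<^sub>R w) = (c\<^sup>2 * d\<^sup>2) * pinching_defect g h v w"
proof -
  have q: "qform m (c *\<^sub>R v) = c\<^sup>2 * qform m v" for m c v
    by (simp add: qform_def sum_distrib_left power2_eq_square mult_ac)
  show ?thesis unfolding pinching_defect_def q by (simp add: algebra_simps)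
qed

lemma psi_K_eq:
  assumes "\<And>i. l $ i > 0" shows "psi_K l = psi_fun (l $ 1) (l $ 2) (l $ 3)"
proof -
  have "l $ 1 \<noteq> 0" "l $ 2 \<noteq> 0" "l $ 3 \<noteq> 0" using assms less_irrefl by metis+
  then have "psi_K l = ((l $ 1 - l $ 2) * l $ 3)\<^sup>2 + ((l $ 1 - l $ 3) * l $ 2)\<^sup>2 + ((l $ 2 - l $ 3) * l $ 1)\<^sup>2"
    unfolding psi_K_def gauss_curvature_def Let_def power_mult_distrib
    by (simp add: divide_simps)
  then show ?thesis unfolding psi_fun_def by algebra
qed

lemma dd_pinching_defect:
  assumes S: "approachable S" and z: "z \<in> S"
    and g: "\<And>i j. smooth_on S (g i j)" and h: "\<And>i j. smooth_on S (h i j)"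
  shows "dd S d (\<lambda>z. pinching_defect (\<lambda>i j. g i j z) (\<lambda>i j. h i j z) v w) z
    = qform (\<lambda>i j. dd S d (h i j) z) v * qform (\<lambda>i j. g i j z) w
      + qform (\<lambda>i j. h i j z) v * qform (\<lambda>i j. dd S d (g i j) z) w
      - 2 * (qform (\<lambda>i j. dd S d (h i j) z) w * qform (\<lambda>i j. g i j z) v
        + qform (\<lambda>i j. h i j z) w * qform (\<lambda>i j. dd S d (g i j) z) v)"
proof -
  have q: "jet1 S d z (\<lambda>z. qform (\<lambda>i j. m i j z) v) (qform (\<lambda>i j. m i j z) v) (qform (\<lambda>i j. dd S d (m i j) z) v)"
    if m: "\<And>i j. smooth_on S (m i j)" for m :: "3 \<Rightarrow> 3 \<Rightarrow> 'a \<Rightarrow> real" and v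
  proof -
    have jm: "jet1 S d z (m i j) (m i j z) (dd S d (m i j) z)" for i j by (simp add: jet1_def m)
    show ?thesis
      unfolding qform_def sum_3
      apply (rule jet1_eq)
        apply (rule jet1_intros[OF S z] jm)+
       apply simp_all
      done
  qed
  have "jet1 S d z (\<lambda>z. pinching_defect (\<lambda>i j. g i j z) (\<lambda>i j. h i j z) v w)
     (pinching_defect (\<lambda>i j. g i j z) (\<lambda>i j. h i j z) v w)
     (qform (\<lambda>i j. dd S d (h i j) z) v * qform (\<lambda>i j. g i j z) w
      + qform (\<lambda>i j. h i j z) v * qform (\<lambda>i j. dd S d (g i j) z) w
      - 2 * (qform (\<lambda>i j. dd S d (h i j) z) w * qform (\<lambda>i j. g i j z) v
        + qform (\<lambda>i j. h i j z) w * qform (\<lambda>i j. dd S d (g i j) z) v))"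
    unfolding pinching_defect_def
    apply (rule jet1_eq)
      apply (rule jet1_intros[OF S z] q g h)+
     apply simp_all
    done
  then show ?thesis by (simp add: jet1_def)
qed

text \<open>These properties hold in a genuine chart but can fail after the quadratic change of
  parameters. The order of the components of \<open>l\<close> may jump from point to point, so
  smoothness and continuity are always taken from \<open>g\<close> and \<open>h\<close>.\<close>

locale curvature_chart = flow_chart +
  fixes l :: "(real^3) \<times> real \<Rightarrow> real^3"
  assumes l_pos: "z \<in> S \<Longrightarrow> l z $ i > 0"
    and eigenvalues: "z \<in> S \<Longrightarrow> relative_eigenvalues (\<chi> i j. g i j z) (\<chi> i j. h i j z) (l z)"
    and immersion: "z \<in> S \<Longrightarrow> v \<noteq> 0 \<Longrightarrow> bform (gm z) v v > 0"
begin

lemma metric_pair: "z \<in> S \<Longrightarrow> metric_pair (gm z) (hm z)"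
  by unfold_locales (auto simp: g_def inner_commute h_commute immersion[unfolded g_def])

lemma frame:
  assumes z: "z \<in> S"
  obtains f where "\<And>i j. bform (gm z) (f i) (f j) = id3 i j"
    "\<And>i j. bform (hm z) (f i) (f j) = diag3 (\<lambda>i. l z $ i) i j"
proof -
  interpret metric_pair "gm z" "hm z" by (rule metric_pair[OF z])
  obtain e where e: "inj e" "independent (range e)"
    "\<And>i. (\<chi> i j. h i j z) *v e i = (l z $ i) *\<^sub>R ((\<chi> i j. g i j z) *v e i)"
    using eigenvalues[OF z] unfolding relative_eigenvalues_def by blast
  have "eigenvector (l z $ i) (e i)" for i
    using bform_matrix[of "hm z", OF h_sym] bform_matrix[of "gm z", OF g_sym] e(3)
    by (simp add: eigenvector_def)
  from frame_exists[OF e(1,2) this] show thesis using that by blast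
qed

lemma pinched_iff:
  "z \<in> S \<Longrightarrow> (\<forall>i j. l z $ i \<le> 2 * l z $ j) \<longleftrightarrow>
    (\<forall>v w. defect v w z \<le> 0)"
  using frame metric_pair.pinching_defect_nonpos_iff[OF metric_pair] by metis

lemma h_pos:
  assumes z: "z \<in> S" and v: "v \<noteq> 0" shows "bform (hm z) v v > 0"
proof -
  interpret metric_pair "gm z" "hm z" by (rule metric_pair[OF z])
  obtain f where f: "\<And>i j. bform (gm z) (f i) (f j) = id3 i j"
    "\<And>i j. bform (hm z) (f i) (f j) = diag3 (\<lambda>i. l z $ i) i j" using frame[OF z] by blast
  obtain a where a: "v = (\<Sum>i\<in>UNIV. a $ i *\<^sub>R f i)" using frame_spans[OF f(1)] .
  have "a \<noteq> 0" using v a by auto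
  then obtain k where "a $ k \<noteq> 0" by (auto simp: vec_eq_iff)
  have "bform (hm z) v v = qform (\<lambda>i j. bform (hm z) (f i) (f j)) a"
    unfolding qform_bform a[symmetric] qform_eq ..
  also have "\<dots> = (\<Sum>i\<in>UNIV. l z $ i * (a $ i)\<^sup>2)"
    unfolding f(2) by (simp add: qform_def diag3_def sum_3 power2_eq_square)
  also have "\<dots> > 0"
    using \<open>a $ k \<noteq> 0\<close> l_pos[OF z]
    by (intro sum_pos2[of UNIV k]) (auto simp: less_imp_le)
  finally show ?thesis .
qed

lemma det_g: "z \<in> S \<Longrightarrow> det3 (gm z) \<noteq> 0"
proof
  assume z: "z \<in> S" and "det3 (gm z) = 0"
  obtain f where f: "\<And>i j. bform (gm z) (f i) (f j) = id3 i j"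
    "\<And>i j. bform (hm z) (f i) (f j) = diag3 (\<lambda>i. l z $ i) i j" using frame[OF z] by blast
  have "det3 (\<lambda>i j. bform (gm z) (f i) (f j)) = 0"
    using \<open>det3 _ = 0\<close> by (subst det3_bform) (simp_all add: g_def inner_commute)
  then show False unfolding f(1) by (simp add: det3_def diag3_def)
qed

lemma psi_numerator_eq:
  assumes z: "z \<in> S"
  shows "psi_numerator (gm z) (hm z) = psi_K (l z) * (det3 (gm z))\<^sup>2"
proof -
  interpret metric_pair "gm z" "hm z" by (rule metric_pair[OF z])
  obtain f where f: "\<And>i j. bform (gm z) (f i) (f j) = id3 i j"
    "\<And>i j. bform (hm z) (f i) (f j) = diag3 (\<lambda>i. l z $ i) i j" using frame[OF z] by blast
  let ?d = "det (\<chi> i. f i)"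
  have "?d ^ 4 * psi_numerator (gm z) (hm z)
      = psi_numerator id3 (diag3 (\<lambda>i. l z $ i))"
    using psi_numerator_bform[of "gm z" "hm z" f, OF g_sym h_sym] by (simp add: f)
  also have "\<dots> = psi_K (l z)"
    unfolding psi_K_eq[OF l_pos[OF z]]
    by (simp add: psi_numerator_def mixed_det_def det3_def diag3_def psi_fun_def algebra_simps)
  finally have 1: "?d ^ 4 * psi_numerator (gm z) (hm z) = psi_K (l z)" .
  have 2: "?d\<^sup>2 * det3 (gm z) = 1"
    using det3_bform[of "gm z" f, OF g_sym] by (simp add: f det3_def diag3_def)
  have "psi_K (l z) * (det3 (gm z))\<^sup>2
      = (?d\<^sup>2 * det3 (gm z))\<^sup>2 * psi_numerator (gm z) (hm z)"
    unfolding 1[symmetric] by algebra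
  then show ?thesis by (simp add: 2)
qed

lemma continuous_slices:
  assumes "x \<in> U"
  shows "continuous_on (I) (\<lambda>t. g i j (x, t))" "continuous_on (I) (\<lambda>t. h i j (x, t))"
  using assms
  by (auto intro!: continuous_on_compose2[OF smooth_on_continuous[OF smooth_g]]
      continuous_on_compose2[OF smooth_on_continuous[OF smooth_h]] continuous_intros simp: mem_S)

lemma pinching_persists:
  assumes x0: "x0 \<in> U" and t0: "t0 \<in> I"
    and pinched: "\<And>x i j. x \<in> U \<Longrightarrow> l (x, t0) $ i \<le> 2 * l (x, t0) $ j"
  obtains V d where "open V" "x0 \<in> V" "V \<subseteq> U" "d > 0"
    "\<And>x t i j. x \<in> V \<Longrightarrow> t \<in> I \<Longrightarrow> t0 \<le> t \<Longrightarrow> t < t0 + d \<Longrightarrow> l (x, t) $ i \<le> 2 * l (x, t) $ j"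
proof -
  \<comment> \<open>The defect is homogeneous of degree two in each vector, so unit vectors suffice,
    and they form a compact parameter set.\<close>
  define C where "C = sphere (0 :: real^3) 1 \<times> sphere (0 :: real^3) 1"
  define f where "f c z = pinching_defect (gm z) (hm z) (fst c) (snd c)" for c z
  have z0: "(x0, t0) \<in> S" using x0 t0 by (simp add: mem_S)
  have le: "f c (x, t0) \<le> 0" if "x \<in> U" for c x
    using pinched_iff[of "(x, t0)"] pinched[OF that] that t0 by (simp add: f_def mem_S)
  have sm: "smooth_on S (f c)" for c
    unfolding f_def pinching_defect_def qform_def sum_3 by (intro smooths smooth_g smooth_h)
  have cg: "continuous_on (S \<times> C) (\<lambda>y. k (fst y))" if "smooth_on S k" for k :: "_ \<Rightarrow> real"
    by (rule continuous_on_compose2[OF smooth_on_continuous[OF that]]) (auto intro!: continuous_intros)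
  have cq: "continuous_on (S \<times> C) (\<lambda>y. qform (\<lambda>i j. k i j (fst y)) (fst (snd y)))"
    "continuous_on (S \<times> C) (\<lambda>y. qform (\<lambda>i j. k i j (fst y)) (snd (snd y)))"
    if "\<And>i j. smooth_on S (k i j)" for k :: "3 \<Rightarrow> 3 \<Rightarrow> _ \<Rightarrow> real"
    unfolding qform_def sum_3 by (intro continuous_intros cg that)+
  have dec: "dd S (0, 1) (f c) (x0, t0) < 0" if c: "c \<in> C" and zero: "f c (x0, t0) = 0" for c
  proof -
    define v w where "v = fst c" and "w = snd c"
    have nz: "v \<noteq> 0" "w \<noteq> 0" using c by (auto simp: C_def v_def w_def)
    interpret P: metric_pair "gm (x0, t0)" "hm (x0, t0)" by (rule metric_pair[OF z0])
    have le0: "defect v w (x0, t0) \<le> 0" for v w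
      using le[OF x0, of "(v, w)"] by (simp add: f_def)
    have zero': "defect v w (x0, t0) = 0"
      using zero by (simp add: f_def v_def w_def)
    define gv gw where "gv = bform (gm (x0, t0)) v v" and "gw = bform (gm (x0, t0)) w w"
    have gvw: "gv > 0" "gw > 0" using immersion[OF z0] nz by (auto simp: gv_def gw_def)
    \<comment> \<open>The frame is chosen so that \<open>e 1\<close> and \<open>e 3\<close> are the
      normalized contact vectors. Rescaling costs the positive constant
      \<open>1 / gv * (1 / gw)\<close>, which leaves the sign of the time derivative
      unchanged.\<close>
    obtain e m where e: "\<And>i j. bform (gm (x0, t0)) (e i) (e j) = id3 i j"
      "\<And>i j. bform (hm (x0, t0)) (e i) (e j) = diag3 m i j"
      "e 1 = (1 / sqrt gv) *\<^sub>R v" "e 3 = (1 / sqrt gw) *\<^sub>R w"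
      and m: "m 2 > 0" "m 3 > 0" "m 1 = 2 * m 3" "m 1 \<le> 2 * m 2" "m 2 \<le> 2 * m 3"
      using P.pinching_boundary_frame[OF h_pos[OF z0] le0 zero' nz, folded gv_def gw_def] by blast
    interpret F: frame_chart U T S Y K N "(x0, t0)" e m
      by unfold_locales (use z0 e in auto)
    have "DT (defect (e 1) (e 3)) (x0, t0) < 0"
    proof (rule F.pinching_defect_decreasing[OF m])
      fix x v w assume "x \<in> U"
      from le[OF this, of "(v, w)"]
      show "defect v w (x, snd (x0, t0)) \<le> 0"
        by (simp add: f_def)
    qed
    moreover have "(defect (e 1) (e 3))
        = (\<lambda>z. (1 / gv * (1 / gw)) * f c z)"
      unfolding e(3,4) pinching_defect_scale f_def v_def[symmetric] w_def[symmetric]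
      using gvw by (simp add: power_divide)
    moreover have "DT (\<lambda>z. (1 / gv * (1 / gw)) * f c z) (x0, t0)
        = (1 / gv * (1 / gw)) * DT (f c) (x0, t0)"
      using appr_S z0 by (subst dd_mult) (simp_all add: sm)
    ultimately have "(1 / gv * (1 / gw)) * DT (f c) (x0, t0) < 0" by simp
    moreover have "1 / gv * (1 / gw) > 0" using gvw by simp
    ultimately show ?thesis unfolding time_dir_def by (metis mult_less_0_iff not_less_iff_gr_or_eq)
  qed
  have C: "compact C" unfolding C_def by (intro compact_Times compact_sphere)
  have cf: "continuous_on (S \<times> C) (\<lambda>(z, c). f c z)"
    unfolding f_def pinching_defect_def case_prod_beta
    by (intro continuous_intros cq smooth_g smooth_h)
  have cd: "continuous_on (S \<times> C) (\<lambda>(z, c). dd S (0, 1) (f c) z)"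
  proof -
    have "continuous_on (S \<times> C) (\<lambda>y.
      qform (\<lambda>i j. dd S (0, 1) (h i j) (fst y)) (fst (snd y)) * qform (\<lambda>i j. g i j (fst y)) (snd (snd y))
      + qform (\<lambda>i j. h i j (fst y)) (fst (snd y)) * qform (\<lambda>i j. dd S (0, 1) (g i j) (fst y)) (snd (snd y))
      - 2 * (qform (\<lambda>i j. dd S (0, 1) (h i j) (fst y)) (snd (snd y)) * qform (\<lambda>i j. g i j (fst y)) (fst (snd y))
        + qform (\<lambda>i j. h i j (fst y)) (snd (snd y)) * qform (\<lambda>i j. dd S (0, 1) (g i j) (fst y)) (fst (snd y))))"
      by (intro continuous_intros cq smooth_g smooth_h smooth_dd)
    then show ?thesis
      unfolding f_def case_prod_beta
      by (rule continuous_on_eq) (auto simp: dd_pinching_defect[OF appr_S _ smooth_g smooth_h])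
  qed
  from nonpos_persists[OF open_U C S_eq sm cf cd z0 le dec]
  obtain V d where V: "open V" "x0 \<in> V" "V \<subseteq> U" "d > 0" and
    V5: "\<And>x t c. x \<in> V \<Longrightarrow> t \<in> I \<Longrightarrow> t0 \<le> t \<Longrightarrow> t < t0 + d \<Longrightarrow> c \<in> C \<Longrightarrow> f c (x, t) \<le> 0"
    by blast
  show thesis
  proof (rule that[OF V(1-4)])
    fix x t i j assume x: "x \<in> V" and t: "t \<in> I" "t0 \<le> t" "t < t0 + d"
    have z: "(x, t) \<in> S" using x t V(3) by (auto simp: mem_S)
    have "defect v w (x, t) \<le> 0" for v w
    proof (cases "v = 0 \<or> w = 0")
      case True then show ?thesis by (auto simp: pinching_defect_def qform_def)
    next
      case False
      let ?v = "(1 / norm v) *\<^sub>R v" and ?w = "(1 / norm w) *\<^sub>R w"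
      have "(?v, ?w) \<in> C" using False by (simp add: C_def)
      then have "f (?v, ?w) (x, t) \<le> 0" by (rule V5[OF x t])
      moreover have "defect v w (x, t)
        = ((norm v)\<^sup>2 * (norm w)\<^sup>2) * f (?v, ?w) (x, t)"
        using False by (simp add: f_def pinching_defect_scale[symmetric])
      ultimately show ?thesis by (simp add: mult_nonneg_nonpos)
    qed
    then show "l (x, t) $ i \<le> 2 * l (x, t) $ j" using pinched_iff[OF z] by blast
  qed
qed

text \<open>The gap has a time derivative that is only nonpositive at a contact point. The
  correction \<open>eps * (t - t0) * G\<close> vanishes on the slice \<open>t0\<close> and
  contributes \<open>- eps * G\<close> to the derivative, which makes the sign strict as
  \<open>nonpos_persists\<close> demands. The parameter \<open>a\<close> ranges over a single point,
  as there are no test vectors.\<close>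

lemma psi_K_persists:
  assumes x0: "x0 \<in> U" and t0: "t0 \<in> I" and eps: "eps > 0"
    and pinched: "\<And>i j. l (x0, t0) $ i \<le> 2 * l (x0, t0) $ j"
    and bound: "\<And>x. x \<in> U \<Longrightarrow> psi_K (l (x, t0)) \<le> c"
  obtains V d where "open V" "x0 \<in> V" "V \<subseteq> U" "d > 0"
    "\<And>x t. x \<in> V \<Longrightarrow> t \<in> I \<Longrightarrow> t0 \<le> t \<Longrightarrow> t < t0 + d \<Longrightarrow>
      psi_K (l (x, t)) \<le> c + eps * (t - t0)"
proof -
  define G where "G z = (det3 (gm z))\<^sup>2" for z
  define R where "R z = psi_numerator (gm z) (hm z) - c * G z" for z
  define f :: "real \<Rightarrow> _" where "f a z = R z - (eps * (snd z - t0)) * G z" for a z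
  have z0: "(x0, t0) \<in> S" using x0 t0 by (simp add: mem_S)
  have bl: "bounded_linear (snd :: (real^3) \<times> real \<Rightarrow> real)" by (rule bounded_linear_snd)
  have smG: "smooth_on S G" unfolding G_def[abs_def] det3_def by (intro smooths smooth_g)
  have smR: "smooth_on S R"
    unfolding R_def[abs_def] psi_numerator_def mixed_det_def det3_def by (intro smooths smooth_g smooth_h smG)
  have smt: "smooth_on S (\<lambda>z. eps * (snd z - t0))"
    by (intro smooths smooth_on_linear bl)
  have sm: "smooth_on S (f a)" for a unfolding f_def[abs_def] by (intro smooths smR smt smG)
  have Gpos: "G z > 0" if "z \<in> S" for z using det_g[OF that] by (simp add: G_def)
  have f_eq: "f a z = (psi_K (l z) - (c + eps * (snd z - t0))) * G z" if "z \<in> S" for a z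
    using psi_numerator_eq[OF that] by (simp add: f_def R_def G_def algebra_simps)
  have le: "f a (x, t0) \<le> 0" if "x \<in> U" for a x
  proof -
    have "(x, t0) \<in> S" using that t0 by (simp add: mem_S)
    then show ?thesis
      using bound[OF that] Gpos[of "(x, t0)"] by (simp add: f_eq mult_nonpos_nonneg)
  qed
  have dec: "dd S (0, 1) (f a) (x0, t0) < 0" if zero: "f a (x0, t0) = 0" for a
  proof -
    obtain e where e: "\<And>i j. bform (gm (x0, t0)) (e i) (e j) = id3 i j"
      "\<And>i j. bform (hm (x0, t0)) (e i) (e j) = diag3 (\<lambda>i. l (x0, t0) $ i) i j"
      using frame[OF z0] by blast
    interpret F: frame_chart U T S Y K N "(x0, t0)" e "\<lambda>i. l (x0, t0) $ i"
      by unfold_locales (use z0 e in auto)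
    \<comment> \<open>Contact at time \<open>t0\<close> identifies the abstract bound
      \<open>c\<close> with the value of psi at that point, the constant for which the local maximum
      principle is stated.\<close>
    have c: "c = psi_fun (l (x0, t0) $ 1) (l (x0, t0) $ 2) (l (x0, t0) $ 3)"
      using zero f_eq[OF z0, of a] Gpos[OF z0] psi_K_eq[OF l_pos[OF z0]] by simp
    have "DT R (x0, t0) \<le> 0"
      unfolding R_def[abs_def] G_def c
    proof (rule F.psi_numerator_decreasing)
      show "l (x0, t0) $ i > 0" for i by (rule l_pos[OF z0])
      show "l (x0, t0) $ i \<le> 2 * l (x0, t0) $ j" for i j by (rule pinched)
      fix x assume "x \<in> U"
      from le[OF this, of a]
      show "psi_numerator (gm (x, snd (x0, t0))) (hm (x, snd (x0, t0)))
         \<le> psi_fun (l (x0, t0) $ 1) (l (x0, t0) $ 2) (l (x0, t0) $ 3)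
            * (det3 (gm (x, snd (x0, t0))))\<^sup>2"
        unfolding f_def R_def G_def c by simp
    qed
    moreover have "DT (f a) (x0, t0) = DT R (x0, t0) - eps * G (x0, t0)"
    proof -
      have "DT (\<lambda>z. eps * (snd z - t0)) (x0, t0) = eps"
        using appr_S z0 dd_linear[OF bl appr_S z0, of time_dir] smooth_on_linear[OF bl, of S]
        by (simp add: dd_mult dd_diff smooth_on_diff time_dir_def)
      then show ?thesis
        unfolding f_def[abs_def] using appr_S z0 smR smt smG
        by (simp add: dd_diff dd_mult smooth_on_mult)
    qed
    moreover have "eps * G (x0, t0) > 0" using eps Gpos[OF z0] by simp
    ultimately show ?thesis by (simp add: time_dir_def)
  qed
  have cont: "continuous_on (S \<times> {0 :: real}) (\<lambda>(z, a). k a z)" if "smooth_on S (k 0)" for k :: "real \<Rightarrow> _ \<Rightarrow> real"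
  proof -
    have "continuous_on (S \<times> {0 :: real}) (\<lambda>y. k 0 (fst y))"
      by (rule continuous_on_compose2[OF smooth_on_continuous[OF that]]) (auto intro!: continuous_intros)
    then show ?thesis by (rule continuous_on_eq) auto
  qed
  have "compact {0 :: real}" by simp
  from nonpos_persists[OF open_U this S_eq sm cont[OF sm] cont[of "\<lambda>a. dd S (0, 1) (f a)", OF smooth_dd[OF sm]] z0 le dec]
  obtain V d where V: "open V" "x0 \<in> V" "V \<subseteq> U" "d > 0" and
    V5: "\<And>x t a. x \<in> V \<Longrightarrow> t \<in> I \<Longrightarrow> t0 \<le> t \<Longrightarrow> t < t0 + d \<Longrightarrow> a \<in> {0} \<Longrightarrow> f a (x, t) \<le> 0"
    by blast
  show thesis
  proof (rule that[OF V(1-4)])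
    fix x t assume x: "x \<in> V" and t: "t \<in> I" "t0 \<le> t" "t < t0 + d"
    have z: "(x, t) \<in> S" using x t V(3) by (auto simp: mem_S)
    have "(psi_K (l (x, t)) - (c + eps * (t - t0))) * G (x, t) \<le> 0"
      using V5[OF x t, of 0] f_eq[OF z, of 0] by simp
    then show "psi_K (l (x, t)) \<le> c + eps * (t - t0)"
      using Gpos[OF z] by (simp add: mult_le_0_iff)
  qed
qed

text \<open>Psi is symmetric in the curvatures, so although \<open>l\<close> itself may jump, psi is
  a quotient of smooth functions of \<open>g\<close> and \<open>h\<close>.\<close>

lemma continuous_psi_K: "continuous_on S (\<lambda>z. psi_K (l z))"
proof -
  have "smooth_on S (\<lambda>z. psi_numerator (gm z) (hm z))" "smooth_on S (\<lambda>z. (det3 (gm z))\<^sup>2)"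
    unfolding psi_numerator_def mixed_det_def det3_def by (intro smooths smooth_g smooth_h)+
  then have "continuous_on S (\<lambda>z. psi_numerator (gm z) (hm z) / (det3 (gm z))\<^sup>2)"
    using det_g by (intro continuous_on_divide smooth_on_continuous) auto
  then show ?thesis by (rule continuous_on_eq) (simp add: psi_numerator_eq det_g)
qed

lemma continuous_pinching_defect:
  "x \<in> U \<Longrightarrow> continuous_on (I)
    (\<lambda>t. defect v w (x, t))"
  unfolding pinching_defect_def qform_def sum_3
  by (intro continuous_intros continuous_slices)

end

subsection \<open>The flow on the closed manifold\<close>

lemma space_slice_derivative:
  assumes "open U" "smooth_on (U \<times> I) f" "x \<in> U" "t \<in> I"
  shows "((\<lambda>x. f (x, t)) has_derivative (\<lambda>v. dd (U \<times> I) (v, 0) f (x, t))) (at x)"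
proof -
  have "((\<lambda>x. f (x, t)) has_derivative (\<lambda>v. dd (U \<times> I) (v, 0) f (x, t))) (at x within U)"
  proof (rule has_derivative_in_compose2[of "U \<times> I" f "\<lambda>y w. dd (U \<times> I) w f y" _ U])
    show "(f has_derivative (\<lambda>w. dd (U \<times> I) w f y)) (at y within U \<times> I)" if "y \<in> U \<times> I" for y
      by (rule smooth_on_has_derivative[OF assms(2) that])
    show "((\<lambda>x. (x, t)) has_derivative (\<lambda>v. (v, 0))) (at x within U)"
      by (auto intro!: derivative_eq_intros)
  qed (use assms in auto)
  then show ?thesis by (simp add: at_within_open[OF assms(3,1)])
qed

lemma frechet_derivative_slice:
  assumes "open U" "smooth_on (U \<times> I) f" "x \<in> U" "t \<in> I" "\<And>y. y \<in> U \<Longrightarrow> F y = f (y, t)"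
  shows "frechet_derivative F (at x) v = dd (U \<times> I) (v, 0) f (x, t)"
proof -
  have "(F has_derivative (\<lambda>v. dd (U \<times> I) (v, 0) f (x, t))) (at x)"
    by (rule has_derivative_transform_within_open[OF space_slice_derivative[OF assms(1-4)] assms(1,3)])
      (simp add: assms(5))
  from frechet_derivative_at[OF this] show ?thesis by metis
qed

lemma partial_slice:
  assumes "open U" "smooth_on (U \<times> I) f" "x \<in> U" "t \<in> I" "\<And>y. y \<in> U \<Longrightarrow> F y = f (y, t)"
  shows "partial i F x = dd (U \<times> I) (space_dir i) f (x, t)"
  unfolding partial_def space_dir_def by (rule frechet_derivative_slice[OF assms])

lemma curvature_chart_of_flow:
  fixes X :: "real \<Rightarrow> 'm::t2_space \<Rightarrow> real^4"
  assumes flow: "gauss_curvature_flow M A T X \<nu> \<kappa>"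
    and convex: "\<And>t. t \<in> time_interval T \<Longrightarrow> strictly_convex M (\<kappa> t)"
    and chart: "(U, \<phi>) \<in> A" and U: "open U" and sub: "\<phi> ` U \<subseteq> M"
  obtains Y K N where
    "curvature_chart U T (U \<times> time_interval T) Y K N (\<lambda>z. \<kappa> (snd z) (\<phi> (fst z)))"
proof -
  define S where "S = U \<times> time_interval T"
  define Y where "Y z = X (snd z) (\<phi> (fst z))" for z :: "(real^3) \<times> real"
  define V where "V = dd S time_dir Y"
  define K where "K z = norm (V z)" for z
  define N where "N z = - ((1 / K z) *\<^sub>R V z)" for z
  define l where "l z = \<kappa> (snd z) (\<phi> (fst z))" for z :: "(real^3) \<times> real"
  note apS = cylinder_approachable[OF U, of T, folded S_def]
  have smY: "smooth_on S Y"
  proof -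
    have "smooth_on S (\<lambda>(x, t). X t (\<phi> x))"
      using flow chart unfolding gauss_curvature_flow_def smooth_family_def S_def by fast
    moreover have "(\<lambda>(x, t). X t (\<phi> x)) = Y" by (auto simp: Y_def)
    ultimately show ?thesis by simp
  qed
  have smV: "smooth_on S V" unfolding V_def by (rule smooth_on_dd[OF apS smY])
  have at_t: "smooth_embedding M A (X t)" "outer_normal_field M A (X t) (\<nu> t)"
    "principal_curvatures A (X t) (\<nu> t) (\<kappa> t)"
    "\<And>p. p \<in> M \<Longrightarrow> ((\<lambda>s. X s p) has_vector_derivative - gauss_curvature (\<kappa> t p) *\<^sub>R \<nu> t p)
                   (at t within time_interval T)" if "t \<in> time_interval T" for t
    using flow that unfolding gauss_curvature_flow_def by auto
  have inM: "\<phi> (fst z) \<in> M" "snd z \<in> time_interval T" "fst z \<in> U" if "z \<in> S" for z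
    using that sub by (auto simp: S_def)
  have lpos: "l z $ i > 0" if "z \<in> S" for z i
    using convex[OF inM(2)[OF that]] inM(1)[OF that] by (simp add: strictly_convex_def l_def)
  have normal: "norm (\<nu> (snd z) (\<phi> (fst z))) = 1"
    "partial i (X (snd z) \<circ> \<phi>) (fst z) \<bullet> \<nu> (snd z) (\<phi> (fst z)) = 0" if "z \<in> S" for z i
    using at_t(2)[OF inM(2)[OF that]] chart inM(3)[OF that]
    unfolding outer_normal_field_def outer_unit_normal_def by blast+
  have V: "V z = - (gauss_curvature (l z) *\<^sub>R \<nu> (snd z) (\<phi> (fst z)))" if z: "z \<in> S" for z
  proof -
    have "V z = dd (time_interval T) 1 (\<lambda>s. Y (fst z, s)) (snd z)"
      using dd_time_slice[OF U smY[unfolded S_def] inM(3)[OF z] inM(2)[OF z]]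
      by (simp add: V_def S_def time_dir_def)
    also have "\<dots> = 1 *\<^sub>R (- gauss_curvature (l z) *\<^sub>R \<nu> (snd z) (\<phi> (fst z)))"
      using at_t(4)[OF inM(2)[OF z] inM(1)[OF z]]
      by (intro dd_eq[OF approachable_time_interval inM(2)[OF z]])
        (simp add: Y_def l_def has_vector_derivative_def)
    finally show ?thesis by simp
  qed
  have gpos: "gauss_curvature (l z) > 0" if "z \<in> S" for z
    using lpos[OF that] by (simp add: gauss_curvature_def)
  have K: "K z = gauss_curvature (l z)" if "z \<in> S" for z
    using gpos[OF that] normal(1)[OF that] by (simp add: K_def V[OF that])
  have N: "N z = \<nu> (snd z) (\<phi> (fst z))" if "z \<in> S" for z
    using gpos[OF that] by (simp add: N_def K[OF that] V[OF that])
  have Vpos: "V z \<bullet> V z > 0" if "z \<in> S" for z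
    using gpos[OF that] normal(1)[OF that] by (simp add: V[OF that] dot_square_norm)
  have smK: "smooth_on S K"
  proof -
    \<comment> \<open>The norm is smooth away from zero, being a square root of a positive smooth
      function; strict convexity keeps the velocity from vanishing.\<close>
    have "smooth_on S (\<lambda>z. (V z \<bullet> V z) powr (1 / 2))"
      by (intro smooth_on_powr smooth_on_inner smV Vpos)
    moreover have "(V z \<bullet> V z) powr (1 / 2) = K z" for z
      by (simp add: powr_half_sqrt K_def norm_eq_sqrt_inner)
    ultimately show ?thesis by simp
  qed
  have smN: "smooth_on S N"
  proof -
    have "smooth_on S (\<lambda>z. - ((K z powr (-1)) *\<^sub>R V z))"
      using K gpos by (intro smooth_on_minus smooth_on_scaleR smooth_on_powr smK smV) simp
    moreover have "- ((K z powr (-1)) *\<^sub>R V z) = N z" if "z \<in> S" for z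
      using gpos[OF that] K[OF that] by (simp add: N_def powr_minus_divide)
    ultimately show ?thesis
      using smooth_on_cong[of S "\<lambda>z. - ((K z powr (-1)) *\<^sub>R V z)" N] by metis
  qed
  have p1: "partial i (X (snd z) \<circ> \<phi>) (fst z) = dd S (space_dir i) Y z" if "z \<in> S" for i z
    using partial_slice[OF U smY[unfolded S_def] inM(3)[OF that] inM(2)[OF that], of "X (snd z) \<circ> \<phi>" i]
    by (simp add: S_def Y_def)
  have p2: "partial j (partial i (X (snd z) \<circ> \<phi>)) (fst z) = dd S (space_dir j) (dd S (space_dir i) Y) z"
    if "z \<in> S" for i j z
  proof -
    have "partial i (X (snd z) \<circ> \<phi>) y = dd S (space_dir i) Y (y, snd z)" if "y \<in> U" for y
      using p1[of "(y, snd z)" i] that inM(2)[OF \<open>z \<in> S\<close>] by (simp add: S_def)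
    from partial_slice[OF U smooth_on_dd[OF apS smY, unfolded S_def] inM(3)[OF that] inM(2)[OF that] this[unfolded S_def]]
    show ?thesis by (simp add: S_def)
  qed
  define g where "g i j z = dd S (space_dir i) Y z \<bullet> dd S (space_dir j) Y z" for i j z
  define h where "h i j z = - (dd S (space_dir j) (dd S (space_dir i) Y) z \<bullet> N z)" for i j z
  have eig: "relative_eigenvalues (\<chi> i j. g i j z) (\<chi> i j. h i j z) (l z)" if z: "z \<in> S" for z
  proof -
    have "relative_eigenvalues (induced_metric (X (snd z) \<circ> \<phi>) (fst z))
        (second_fundamental_form (X (snd z) \<circ> \<phi>) (\<nu> (snd z) (\<phi> (fst z))) (fst z)) (\<kappa> (snd z) (\<phi> (fst z)))"
      using at_t(3)[OF inM(2)[OF z]] chart inM(3)[OF z] unfolding principal_curvatures_def by blast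
    then show ?thesis
      unfolding induced_metric_def second_fundamental_form_def p1[OF z] p2[OF z] g_def h_def N[OF z] l_def .
  qed
  have gauss: "K z * det3 (\<lambda>i j. g i j z) = det3 (\<lambda>i j. h i j z)" if z: "z \<in> S" for z
  proof -
    have sym: "g i j z = g j i z" "h i j z = h j i z" for i j
      using dd_commute[OF apS cylinder_closure_interior[OF U, of T, folded S_def] smY z]
      by (simp_all add: g_def h_def inner_commute)
    have "det (\<chi> i j. h i j z) = det (\<chi> i j. g i j z) * gauss_curvature (l z)"
      using det3_eigen_pencil[OF eig[OF z], of 0] by (simp add: gauss_curvature_def mult_ac)
    then show ?thesis
      using det3_det[of "\<lambda>i j. g i j z", OF sym(1)] det3_det[of "\<lambda>i j. h i j z", OF sym(2)] K[OF z]
      by simp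
  qed
  interpret F: flow_chart U T S Y K N
  proof
    show "smooth_on S Y" "smooth_on S K" "smooth_on S N" by (rule smY smK smN)+
    fix z assume z: "z \<in> S"
    show "dd S time_dir Y z = - (K z *\<^sub>R N z)"
      using K[OF z] N[OF z] V[OF z] by (simp add: V_def)
    show "N z \<bullet> N z = 1" using normal(1)[OF z] N[OF z] by (simp add: dot_square_norm)
    show "dd S (space_dir i) Y z \<bullet> N z = 0" for i using normal(2)[OF z] p1[OF z] N[OF z] by simp
    show "K z * det3 (\<lambda>i j. dd S (space_dir i) Y z \<bullet> dd S (space_dir j) Y z)
      = det3 (\<lambda>i j. - (dd S (space_dir j) (dd S (space_dir i) Y) z \<bullet> N z))"
      using gauss[OF z] by (simp add: g_def h_def)
  qed (simp_all add: U S_def)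
  have gh: "F.g = g" "F.h = h"
    by (simp_all add: fun_eq_iff F.g_def F.h_def F.Y1_def F.Y2_def g_def h_def)
  have "curvature_chart U T S Y K N l"
  proof
    fix z assume z: "z \<in> S"
    show "l z $ i > 0" for i by (rule lpos[OF z])
    show "relative_eigenvalues (\<chi> i j. F.g i j z) (\<chi> i j. F.h i j z) (l z)"
      unfolding gh by (rule eig[OF z])
    fix v :: "real^3" assume v: "v \<noteq> 0"
    have inj: "inj (frechet_derivative (X (snd z) \<circ> \<phi>) (at (fst z)))"
      using at_t(1)[OF inM(2)[OF z]] chart inM(3)[OF z] unfolding smooth_embedding_def by blast
    have D: "frechet_derivative (X (snd z) \<circ> \<phi>) (at (fst z)) v = (\<Sum>k\<in>UNIV. v $ k *\<^sub>R F.Y1 k z)" for v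
      using frechet_derivative_slice[OF U smY[unfolded S_def] inM(3)[OF z] inM(2)[OF z], of "X (snd z) \<circ> \<phi>" v]
        F.dd_space_expand[OF smY z]
      by (simp add: S_def[symmetric] Y_def F.Y1_def)
    \<comment> \<open>Injectivity of the differential is positive definiteness of the induced
      metric.\<close>
    have "(\<Sum>k\<in>UNIV. v $ k *\<^sub>R F.Y1 k z) \<noteq> (\<Sum>k\<in>UNIV. (0 :: real^3) $ k *\<^sub>R F.Y1 k z)"
      using injD[OF inj, of v 0] v unfolding D by blast
    then show "bform (\<lambda>i j. F.g i j z) v v > 0"
      unfolding F.inner_Y1_combination[symmetric] by simp
  qed
  then show thesis using that unfolding S_def l_def[abs_def] by blast
qed

section \<open>Continuous induction in time and compactness in space\<close>

lemma interval_induct: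
  fixes a b :: real
  assumes "a \<le> b" "P a"
    and step: "\<And>t. a \<le> t \<Longrightarrow> t < b \<Longrightarrow> P t \<Longrightarrow> \<exists>d>0. \<forall>u. t \<le> u \<and> u < t + d \<and> u \<le> b \<longrightarrow> P u"
    and limit: "\<And>t. a < t \<Longrightarrow> t \<le> b \<Longrightarrow> (\<And>u. a \<le> u \<Longrightarrow> u < t \<Longrightarrow> P u) \<Longrightarrow> P t"
  shows "P b"
proof -
  \<comment> \<open>Demanding \<open>P\<close> on the whole segment from \<open>a\<close> to
    \<open>t\<close> makes \<open>R\<close> an interval, so every time below its supremum is
    good.\<close>
  define R where "R = {t. a \<le> t \<and> t \<le> b \<and> (\<forall>u. a \<le> u \<and> u \<le> t \<longrightarrow> P u)}"
  define s where "s = Sup R"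
  have aR: "a \<in> R" using assms(1,2) by (auto simp: R_def dest: antisym)
  have bdd: "bdd_above R" unfolding R_def by (rule bdd_aboveI[of _ b]) auto
  have s: "a \<le> s" "s \<le> b"
    unfolding s_def by (rule cSup_upper[OF aR bdd], rule cSup_least) (use aR in \<open>auto simp: R_def\<close>)
  have below: "P u" if u: "a \<le> u" "u < s" for u
  proof -
    obtain t where "t \<in> R" "u < t" using less_cSupD[of R u] aR u(2) by (auto simp: s_def)
    then show ?thesis using u(1) by (auto simp: R_def)
  qed
  have Ps: "P s"
  proof (cases "a = s")
    case False then show ?thesis using limit[of s] s below by simp
  qed (use assms(2) in simp)
  show ?thesis
  proof (cases "s < b")
    case True
    obtain d where d: "d > 0" "\<forall>u. s \<le> u \<and> u < s + d \<and> u \<le> b \<longrightarrow> P u" using step[OF s(1) True Ps] by blast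
    define t where "t = min (s + d / 2) b"
    have t: "s < t" "t < s + d" "t \<le> b" using d(1) True by (auto simp: t_def)
    have "P u" if "a \<le> u" "u \<le> t" for u using below[of u] d(2) that t by (cases "u < s") auto
    then have "t \<in> R" using s t by (auto simp: R_def)
    then have "t \<le> s" unfolding s_def by (rule cSup_upper[OF _ bdd])
    then show ?thesis using t by simp
  qed (use s Ps in simp)
qed

lemma closed_manifold_chart:
  assumes "closed_manifold M A" "(U, \<phi>) \<in> A"
  shows "open U" "\<phi> ` U \<subseteq> M" "V \<subseteq> U \<Longrightarrow> open V \<Longrightarrow> openin (top_of_set M) (\<phi> ` V)"
proof -
  have U: "open U" "openin (top_of_set M) (\<phi> ` U)" "\<exists>\<theta>. homeomorphism U (\<phi> ` U) \<phi> \<theta>"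
    using assms unfolding closed_manifold_def smooth_atlas_def by auto
  show "open U" "\<phi> ` U \<subseteq> M" using U openin_imp_subset by blast+
  assume "V \<subseteq> U" "open V"
  then have "openin (top_of_set U) V" by (simp add: open_subset)
  then show "openin (top_of_set M) (\<phi> ` V)"
    using U(2,3) homeomorphism_imp_open_map openin_trans by metis
qed

lemma closed_manifold_cover:
  assumes "closed_manifold M A" "p \<in> M"
  obtains U \<phi> x where "(U, \<phi>) \<in> A" "x \<in> U" "p = \<phi> x"
  using assms unfolding closed_manifold_def smooth_atlas_def by blast

text \<open>Each point has a neighbourhood with its own time step. Charts carry these neighbourhoods
  to relatively open sets, and a finite subcover of the compact \<open>M\<close> has a smallest
  step.\<close>

lemma closed_manifold_uniform_time:
  assumes M: "closed_manifold M A"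
    and local: "\<And>U \<phi> x. (U, \<phi>) \<in> A \<Longrightarrow> x \<in> U \<Longrightarrow>
      \<exists>V d. open V \<and> x \<in> V \<and> V \<subseteq> U \<and> d > 0 \<and> (\<forall>y\<in>V. \<forall>t. t \<in> I \<and> t0 \<le> t \<and> t < t0 + d \<longrightarrow> P t (\<phi> y))"
  shows "\<exists>d>0 :: real. \<forall>p\<in>M. \<forall>t. t \<in> I \<and> t0 \<le> t \<and> t < t0 + d \<longrightarrow> P t p"
proof -
  define C where "C = {c. openin (top_of_set M) c \<and> (\<exists>d>0. \<forall>p\<in>c. \<forall>t. t \<in> I \<and> t0 \<le> t \<and> t < t0 + d \<longrightarrow> P t p)}"
  have "M \<subseteq> \<Union>C"
  proof
    fix p assume "p \<in> M"
    then obtain U \<phi> x where x: "(U, \<phi>) \<in> A" "x \<in> U" "p = \<phi> x" using closed_manifold_cover[OF M] by metis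
    obtain V d where V: "open V" "x \<in> V" "V \<subseteq> U" "d > 0"
      "\<forall>y\<in>V. \<forall>t. t \<in> I \<and> t0 \<le> t \<and> t < t0 + d \<longrightarrow> P t (\<phi> y)" using local[OF x(1,2)] by blast
    then have "\<phi> ` V \<in> C" using closed_manifold_chart(3)[OF M x(1)] unfolding C_def by blast
    then show "p \<in> \<Union>C" using V(2) x(3) by blast
  qed
  moreover have "compact M" using M by (simp add: closed_manifold_def)
  moreover have "\<forall>c\<in>C. openin (top_of_set M) c" by (simp add: C_def)
  ultimately obtain D where D: "D \<subseteq> C" "finite D" "M \<subseteq> \<Union>D"
    unfolding compact_eq_openin_cover by meson
  have "\<forall>c\<in>D. \<exists>d>0. \<forall>p\<in>c. \<forall>t. t \<in> I \<and> t0 \<le> t \<and> t < t0 + d \<longrightarrow> P t p"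
    using D(1) by (auto simp: C_def)
  then obtain d where d: "\<And>c. c \<in> D \<Longrightarrow> d c > 0"
    "\<And>c p t. c \<in> D \<Longrightarrow> p \<in> c \<Longrightarrow> t \<in> I \<Longrightarrow> t0 \<le> t \<Longrightarrow> t < t0 + d c \<Longrightarrow> P t p" by metis
  define m where "m = Min (insert 1 (d ` D))"
  have "m > 0" using D(2) d(1) by (auto simp: m_def)
  moreover have "P t p" if p: "p \<in> M" and t: "t \<in> I" "t0 \<le> t" "t < t0 + m" for p t
  proof -
    obtain c where c: "c \<in> D" "p \<in> c" using p D(3) by blast
    have "m \<le> d c" unfolding m_def using D(2) c(1) by (intro Min_le) auto
    then show ?thesis using d(2)[OF c t(1,2)] t(3) by simp
  qed
  ultimately show ?thesis by blast
qed

text \<open>The forward step may use the property on the whole slice, since the maximum principle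
  compares a point with its neighbours; the passage to the limit in time works at each point
  separately.\<close>

lemma preserved_on_closed_manifold:
  fixes s t :: real
  assumes M: "closed_manifold M A" and I: "{s..t} \<subseteq> I" and "s \<le> t" and "\<forall>p\<in>M. P s p"
    and step: "\<And>U \<phi> x r. (U, \<phi>) \<in> A \<Longrightarrow> x \<in> U \<Longrightarrow> r \<in> I \<Longrightarrow> \<forall>p\<in>M. P r p \<Longrightarrow>
      \<exists>V d. open V \<and> x \<in> V \<and> V \<subseteq> U \<and> d > 0 \<and> (\<forall>y\<in>V. \<forall>u. u \<in> I \<and> r \<le> u \<and> u < r + d \<longrightarrow> P u (\<phi> y))"
    and limit: "\<And>U \<phi> x r. (U, \<phi>) \<in> A \<Longrightarrow> x \<in> U \<Longrightarrow> s < r \<Longrightarrow> {s..r} \<subseteq> I \<Longrightarrow>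
      (\<And>u. s \<le> u \<Longrightarrow> u < r \<Longrightarrow> P u (\<phi> x)) \<Longrightarrow> P r (\<phi> x)"
  shows "\<forall>p\<in>M. P t p"
proof (rule interval_induct[of s t "\<lambda>t. \<forall>p\<in>M. P t p"])
  fix r assume r: "s \<le> r" "r < t" and P: "\<forall>p\<in>M. P r p"
  have "r \<in> I" using r I by auto
  then have "\<exists>d>0. \<forall>p\<in>M. \<forall>u. u \<in> I \<and> r \<le> u \<and> u < r + d \<longrightarrow> P u p"
    using step P by (intro closed_manifold_uniform_time[OF M])
  moreover have "u \<in> I" if "r \<le> u" "u \<le> t" for u using that r I by auto
  ultimately show "\<exists>d>0. \<forall>u. r \<le> u \<and> u < r + d \<and> u \<le> t \<longrightarrow> (\<forall>p\<in>M. P u p)" by blast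
next
  fix r assume r: "s < r" "r \<le> t" and P: "\<And>u. s \<le> u \<Longrightarrow> u < r \<Longrightarrow> \<forall>p\<in>M. P u p"
  have "{s..r} \<subseteq> I" using r I by auto
  moreover have "P u (\<phi> x)" if "(U, \<phi>) \<in> A" "x \<in> U" "s \<le> u" "u < r" for U \<phi> x u
    using P[OF that(3,4)] closed_manifold_chart(2)[OF M that(1)] that(2) by blast
  ultimately show "\<forall>p\<in>M. P r p" using limit r(1) closed_manifold_cover[OF M] by metis
qed (use assms in simp_all)

lemma nonpos_limit:
  fixes f :: "real \<Rightarrow> real"
  assumes "continuous_on {a..t} f" "a < t" "\<And>u. a \<le> u \<Longrightarrow> u < t \<Longrightarrow> f u \<le> 0"
  shows "f t \<le> 0"
proof (rule tendsto_upperbound)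
  show "(f \<longlongrightarrow> f t) (at_left t)"
    using assms(1,2) continuous_on_Icc_at_leftD by blast
  show "\<forall>\<^sub>F u in at_left t. f u \<le> 0"
    using eventually_at_left_real[OF assms(2)] by eventually_elim (simp add: assms(3))
qed simp

section \<open>Preservation of pinching and of upper bounds for psi along the flow\<close>

context
  fixes M :: "'m::t2_space set" and A :: "'m chart set" and T :: ereal
    and X \<nu> :: "real \<Rightarrow> 'm \<Rightarrow> real^4" and \<kappa> :: "real \<Rightarrow> 'm \<Rightarrow> real^3"
  assumes M: "closed_manifold M A" and flow: "gauss_curvature_flow M A T X \<nu> \<kappa>"
    and convex: "\<And>t. t \<in> time_interval T \<Longrightarrow> strictly_convex M (\<kappa> t)"
begin

lemma chart:
  assumes "(U, \<phi>) \<in> A"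
  shows "\<exists>Y K N. curvature_chart U T (U \<times> time_interval T) Y K N (\<lambda>z. \<kappa> (snd z) (\<phi> (fst z)))"
  using curvature_chart_of_flow[OF flow convex assms closed_manifold_chart(1,2)[OF M assms]] by blast

lemma pinching_preserved:
  assumes pinched: "\<And>p i j. p \<in> M \<Longrightarrow> \<kappa> 0 p $ i \<le> 2 * \<kappa> 0 p $ j"
    and t: "t \<in> time_interval T" and p: "p \<in> M"
  shows "\<kappa> t p $ i \<le> 2 * \<kappa> t p $ j"
proof -
  have t0: "0 \<le> t" "0 \<in> time_interval T"
    using t by (auto simp: time_interval_def zero_ereal_def[symmetric])
      (metis ereal_less_eq(3) order.strict_trans1 zero_ereal_def)
  have "\<forall>p\<in>M. \<forall>i j. \<kappa> t p $ i \<le> 2 * \<kappa> t p $ j"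
  proof (rule preserved_on_closed_manifold[OF M time_interval_between[OF t t0(2)] t0(1)])
    show "\<forall>p\<in>M. \<forall>i j. \<kappa> 0 p $ i \<le> 2 * \<kappa> 0 p $ j" using pinched by blast
  next
    fix U \<phi> x s assume c: "(U, \<phi>) \<in> A" and x: "x \<in> U" and s: "s \<in> time_interval T"
      and P: "\<forall>p\<in>M. \<forall>i j. \<kappa> s p $ i \<le> 2 * \<kappa> s p $ j"
    obtain Y K N where "curvature_chart U T (U \<times> time_interval T) Y K N (\<lambda>z. \<kappa> (snd z) (\<phi> (fst z)))"
      using chart[OF c] by blast
    then interpret curvature_chart U T "U \<times> time_interval T" Y K N "\<lambda>z. \<kappa> (snd z) (\<phi> (fst z))" .
    have "\<kappa> (snd (y, s)) (\<phi> (fst (y, s))) $ i \<le> 2 * \<kappa> (snd (y, s)) (\<phi> (fst (y, s))) $ j" if "y \<in> U" for y i j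
      using P closed_manifold_chart(2)[OF M c] that by auto
    from pinching_persists[OF x s this, unfolded fst_conv snd_conv]
    obtain V d where "open V" "x \<in> V" "V \<subseteq> U" "d > 0" and
      "\<And>y u i j. y \<in> V \<Longrightarrow> u \<in> time_interval T \<Longrightarrow> s \<le> u \<Longrightarrow> u < s + d \<Longrightarrow>
        \<kappa> u (\<phi> y) $ i \<le> 2 * \<kappa> u (\<phi> y) $ j"
      by blast
    then show "\<exists>V d. open V \<and> x \<in> V \<and> V \<subseteq> U \<and> 0 < d \<and> (\<forall>y\<in>V. \<forall>u. u \<in> time_interval T \<and> s \<le> u \<and> u < s + d \<longrightarrow>
        (\<forall>i j. \<kappa> u (\<phi> y) $ i \<le> 2 * \<kappa> u (\<phi> y) $ j))"
      by blast
  next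
    fix U \<phi> x s assume c: "(U, \<phi>) \<in> A" and x: "x \<in> U" and s: "0 < s" "{0..s} \<subseteq> time_interval T"
      and P: "\<And>u. 0 \<le> u \<Longrightarrow> u < s \<Longrightarrow> \<forall>i j. \<kappa> u (\<phi> x) $ i \<le> 2 * \<kappa> u (\<phi> x) $ j"
    obtain Y K N where "curvature_chart U T (U \<times> time_interval T) Y K N (\<lambda>z. \<kappa> (snd z) (\<phi> (fst z)))"
      using chart[OF c] by blast
    then interpret curvature_chart U T "U \<times> time_interval T" Y K N "\<lambda>z. \<kappa> (snd z) (\<phi> (fst z))" .
    have in_S: "(x, u) \<in> U \<times> time_interval T" if "0 \<le> u" "u \<le> s" for u using that s x by auto
    have "defect v w (x, s) \<le> 0" for v w
    proof (rule nonpos_limit[of 0 s "\<lambda>s. defect v w (x, s)"])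
      show "continuous_on {0..s} (\<lambda>s. defect v w (x, s))"
        by (rule continuous_on_subset[OF continuous_pinching_defect[OF x] s(2)])
      show "defect v w (x, u) \<le> 0" if "0 \<le> u" "u < s" for u
        using pinched_iff[OF in_S[of u]] P[OF that] that by simp
    qed (rule s)
    then show "\<forall>i j. \<kappa> s (\<phi> x) $ i \<le> 2 * \<kappa> s (\<phi> x) $ j"
      using pinched_iff[OF in_S[of s]] s by simp
  qed
  then show ?thesis using p by blast
qed

text \<open>Restarting at time \<open>r\<close> from the bound \<open>c + eps * (r - s)\<close> with
  slope \<open>eps\<close> continues one and the same affine bound, so the relaxed inequality
  propagates from \<open>s\<close> to \<open>t\<close>. Letting \<open>eps\<close> tend to 0 removes
  the slack.\<close>

lemma psi_K_bound_preserved: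
  assumes pinched: "\<And>t p i j. t \<in> time_interval T \<Longrightarrow> p \<in> M \<Longrightarrow> \<kappa> t p $ i \<le> 2 * \<kappa> t p $ j"
    and s: "s \<in> time_interval T" and t: "t \<in> time_interval T" and st: "s \<le> t"
    and bound: "\<And>p. p \<in> M \<Longrightarrow> psi_K (\<kappa> s p) \<le> c" and p: "p \<in> M"
  shows "psi_K (\<kappa> t p) \<le> c"
proof -
  have growth: "\<forall>p\<in>M. psi_K (\<kappa> t p) \<le> c + eps * (t - s)" if eps: "eps > 0" for eps
  proof (rule preserved_on_closed_manifold[OF M time_interval_between[OF t s] st])
    show "\<forall>p\<in>M. psi_K (\<kappa> s p) \<le> c + eps * (s - s)" using bound by simp
  next
    fix U \<phi> x r assume c: "(U, \<phi>) \<in> A" and x: "x \<in> U" and r: "r \<in> time_interval T"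
      and P: "\<forall>p\<in>M. psi_K (\<kappa> r p) \<le> c + eps * (r - s)"
    obtain Y K N where "curvature_chart U T (U \<times> time_interval T) Y K N (\<lambda>z. \<kappa> (snd z) (\<phi> (fst z)))"
      using chart[OF c] by blast
    then interpret curvature_chart U T "U \<times> time_interval T" Y K N "\<lambda>z. \<kappa> (snd z) (\<phi> (fst z))" .
    have inM: "\<phi> y \<in> M" if "y \<in> U" for y using closed_manifold_chart(2)[OF M c] that by blast
    have hb: "psi_K (\<kappa> (snd (y, r)) (\<phi> (fst (y, r)))) \<le> c + eps * (r - s)" if "y \<in> U" for y
      using P inM[OF that] by simp
    have hp: "\<kappa> (snd (x, r)) (\<phi> (fst (x, r))) $ i \<le> 2 * \<kappa> (snd (x, r)) (\<phi> (fst (x, r))) $ j" for i j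
      using pinched[OF r inM[OF x]] by simp
    have eq: "c + eps * (r - s) + eps * (u - r) = c + eps * (u - s)" for u by (simp add: algebra_simps)
    from psi_K_persists[OF x r eps hp hb, unfolded fst_conv snd_conv eq]
    obtain V d where "open V" "x \<in> V" "V \<subseteq> U" "d > 0" and
      "\<And>y u. y \<in> V \<Longrightarrow> u \<in> time_interval T \<Longrightarrow> r \<le> u \<Longrightarrow> u < r + d \<Longrightarrow>
        psi_K (\<kappa> u (\<phi> y)) \<le> c + eps * (u - s)"
      by blast
    then show "\<exists>V d. open V \<and> x \<in> V \<and> V \<subseteq> U \<and> 0 < d \<and> (\<forall>y\<in>V. \<forall>u. u \<in> time_interval T \<and> r \<le> u \<and> u < r + d \<longrightarrow>
        psi_K (\<kappa> u (\<phi> y)) \<le> c + eps * (u - s))"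
      by blast
  next
    fix U \<phi> x r assume c: "(U, \<phi>) \<in> A" and x: "x \<in> U" and r: "s < r" "{s..r} \<subseteq> time_interval T"
      and P: "\<And>u. s \<le> u \<Longrightarrow> u < r \<Longrightarrow> psi_K (\<kappa> u (\<phi> x)) \<le> c + eps * (u - s)"
    obtain Y K N where "curvature_chart U T (U \<times> time_interval T) Y K N (\<lambda>z. \<kappa> (snd z) (\<phi> (fst z)))"
      using chart[OF c] by blast
    then interpret curvature_chart U T "U \<times> time_interval T" Y K N "\<lambda>z. \<kappa> (snd z) (\<phi> (fst z))" .
    have sub: "Pair x ` {s..r} \<subseteq> U \<times> time_interval T" using r x by auto
    have "continuous_on {s..r} (\<lambda>u. (x, u))" by (intro continuous_intros)
    from continuous_on_compose2[OF continuous_psi_K this sub]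
    have "continuous_on {s..r} (\<lambda>u. psi_K (\<kappa> u (\<phi> x)) - (c + eps * (u - s)))"
      by (intro continuous_intros) simp
    from nonpos_limit[OF this r(1)] show "psi_K (\<kappa> r (\<phi> x)) \<le> c + eps * (r - s)" using P by simp
  qed
  show ?thesis
  proof (cases "s = t")
    case False
    then have st': "t - s > 0" using st by simp
    show ?thesis
    proof (rule field_le_epsilon)
      fix e :: real assume "e > 0"
      then show "psi_K (\<kappa> t p) \<le> c + e" using growth[of "e / (t - s)"] p st' by simp
    qed
  qed (use bound p in simp)
qed

lemma continuous_on_psi_K:
  assumes t: "t \<in> time_interval T"
  shows "continuous_on M (\<lambda>p. psi_K (\<kappa> t p))"
  unfolding continuous_openin_preimage_eq
proof (intro allI impI)
  fix W :: "real set" assume W: "open W"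
  let ?f = "\<lambda>p. psi_K (\<kappa> t p)"
  have local: "openin (top_of_set M) (\<phi> ` U \<inter> ?f -` W)" if c: "(U, \<phi>) \<in> A" for U \<phi>
  proof -
    obtain Y K N where "curvature_chart U T (U \<times> time_interval T) Y K N (\<lambda>z. \<kappa> (snd z) (\<phi> (fst z)))"
      using chart[OF c] by blast
    then interpret curvature_chart U T "U \<times> time_interval T" Y K N "\<lambda>z. \<kappa> (snd z) (\<phi> (fst z))" .
    have sub: "(\<lambda>x. (x, t)) ` U \<subseteq> U \<times> time_interval T" using t by auto
    have "continuous_on U (\<lambda>x. (x, t))" by (intro continuous_intros)
    from continuous_on_compose2[OF continuous_psi_K this sub]
    have "continuous_on U (\<lambda>x. ?f (\<phi> x))" by simp
    then have "open (U \<inter> (\<lambda>x. ?f (\<phi> x)) -` W)"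
      using W open_U continuous_open_preimage by blast
    then have "openin (top_of_set M) (\<phi> ` (U \<inter> (\<lambda>x. ?f (\<phi> x)) -` W))"
      by (intro closed_manifold_chart(3)[OF M c]) auto
    moreover have "\<phi> ` (U \<inter> (\<lambda>x. ?f (\<phi> x)) -` W) = \<phi> ` U \<inter> ?f -` W" by auto
    ultimately show ?thesis by simp
  qed
  have "M \<inter> ?f -` W = (\<Union>c\<in>A. snd c ` fst c \<inter> ?f -` W)"
    using M by (auto simp: closed_manifold_def smooth_atlas_def case_prod_beta)
  moreover have "openin (top_of_set M) (\<Union>c\<in>A. snd c ` fst c \<inter> ?f -` W)"
    using local by (intro openin_Union) auto
  ultimately show "openin (top_of_set M) (M \<inter> ?f -` W)" by simp
qed

end

theorem lemma8p1:
  fixes M :: "'m::t2_space set" and A :: "'m chart set" and T :: ereal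
    and X :: "real \<Rightarrow> 'm \<Rightarrow> real^4"
    and \<nu> :: "real \<Rightarrow> 'm \<Rightarrow> real^4"
    and \<kappa> :: "real \<Rightarrow> 'm \<Rightarrow> real^3"
  assumes "closed_manifold M A"
    and "maximal_gauss_curvature_flow M A T X \<nu> \<kappa>"
    and "\<And>t. t \<in> time_interval T \<Longrightarrow> strictly_convex M (\<kappa> t)"
    and "two_pinched M (\<kappa> 0)"
  shows "antimono_on (time_interval T) (\<lambda>t. GREATEST y. y \<in> (\<lambda>p. psi_K (\<kappa> t p)) ` M)"
proof (cases "M = {}")
  case True
  \<comment> \<open>For empty \<open>M\<close> the image is the same empty set at all times, so
    \<open>GREATEST\<close> denotes one fixed, unspecified number.\<close>
  then show ?thesis by (simp add: monotone_on_def)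
next
  case False
  have flow: "gauss_curvature_flow M A T X \<nu> \<kappa>"
    using assms(2) by (simp add: maximal_gauss_curvature_flow_def)
  have T: "0 \<in> time_interval T"
    using flow by (simp add: gauss_curvature_flow_def time_interval_def zero_ereal_def[symmetric])
  have "\<kappa> 0 p $ i \<le> 2 * \<kappa> 0 p $ j" if "p \<in> M" for p i j
  proof -
    have "\<kappa> 0 p $ j > 0" using assms(3)[OF T] that by (simp add: strictly_convex_def)
    moreover have "\<kappa> 0 p $ i / \<kappa> 0 p $ j \<le> 2" using assms(4) that by (simp add: two_pinched_def)
    ultimately show ?thesis by (simp add: field_simps)
  qed
  note pinched = pinching_preserved[OF assms(1) flow assms(3) this]
  \<comment> \<open>Continuity on the compact manifold provides a maximizer, and with it
    \<open>GREATEST\<close> is the actual maximum.\<close>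
  have max: "\<exists>q\<in>M. (GREATEST y. y \<in> (\<lambda>p. psi_K (\<kappa> t p)) ` M) = psi_K (\<kappa> t q)
      \<and> (\<forall>p\<in>M. psi_K (\<kappa> t p) \<le> psi_K (\<kappa> t q))" if t: "t \<in> time_interval T" for t
  proof -
    obtain q where q: "q \<in> M" "\<forall>p\<in>M. psi_K (\<kappa> t p) \<le> psi_K (\<kappa> t q)"
      using continuous_attains_sup[OF _ False continuous_on_psi_K[OF assms(1) flow assms(3) t]]
        assms(1) closed_manifold_def by blast
    moreover have "(GREATEST y. y \<in> (\<lambda>p. psi_K (\<kappa> t p)) ` M) = psi_K (\<kappa> t q)"
      using q by (intro Greatest_equality) auto
    ultimately show ?thesis by blast
  qed
  show ?thesis
  proof (rule monotone_onI)
    fix s t assume st: "s \<in> time_interval T" "t \<in> time_interval T" "s \<le> t"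
    obtain q where q: "(GREATEST y. y \<in> (\<lambda>p. psi_K (\<kappa> s p)) ` M) = psi_K (\<kappa> s q)"
      "\<forall>p\<in>M. psi_K (\<kappa> s p) \<le> psi_K (\<kappa> s q)" using max[OF st(1)] by blast
    obtain r where r: "r \<in> M" "(GREATEST y. y \<in> (\<lambda>p. psi_K (\<kappa> t p)) ` M) = psi_K (\<kappa> t r)"
      using max[OF st(2)] by blast
    show "(GREATEST y. y \<in> (\<lambda>p. psi_K (\<kappa> t p)) ` M) \<le> (GREATEST y. y \<in> (\<lambda>p. psi_K (\<kappa> s p)) ` M)"
      unfolding q(1) r(2)
      using psi_K_bound_preserved[OF assms(1) flow assms(3) pinched st] q(2) r(1) by blast
  qed
qed

end
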